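(* Let $n \geq 3$. Dehornoy's ordering $\preceq_D$ on the braid group $B_n$ is an accumulation point (in $\mathcal{O}(B_n)$) of its orbit under the right (conjugacy) action of $B_n$; that is, it may be approximated by its conjugates. Consequently, its positive cone $\{g \in B_n : g \succ_D id\}$ is not finitely generated as a semigroup. Moreover, there exists a sequence of conjugates of Dubrovina-Dubrovin's ordering $\preceq_{DD}$ on $B_n$ that converges to $\preceq_D$ in $\mathcal{O}(B_n)$ as well.
   Context: An ordering on a group $\Gamma$ is a left-invariant total order on $\Gamma$ ($g \preceq h$ implies $fg \preceq fh$); its positive cone is $P^+_{\preceq} = \{g : g \succ id\}$, which determines it ($f \prec g$ iff $f^{-1}g \in P^+_{\preceq}$). $\mathcal{O}(\Gamma)$ is the set of orderings on $\Gamma$, with the topology having as sub-basis the sets $U_{f,g} = \{\preceq \,:\, f \prec g\}$, $f \neq g$. The group $\Gamma$ acts on $\mathcal{O}(\Gamma)$ by conjugacy (equivalently, by right multiplication): for $f \in \Gamma$, the conjugate $\preceq_f$ of $\preceq$ is defined by $g \preceq_f h$ iff $fgf^{-1} \preceq fhf^{-1}$ (equivalently $gf^{-1} \preceq hf^{-1}$). $B_n$ has the presentation with generators $\sigma_1,\ldots,\sigma_{n-1}$ and relations $\sigma_i\sigma_{i+1}\sigma_i = \sigma_{i+1}\sigma_i\sigma_{i+1}$ for $1 \le i \le n-2$ and $\sigma_i\sigma_j=\sigma_j\sigma_i$ for $|i-j|\ge 2$. An element of $B_n$ is $\sigma_i$-positive if it can be written as $w_1\sigma_i^{n_1}w_2\sigma_i^{n_2}\cdots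 w_k\sigma_i^{n_k}w_{k+1}$, with $k \ge 1$, where the $w_j$ are words in $\sigma_{i+1}^{\pm1},\ldots,\sigma_{n-1}^{\pm1}$ and all the exponents $n_j$ are positive. It is $\sigma$-positive if it is $\sigma_i$-positive for some $i \in \{1,\ldots,n-1\}$. By a theorem of Dehornoy, the set of $\sigma$-positive elements is the positive cone of an ordering $\preceq_D$ on $B_n$, called Dehornoy's ordering. For an ordering $\preceq$, let $\bar{\preceq}$ be the reverse ordering, whose positive elements are those $g$ with $g \prec id$. A subgroup $\Gamma_*$ is $\preceq$-convex if $f \prec h \prec g$ with $f,g\in\Gamma_*$ implies $h \in \Gamma_*$. If $\Gamma_*$ is $\preceq$-convex and $\preceq_*$ is an ordering on $\Gamma_*$, the extension of $\preceq_*$ by $\preceq$ is the ordering on $\Gamma$ with positive cone $(P^+_{\preceq}\setminus\Gamma_* )\cup P^+_{\preceq_*}$. Dubrovina-Dubrovin's ordering $\preceq_{DD}$ on $B_n$ is the ordering $\preceq_n$ defined inductively: $\preceq_2$ is Dehornoy's ordering on $B_2 = \langle\sigma_1\rangle$; for $n \ge 3$, identify $B_{n-1} = \langle \tilde\sigma_1,\ldots,\tilde\sigma_{n-2}\rangle$ with the ($\preceq_D$-convex) subgroup $\langle\sigma_2,\ldots,\sigma_{n-1}\rangle$ of $B_n$ via $\tilde\sigma_i \mapsto \sigma_{i+1}$, and let $\preceq_n$ be the extension of $\bar{\preceq}_{n-1}$ by $\preceq_D$. (Equivalently, the positive cone of $\preceq_n$ is the semigroup generated by $u_1,\ldots,u_{n-1}$,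 where $u_i = (\sigma_i\sigma_{i+1}\cdots\sigma_{n-1})^{(-1)^{i-1}}$.) *)

theory Defs
  imports "HOL-Algebra.Generated_Groups" "HOL-Analysis.Abstract_Limits"
begin

section \<open>Groups given by generators and relations\<close>

text \<open>The letter \<open>(x, True)\<close> stands for the generator \<open>x\<close> and \<open>(x, False)\<close> for its formal inverse.\<close>

type_synonym 'a gword = "('a \<times> bool) list"

inductive word_cong :: "'a set \<Rightarrow> ('a gword \<times> 'a gword) set \<Rightarrow> 'a gword \<Rightarrow> 'a gword \<Rightarrow> bool"
  for S :: "'a set" and R :: "('a gword \<times> 'a gword) set" where
  refl: "w \<in> lists (S \<times> UNIV) \<Longrightarrow> word_cong S R w w"
| sym: "word_cong S R u v \<Longrightarrow> word_cong S R v u"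
| trans: "word_cong S R u v \<Longrightarrow> word_cong S R v w \<Longrightarrow> word_cong S R u w"
| append: "word_cong S R u u' \<Longrightarrow> word_cong S R v v' \<Longrightarrow> word_cong S R (u @ v) (u' @ v')"
| cancel: "x \<in> S \<Longrightarrow> word_cong S R [(x, b), (x, \<not> b)] []"
| rel: "(u, v) \<in> R \<Longrightarrow> u \<in> lists (S \<times> UNIV) \<Longrightarrow> v \<in> lists (S \<times> UNIV) \<Longrightarrow> word_cong S R u v"

definition word_cong_rel :: "'a set \<Rightarrow> ('a gword \<times> 'a gword) set \<Rightarrow> ('a gword \<times> 'a gword) set" where
  "word_cong_rel S R = {(u, v). word_cong S R u v}"

definition presented_group :: "'a set \<Rightarrow> ('a gword \<times> 'a gword) set \<Rightarrow> 'a gword set monoid" where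
  "presented_group S R =
     \<lparr>carrier = lists (S \<times> UNIV) // word_cong_rel S R,
      mult = (\<lambda>X Y. \<Union>u\<in>X. \<Union>v\<in>Y. word_cong_rel S R `` {u @ v}),
      one = word_cong_rel S R `` {[]}\<rparr>"

lemma word_cong_in_lists:
  assumes "word_cong S R u v"
  shows "u \<in> lists (S \<times> UNIV) \<and> v \<in> lists (S \<times> UNIV)"
  using assms by induction auto

lemma equiv_word_cong_rel: "equiv (lists (S \<times> UNIV)) (word_cong_rel S R)"
  unfolding equiv_def
proof (intro conjI)
  show "word_cong_rel S R \<subseteq> lists (S \<times> UNIV) \<times> lists (S \<times> UNIV)"
    using word_cong_in_lists by (fastforce simp: word_cong_rel_def)
  show "refl_on (lists (S \<times> UNIV)) (word_cong_rel S R)"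
    by (auto simp: refl_on_def word_cong_rel_def intro: word_cong.refl)
  show "sym (word_cong_rel S R)"
    by (simp add: sym_def word_cong_rel_def word_cong.sym)
  show "trans (word_cong_rel S R)"
    unfolding trans_def word_cong_rel_def by (simp, iprover intro: word_cong.trans)
qed

lemma presented_mult_class:
  assumes "u \<in> lists (S \<times> UNIV)" "v \<in> lists (S \<times> UNIV)"
  shows "word_cong_rel S R `` {u} \<otimes>\<^bsub>presented_group S R\<^esub> word_cong_rel S R `` {v}
       = word_cong_rel S R `` {u @ v}"
proof -
  let ?E = "word_cong_rel S R"
  have eq: "?E `` {u' @ v'} = ?E `` {u @ v}" if "u' \<in> ?E `` {u}" "v' \<in> ?E `` {v}" for u' v'
  proof -
    have "(u @ v, u' @ v') \<in> ?E"
      using that by (simp add: word_cong_rel_def word_cong.append)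
    then show ?thesis by (rule equiv_class_eq[OF equiv_word_cong_rel, symmetric])
  qed
  have ne: "?E `` {u} \<noteq> {}" "?E `` {v} \<noteq> {}"
    using assms equiv_class_self[OF equiv_word_cong_rel] by blast+
  have "(\<Union>u'\<in>?E `` {u}. \<Union>v'\<in>?E `` {v}. ?E `` {u' @ v'})
      = (\<Union>u'\<in>?E `` {u}. \<Union>v'\<in>?E `` {v}. ?E `` {u @ v})"
    by (intro SUP_cong HOL.refl eq)
  also have "\<dots> = ?E `` {u @ v}"
    using ne by simp
  finally show ?thesis
    by (simp add: presented_group_def)
qed

lemma word_cong_inverse:
  assumes "w \<in> lists (S \<times> UNIV)"
  shows "word_cong S R (rev (map (\<lambda>(x, b). (x, \<not> b)) w) @ w) []"
  using assms
proof (induction w)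
  case Nil
  then show ?case by (simp add: word_cong.refl)
next
  case (Cons a w)
  obtain x b where a: "a = (x, b)" by (cases a)
  let ?v = "rev (map (\<lambda>(x, b). (x, \<not> b)) w)"
  have v: "?v \<in> lists (S \<times> UNIV)" and w: "w \<in> lists (S \<times> UNIV)" and x: "x \<in> S"
    using Cons.hyps Cons.prems a by auto
  have "word_cong S R [(x, \<not> b), (x, b)] []"
    using word_cong.cancel[OF x, of R "\<not> b"] by simp
  then have "word_cong S R (?v @ [(x, \<not> b), (x, b)] @ w) (?v @ [] @ w)"
    by (intro word_cong.append word_cong.refl v w)
  then show ?case
    using Cons.IH word_cong.trans a by fastforce
qed

lemma group_presented_group: "group (presented_group S R)"
proof (rule groupI)
  let ?G = "presented_group S R"
  let ?L = "lists (S \<times> (UNIV :: bool set))"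
  have carr: "carrier ?G = ?L // word_cong_rel S R"
    and one: "\<one>\<^bsub>?G\<^esub> = word_cong_rel S R `` {[]}"
    by (simp_all add: presented_group_def)
  show "\<one>\<^bsub>?G\<^esub> \<in> carrier ?G"
    unfolding carr one by (intro quotientI) simp
  fix X assume "X \<in> carrier ?G"
  then obtain u where u: "u \<in> ?L" "X = word_cong_rel S R `` {u}"
    unfolding carr by (rule quotientE)
  show "\<one>\<^bsub>?G\<^esub> \<otimes>\<^bsub>?G\<^esub> X = X"
    unfolding one u(2) using presented_mult_class[of "[]" S u R] u(1) by simp
  let ?v = "rev (map (\<lambda>(x, b). (x, \<not> b)) u)"
  have v: "?v \<in> ?L" using u(1) by auto
  have "word_cong_rel S R `` {?v} \<otimes>\<^bsub>?G\<^esub> X = \<one>\<^bsub>?G\<^esub>"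
    unfolding one u(2) presented_mult_class[OF v u(1)]
    by (rule equiv_class_eq[OF equiv_word_cong_rel])
      (simp add: word_cong_rel_def word_cong_inverse[OF u(1)])
  then show "\<exists>Y\<in>carrier ?G. Y \<otimes>\<^bsub>?G\<^esub> X = \<one>\<^bsub>?G\<^esub>"
    unfolding carr using quotientI[OF v] by blast
  fix Y assume "Y \<in> carrier ?G"
  then obtain v where v: "v \<in> ?L" "Y = word_cong_rel S R `` {v}"
    unfolding carr by (rule quotientE)
  show "X \<otimes>\<^bsub>?G\<^esub> Y \<in> carrier ?G"
    unfolding u(2) v(2) presented_mult_class[OF u(1) v(1)] carr
    using u(1) v(1) by (intro quotientI) simp
  fix Z assume "Z \<in> carrier ?G"
  then obtain w where w: "w \<in> ?L" "Z = word_cong_rel S R `` {w}"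
    unfolding carr by (rule quotientE)
  have "u @ v \<in> ?L" "v @ w \<in> ?L" using u v w by auto
  then show "X \<otimes>\<^bsub>?G\<^esub> Y \<otimes>\<^bsub>?G\<^esub> Z = X \<otimes>\<^bsub>?G\<^esub> (Y \<otimes>\<^bsub>?G\<^esub> Z)"
    using u v w by (simp add: presented_mult_class)
qed


section \<open>The space of orderings of a group\<close>

text \<open>An ordering is represented by its non-strict relation \<open>{(f, g). f \<preceq> g}\<close> on the carrier.\<close>

definition left_orderings :: "('a, 'b) monoid_scheme \<Rightarrow> 'a rel set" where
  "left_orderings G = {r. linear_order_on (carrier G) r \<and>
     (\<forall>f\<in>carrier G. \<forall>g\<in>carrier G. \<forall>h\<in>carrier G.
        (g, h) \<in> r \<longrightarrow> (f \<otimes>\<^bsub>G\<^esub> g, f \<otimes>\<^bsub>G\<^esub> h) \<in> r)}"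

definition positive_cone :: "('a, 'b) monoid_scheme \<Rightarrow> 'a rel \<Rightarrow> 'a set" where
  "positive_cone G r = {g \<in> carrier G. (\<one>\<^bsub>G\<^esub>, g) \<in> r \<and> g \<noteq> \<one>\<^bsub>G\<^esub>}"

definition ordering_of_cone :: "('a, 'b) monoid_scheme \<Rightarrow> 'a set \<Rightarrow> 'a rel" where
  "ordering_of_cone G P =
     {(f, g). f \<in> carrier G \<and> g \<in> carrier G \<and> (f = g \<or> inv\<^bsub>G\<^esub> f \<otimes>\<^bsub>G\<^esub> g \<in> P)}"

text \<open>The whole set is included in the sub-basis only so that the trivial group, which has no
  pair \<open>f \<noteq> g\<close>, also gets the correct underlying space.\<close>

definition ordering_topology :: "('a, 'b) monoid_scheme \<Rightarrow> 'a rel topology" where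
  "ordering_topology G = topology_generated_by
     (insert (left_orderings G)
        {{r \<in> left_orderings G. (f, g) \<in> r} |f g. f \<in> carrier G \<and> g \<in> carrier G \<and> f \<noteq> g})"

definition conjugate_ordering :: "('a, 'b) monoid_scheme \<Rightarrow> 'a rel \<Rightarrow> 'a \<Rightarrow> 'a rel" where
  "conjugate_ordering G r f =
     {(g, h). g \<in> carrier G \<and> h \<in> carrier G \<and>
        (f \<otimes>\<^bsub>G\<^esub> g \<otimes>\<^bsub>G\<^esub> inv\<^bsub>G\<^esub> f, f \<otimes>\<^bsub>G\<^esub> h \<otimes>\<^bsub>G\<^esub> inv\<^bsub>G\<^esub> f) \<in> r}"

definition conjugacy_orbit :: "('a, 'b) monoid_scheme \<Rightarrow> 'a rel \<Rightarrow> 'a rel set" where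
  "conjugacy_orbit G r = conjugate_ordering G r ` carrier G"

text \<open>The extension by \<open>r\<close> of an ordering \<open>s\<close> given on the \<open>r\<close>-convex subgroup \<open>H\<close>.\<close>

definition extension_ordering ::
    "('a, 'b) monoid_scheme \<Rightarrow> 'a set \<Rightarrow> 'a rel \<Rightarrow> 'a rel \<Rightarrow> 'a rel" where
  "extension_ordering G H s r = ordering_of_cone G
     ((positive_cone G r - H) \<union> positive_cone (G\<lparr>carrier := H\<rparr>) s)"

inductive_set semigroup_generated :: "('a, 'b) monoid_scheme \<Rightarrow> 'a set \<Rightarrow> 'a set"
  for G :: "('a, 'b) monoid_scheme" and A :: "'a set" where
  incl: "a \<in> A \<Longrightarrow> a \<in> semigroup_generated G A"
| mult: "a \<in> semigroup_generated G A \<Longrightarrow> b \<in> semigroup_generated G A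
    \<Longrightarrow> a \<otimes>\<^bsub>G\<^esub> b \<in> semigroup_generated G A"

definition finitely_generated_semigroup :: "('a, 'b) monoid_scheme \<Rightarrow> 'a set \<Rightarrow> bool" where
  "finitely_generated_semigroup G P \<longleftrightarrow>
     (\<exists>A. finite A \<and> A \<subseteq> carrier G \<and> semigroup_generated G A = P)"


section \<open>Braid groups\<close>

definition braid_relations :: "nat \<Rightarrow> (nat gword \<times> nat gword) set" where
  "braid_relations n =
     {([(i, True), (i + 1, True), (i, True)], [(i + 1, True), (i, True), (i + 1, True)]) |i.
        1 \<le> i \<and> i + 2 \<le> n} \<union>
     {([(i, True), (j, True)], [(j, True), (i, True)]) |i j.
        i \<in> {1..<n} \<and> j \<in> {1..<n} \<and> (i + 2 \<le> j \<or> j + 2 \<le> i)}"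

definition braid_group :: "nat \<Rightarrow> nat gword set monoid" where
  "braid_group n = presented_group {1..<n} (braid_relations n)"

definition braid_class :: "nat \<Rightarrow> nat gword \<Rightarrow> nat gword set" where
  "braid_class n w = word_cong_rel {1..<n} (braid_relations n) `` {w}"

definition braid_gen :: "nat \<Rightarrow> nat \<Rightarrow> nat gword set" where
  "braid_gen n i = braid_class n [(i, True)]"

lemma group_braid_group: "group (braid_group n)"
  unfolding braid_group_def by (rule group_presented_group)

lemma braid_class_in_carrier:
  "w \<in> lists ({1..<n} \<times> UNIV) \<Longrightarrow> braid_class n w \<in> carrier (braid_group n)"
  by (simp add: braid_class_def braid_group_def presented_group_def quotientI)

lemma braid_class_append:
  assumes "u \<in> lists ({1..<n} \<times> UNIV)" "v \<in> lists ({1..<n} \<times> UNIV)"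
  shows "braid_class n u \<otimes>\<^bsub>braid_group n\<^esub> braid_class n v = braid_class n (u @ v)"
  unfolding braid_class_def braid_group_def by (rule presented_mult_class[OF assms])

text \<open>Each pair \<open>(w, m)\<close> in \<open>ps\<close> contributes a factor \<open>w \<sigma>\<^sub>i\<^sup>m\<close>; \<open>v\<close> is the last word \<open>w\<^bsub>k+1\<^esub>\<close>.\<close>

definition sigma_i_positive :: "nat \<Rightarrow> nat \<Rightarrow> nat gword set \<Rightarrow> bool" where
  "sigma_i_positive n i g \<longleftrightarrow>
     (\<exists>(ps :: (nat gword \<times> nat) list) v. ps \<noteq> [] \<and>
        (\<forall>(w, m)\<in>set ps. w \<in> lists ({i + 1..<n} \<times> UNIV) \<and> m > 0) \<and>
        v \<in> lists ({i + 1..<n} \<times> UNIV) \<and>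
        g = braid_class n (concat (map (\<lambda>(w, m). w @ replicate m (i, True)) ps) @ v))"

definition sigma_positive :: "nat \<Rightarrow> nat gword set \<Rightarrow> bool" where
  "sigma_positive n g \<longleftrightarrow> (\<exists>i\<in>{1..<n}. sigma_i_positive n i g)"

definition dehornoy_ordering :: "nat \<Rightarrow> nat gword set rel" where
  "dehornoy_ordering n = ordering_of_cone (braid_group n) {g. sigma_positive n g}"

text \<open>The homomorphism from the braid group on \<open>n - 1\<close> strands to the one on \<open>n\<close> strands that
  sends \<open>\<sigma>\<^sub>i\<close> to \<open>\<sigma>\<^bsub>i+1\<^esub>\<close>, and the subgroup generated by \<open>\<sigma>\<^sub>2, \<dots>, \<sigma>\<^bsub>n-1\<^esub>\<close>, which is its image.\<close>

definition braid_shift :: "nat \<Rightarrow> nat gword set \<Rightarrow> nat gword set" where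
  "braid_shift n X = (\<Union>w\<in>X. braid_class n (map (\<lambda>(i, b). (i + 1, b)) w))"

definition shifted_subgroup :: "nat \<Rightarrow> nat gword set set" where
  "shifted_subgroup n = generate (braid_group n) (braid_gen n ` {2..<n})"

text \<open>For \<open>n \<le> 1\<close> the group is trivial and the value is its unique ordering.\<close>

fun dubrovina_ordering :: "nat \<Rightarrow> nat gword set rel" where
  "dubrovina_ordering n =
     (if n \<le> 2 then dehornoy_ordering n
      else extension_ordering (braid_group n) (shifted_subgroup n)
        (map_prod (braid_shift n) (braid_shift n) ` ((dubrovina_ordering (n - 1))\<inverse>))
        (dehornoy_ordering n))"

declare dubrovina_ordering.simps [simp del]

end

theory Submission
  imports Defs
begin

text \<open>
  That the \<open>\<sigma>\<close>-positive elements form a positive cone is obtained as follows. A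
  \<open>\<sigma>\<^sub>i\<close>-positive braid is not trivial because its action makes one of the Dynnikov
  coordinates of the trivial lamination positive. For the comparison of two braids, write a braid as a
  fraction \<open>a\<^sup>-\<^sup>1b\<close> of positive braids and choose a common multiple \<open>m\<close> of \<open>a\<close> and \<open>b\<close>. In the
  finite graph of left divisors of \<open>m\<close>, a path from \<open>a\<close> to \<open>b\<close> is rectified by Dehornoy's handle
  reduction: Garside's lemma keeps the reduced path inside the graph, and every reduction at a
  turning point moves that point strictly down (or up) for the relation ``joined by a
  \<open>\<sigma>\<^sub>i\<close>-positive path'', which is well-founded since the graph is finite and the relation acyclic.

  For the theorem itself, conjugation by \<open>\<Delta>\<^bsup>-2k\<^esup>\<sigma>\<^sub>j\<close>, with \<open>\<Delta>\<^sup>2\<close> the full twist on the strands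
  moved by \<open>\<sigma>\<^bsub>j+1\<^esub>, \<dots>, \<sigma>\<^bsub>n-1\<^esub>\<close>, turns \<open>\<sigma>\<^bsub>j+1\<^esub>\<close>-positive elements into \<open>\<sigma>\<^sub>j\<close>-positive ones
  and, for large \<open>k\<close>, keeps any given \<open>\<sigma>\<^sub>j\<close>-positive element \<open>\<sigma>\<^sub>j\<close>-positive. Hence every finite
  set of positive elements has a conjugate consisting of \<open>\<sigma>\<^sub>1\<close>-positive elements. Such elements
  are positive for both orderings, which gives the two limits; the conjugates differ from
  \<open>\<preceq>\<^sub>D\<close> because its least positive element \<open>\<sigma>\<^bsub>n-1\<^esub>\<close> is not \<open>\<sigma>\<^sub>1\<close>-positive; and a finite
  generating set of the cone would be positive for one of these other orderings, which is impossible.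
\<close>

section \<open>Sigma-positive words\<close>

text \<open>Trades the block form of a sigma_i-positive word for a condition on single letters,
  which concatenation and induction on words respect.\<close>

definition sigma_alphabet :: "nat \<Rightarrow> nat \<Rightarrow> (nat \<times> bool) set" where
  "sigma_alphabet n i = insert (i, True) ({i + 1..<n} \<times> UNIV)"

text \<open>Built up from the back of the word: each letter \<open>(i, True)\<close> opens a block
  of its own with empty word and exponent 1; any other letter is put in front of the first block, or
  of the tail \<open>v\<close> if there is no block yet.\<close>

lemma sigma_word_decomposition:
  assumes "w \<in> lists (sigma_alphabet n i)"
  shows "\<exists>ps v. (\<forall>(u, m)\<in>set ps. u \<in> lists ({i + 1..<n} \<times> UNIV) \<and> m > 0) \<and>
     v \<in> lists ({i + 1..<n} \<times> UNIV) \<and>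
     w = concat (map (\<lambda>(u, m). u @ replicate m (i, True)) ps) @ v"
  using assms
proof (induction w)
  case Nil
  show ?case by (rule exI[of _ "[]"], rule exI[of _ "[]"]) simp
next
  case (Cons l w)
  then obtain ps v where ps: "\<forall>(u, m)\<in>set ps. u \<in> lists ({i + 1..<n} \<times> UNIV) \<and> m > 0"
    and v: "v \<in> lists ({i + 1..<n} \<times> UNIV)"
    and w: "w = concat (map (\<lambda>(u, m). u @ replicate m (i, True)) ps) @ v"
    by auto
  consider "l = (i, True)" | "l \<in> {i + 1..<n} \<times> UNIV" "ps = []"
    | u m ps' where "l \<in> {i + 1..<n} \<times> UNIV" "ps = (u, m) # ps'"
    using Cons.hyps(1) unfolding sigma_alphabet_def by (cases ps) (blast, metis insertE list.discI surj_pair)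
  then show ?case
  proof cases
    case 1
    show ?thesis
      by (rule exI[of _ "([], 1) # ps"], rule exI[of _ v]) (use ps v w 1 in auto)
  next
    case 2
    show ?thesis
      by (rule exI[of _ "[]"], rule exI[of _ "l # v"]) (use v w 2 in auto)
  next
    case 3
    show ?thesis
      by (rule exI[of _ "(l # u, m) # ps'"], rule exI[of _ v]) (use ps v w 3 in auto)
  qed
qed

lemma sigma_i_positive_iff:
  "sigma_i_positive n i g \<longleftrightarrow>
     (\<exists>w\<in>lists (sigma_alphabet n i). (i, True) \<in> set w \<and> g = braid_class n w)"
proof
  assume "sigma_i_positive n i g"
  then obtain ps v where ps: "ps \<noteq> []"
    "\<forall>(u, m)\<in>set ps. u \<in> lists ({i + 1..<n} \<times> UNIV) \<and> m > (0::nat)"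
    and v: "v \<in> lists ({i + 1..<n} \<times> UNIV)"
    and g: "g = braid_class n (concat (map (\<lambda>(u, m). u @ replicate m (i, True)) ps) @ v)"
    unfolding sigma_i_positive_def by blast
  let ?w = "concat (map (\<lambda>(u, m). u @ replicate m (i, True)) ps) @ v"
  have "?w \<in> lists (sigma_alphabet n i)"
    using ps(2) v by (fastforce simp: sigma_alphabet_def in_lists_conv_set)
  moreover have "(i, True) \<in> set ?w"
    using ps by (cases ps) auto
  ultimately show "\<exists>w\<in>lists (sigma_alphabet n i). (i, True) \<in> set w \<and> g = braid_class n w"
    using g by blast
next
  assume "\<exists>w\<in>lists (sigma_alphabet n i). (i, True) \<in> set w \<and> g = braid_class n w"
  then obtain w where w: "w \<in> lists (sigma_alphabet n i)" "(i, True) \<in> set w"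
    and g: "g = braid_class n w" by blast
  obtain ps v where ps: "\<forall>(u, m)\<in>set ps. u \<in> lists ({i + 1..<n} \<times> UNIV) \<and> m > (0::nat)"
    and v: "v \<in> lists ({i + 1..<n} \<times> UNIV)"
    and d: "w = concat (map (\<lambda>(u, m). u @ replicate m (i, True)) ps) @ v"
    using sigma_word_decomposition[OF w(1)] by blast
  have "ps \<noteq> []" using w(2) d v by auto
  then show "sigma_i_positive n i g"
    unfolding sigma_i_positive_def using ps v g d by blast
qed

section \<open>Dynnikov coordinates\<close>

type_synonym coords = "(int \<times> int) \<times> int \<times> int"

text \<open>Dynnikov's formulas for the action of \<open>\<sigma>\<^sub>i\<close> on the coordinates of index \<open>i\<close> and
  \<open>i + 1\<close> of an integral lamination. All that matters here is that they satisfy the braid relation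
  and that \<open>\<sigma>\<^sub>i\<close> cannot decrease the first coordinate.\<close>

fun dyn :: "coords \<Rightarrow> coords" where
  "dyn ((x1, y1), (x2, y2)) =
    (let z = x1 - min y1 0 - x2 + max y2 0 in
     ((x1 + max y1 0 + max (max y2 0 - z) 0, y2 - max z 0),
      (x2 + min y2 0 + min (min y1 0 + z) 0, y1 + max z 0)))"

fun dyn_inv :: "coords \<Rightarrow> coords" where
  "dyn_inv ((x1, y1), (x2, y2)) =
    (let z = x1 + min y1 0 - x2 - max y2 0 in
     ((x1 - max y1 0 - max (max y2 0 + z) 0, y2 + min z 0),
      (x2 - min y2 0 - min (min y1 0 - z) 0, y1 - min z 0)))"

lemma dyn_dyn_inv: "dyn (dyn_inv p) = p" and dyn_inv_dyn: "dyn_inv (dyn p) = p"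
  by (cases p, cases "fst p", cases "snd p"; simp add: Let_def max_def min_def; fail)+

text \<open>Both sides of the braid relation with every intermediate value named: \<open>z1\<close>
  to \<open>f2\<close> trace the action at positions (1,2), (2,3), (1,2), and \<open>w1\<close> to
  \<open>u3\<close> at (2,3), (1,2), (2,3). The claim is piecewise linear, so case distinctions on
  signs settle it.\<close>

lemma dyn_braid_arith:
  fixes x1 x2 x3 y1 y2 y3 :: int
  assumes "z1 = x1 - min y1 0 - x2 + max y2 0"
    "a1 = x1 + max y1 0 + max (max y2 0 - z1) 0" "b1 = y2 - max z1 0"
    "a2 = x2 + min y2 0 + min (min y1 0 + z1) 0" "b2 = y1 + max z1 0"
    "z2 = a2 - min b2 0 - x3 + max y3 0"
    "c2 = a2 + max b2 0 + max (max y3 0 - z2) 0" "d2 = y3 - max z2 0"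
    "c3 = x3 + min y3 0 + min (min b2 0 + z2) 0" "d3 = b2 + max z2 0"
    "z3 = a1 - min b1 0 - c2 + max d2 0"
    "e1 = a1 + max b1 0 + max (max d2 0 - z3) 0" "f1 = d2 - max z3 0"
    "e2 = c2 + min d2 0 + min (min b1 0 + z3) 0" "f2 = b1 + max z3 0"
    "w1 = x2 - min y2 0 - x3 + max y3 0"
    "p2 = x2 + max y2 0 + max (max y3 0 - w1) 0" "q2 = y3 - max w1 0"
    "p3 = x3 + min y3 0 + min (min y2 0 + w1) 0" "q3 = y2 + max w1 0"
    "w2 = x1 - min y1 0 - p2 + max q2 0"
    "r1 = x1 + max y1 0 + max (max q2 0 - w2) 0" "s1 = q2 - max w2 0"
    "r2 = p2 + min q2 0 + min (min y1 0 + w2) 0" "s2 = y1 + max w2 0"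
    "w3 = r2 - min s2 0 - p3 + max q3 0"
    "t2 = r2 + max s2 0 + max (max q3 0 - w3) 0" "u2 = q3 - max w3 0"
    "t3 = p3 + min q3 0 + min (min s2 0 + w3) 0" "u3 = s2 + max w3 0"
  shows "e1 = r1" "f1 = s1" "e2 = t2" "f2 = u2" "c3 = t3" "d3 = u3"
proof -
  show "e1 = r1" using assms(1,2,3,4,5,6,7,8,11,12,16,17,18,21,22) by smt
  show f: "f1 = s1" using assms(1,2,3,4,5,6,7,8,11,13,16,17,18,21,23) by smt
  show "e2 = t2" using assms(1,2,3,4,5,6,7,8,11,14,16,17,18,19,20,21,24,25,26,27) by smt
  show d: "d3 = u3" using assms(1,4,5,6,10,16,17,18,19,20,21,24,25,26,30) by smt
  \<comment> \<open>Each application of \<open>dyn\<close> preserves the sum of the two second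
    coordinates, so this equality follows from the other two.\<close>
  show "f2 = u2" using f d assms(3,5,8,10,13,15,18,20,23,25,28,30) by linarith
  show "c3 = t3" using assms(1,4,5,6,9,16,17,18,19,20,21,24,25,26,29) by smt
qed

lemma dyn_eqD:
  assumes "dyn ((x1, y1), (x2, y2)) = ((a1, b1), (a2, b2))" "z = x1 - min y1 0 - x2 + max y2 0"
  shows "a1 = x1 + max y1 0 + max (max y2 0 - z) 0" "b1 = y2 - max z 0"
    "a2 = x2 + min y2 0 + min (min y1 0 + z) 0" "b2 = y1 + max z 0"
  using assms(1) unfolding dyn.simps assms(2)[symmetric] Let_def by simp_all

lemma dyn_braid:
  assumes "dyn (p, q) = (p', q')" "dyn (q', r) = (q'', r')" "dyn (p', q'') = (u, v)"
    "dyn (q, r) = (q1, r1)" "dyn (p, q1) = (p2, q2)" "dyn (q2, r1) = (q3, r3)"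
  shows "u = p2 \<and> v = q3 \<and> r' = r3"
proof -
  have S: "dyn ((fst p, snd p), (fst q, snd q)) = ((fst p', snd p'), (fst q', snd q'))"
    "dyn ((fst q', snd q'), (fst r, snd r)) = ((fst q'', snd q''), (fst r', snd r'))"
    "dyn ((fst p', snd p'), (fst q'', snd q'')) = ((fst u, snd u), (fst v, snd v))"
    "dyn ((fst q, snd q), (fst r, snd r)) = ((fst q1, snd q1), (fst r1, snd r1))"
    "dyn ((fst p, snd p), (fst q1, snd q1)) = ((fst p2, snd p2), (fst q2, snd q2))"
    "dyn ((fst q2, snd q2), (fst r1, snd r1)) = ((fst q3, snd q3), (fst r3, snd r3))"
    using assms by simp_all
  note D1 = dyn_eqD[OF S(1) HOL.refl] and D2 = dyn_eqD[OF S(2) HOL.refl]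
    and D3 = dyn_eqD[OF S(3) HOL.refl] and D4 = dyn_eqD[OF S(4) HOL.refl]
    and D5 = dyn_eqD[OF S(5) HOL.refl] and D6 = dyn_eqD[OF S(6) HOL.refl]
  note * = dyn_braid_arith[OF HOL.refl D1 HOL.refl D2 HOL.refl D3
      HOL.refl D4 HOL.refl D5 HOL.refl D6]
  show ?thesis using * by (intro conjI prod_eqI)
qed

definition dyn_step :: "(coords \<Rightarrow> coords) \<Rightarrow> nat \<Rightarrow> (nat \<Rightarrow> int \<times> int) \<Rightarrow> nat \<Rightarrow> int \<times> int" where
  "dyn_step d i s = s(i := fst (d (s i, s (Suc i))), Suc i := snd (d (s i, s (Suc i))))"

definition letter_action :: "nat \<times> bool \<Rightarrow> (nat \<Rightarrow> int \<times> int) \<Rightarrow> nat \<Rightarrow> int \<times> int" where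
  "letter_action l = dyn_step (if snd l then dyn else dyn_inv) (fst l)"

abbreviation word_action :: "nat gword \<Rightarrow> (nat \<Rightarrow> int \<times> int) \<Rightarrow> nat \<Rightarrow> int \<times> int" where
  "word_action \<equiv> fold letter_action"

lemma dyn_step_cancel:
  "dyn_step dyn i (dyn_step dyn_inv i s) = s" "dyn_step dyn_inv i (dyn_step dyn i s) = s"
  by (auto simp: dyn_step_def fun_eq_iff dyn_dyn_inv dyn_inv_dyn)

lemma dyn_step_commute:
  "i + 2 \<le> j \<or> j + 2 \<le> i \<Longrightarrow> dyn_step d j (dyn_step d i s) = dyn_step d i (dyn_step d j s)"
  by (auto simp: dyn_step_def fun_eq_iff)

lemma dyn_step_braid:
  "dyn_step dyn i (dyn_step dyn (Suc i) (dyn_step dyn i s)) =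
   dyn_step dyn (Suc i) (dyn_step dyn i (dyn_step dyn (Suc i) s))"
proof -
  obtain p' q' where 1: "dyn (s i, s (Suc i)) = (p', q')" by (rule prod.exhaust)
  obtain q'' r' where 2: "dyn (q', s (Suc (Suc i))) = (q'', r')" by (rule prod.exhaust)
  obtain u v where 3: "dyn (p', q'') = (u, v)" by (rule prod.exhaust)
  obtain q1 r1 where 4: "dyn (s (Suc i), s (Suc (Suc i))) = (q1, r1)" by (rule prod.exhaust)
  obtain p2 q2 where 5: "dyn (s i, q1) = (p2, q2)" by (rule prod.exhaust)
  obtain q3 r3 where 6: "dyn (q2, r1) = (q3, r3)" by (rule prod.exhaust)
  have "u = p2 \<and> v = q3 \<and> r' = r3" using dyn_braid[OF 1 2 3 4 5 6] .
  then show ?thesis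
    by (auto simp: dyn_step_def fun_eq_iff 1 2 3 4 5 6)
qed

text \<open>The cancellations and the braid relations act trivially, so the action is an invariant
  of the braid and not only of the word.\<close>

lemma word_cong_action:
  "word_cong {1..<n} (braid_relations n) u v \<Longrightarrow> word_action u = word_action v"
proof (induction rule: word_cong.induct)
  case (cancel x b)
  then show ?case
    by (cases b) (auto simp: fun_eq_iff letter_action_def dyn_step_cancel)
next
  case (rel u v)
  then show ?case
    unfolding braid_relations_def
    by (auto simp: fun_eq_iff letter_action_def dyn_step_braid intro!: fun_cong[OF dyn_step_commute])
qed auto

text \<open>Letters of index above \<open>i\<close> do not touch coordinate \<open>i\<close>. The
  letter \<open>(i, True)\<close> adds \<open>max y1 0\<close> and another nonnegative term to its
  first entry, which makes this entry positive when starting from \<open>(0, 1)\<close> and keeps it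
  positive afterwards; the disjunctive hypothesis carries the induction.\<close>

lemma word_action_sigma:
  assumes "w \<in> lists (sigma_alphabet n i)" "s i = (0, 1) \<or> fst (s i) > 0"
  shows "if (i, True) \<in> set w then fst (word_action w s i) > 0 else word_action w s i = s i"
  using assms
proof (induction w arbitrary: s)
  case (Cons l w)
  show ?case
  proof (cases "l = (i, True)")
    case True
    obtain x1 y1 x2 y2 where s: "s i = (x1, y1)" "s (Suc i) = (x2, y2)" by (metis surj_pair)
    have "fst (letter_action l s i) > 0"
      using Cons.prems True by (auto simp: letter_action_def dyn_step_def s Let_def)
    then show ?thesis
      using Cons.IH[of "letter_action l s"] Cons.hyps True by (auto split: if_splits)
  next
    case False
    then have "letter_action l s i = s i"
      using Cons.hyps by (auto simp: sigma_alphabet_def letter_action_def dyn_step_def)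
    then show ?thesis
      using Cons.IH[of "letter_action l s"] Cons.prems False by auto
  qed
qed auto

theorem not_sigma_i_positive_one:
  "\<not> sigma_i_positive n i \<one>\<^bsub>braid_group n\<^esub>"
proof
  assume "sigma_i_positive n i \<one>\<^bsub>braid_group n\<^esub>"
  then obtain w where w: "w \<in> lists (sigma_alphabet n i)" "(i, True) \<in> set w"
    and "braid_class n [] = braid_class n w"
    unfolding sigma_i_positive_iff by (auto simp: braid_group_def presented_group_def braid_class_def)
  moreover have "[] \<in> braid_class n []"
    by (simp add: braid_class_def word_cong_rel_def word_cong.refl)
  ultimately have "word_cong {1..<n} (braid_relations n) w []"
    by (simp add: braid_class_def word_cong_rel_def)
  \<comment> \<open>The constant family \<open>(0, 1)\<close> is the trivial lamination: the word
    makes a first entry positive, whereas the empty word leaves it at 0.\<close>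
  from word_cong_action[OF this] word_action_sigma[OF w(1), of "\<lambda>_. (0, 1)"] w(2)
  show False by (auto simp: fun_eq_iff)
qed

section \<open>The monoid of positive braids\<close>

definition near :: "nat \<Rightarrow> nat \<Rightarrow> bool" where
  "near i j \<longleftrightarrow> j = Suc i \<or> i = Suc j"

definition far :: "nat \<Rightarrow> nat \<Rightarrow> bool" where
  "far i j \<longleftrightarrow> i + 2 \<le> j \<or> j + 2 \<le> i"

lemma near_sym: "near i j \<Longrightarrow> near j i" and far_sym: "far i j \<Longrightarrow> far j i"
  by (auto simp: near_def far_def)

lemma near_far_cases: obtains "i = j" | "near i j" | "far i j"
  by (auto simp: near_def far_def) linarith

lemma not_near_self [simp]: "\<not> near i i" and not_far_self [simp]: "\<not> far i i"
  and near_not_far: "near i j \<Longrightarrow> \<not> far i j"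
  and near_near_far: "near i k \<Longrightarrow> near k j \<Longrightarrow> i \<noteq> j \<Longrightarrow> far i j"
  by (auto simp: near_def far_def)

text \<open>Letters range over all naturals, so the quotient is the positive braid monoid on
  infinitely many strands. The relations preserve the set of letters, so the braids on
  \<open>n\<close> strands are singled out by their support.\<close>

inductive pb_step :: "nat list \<Rightarrow> nat list \<Rightarrow> bool" where
  far: "far i j \<Longrightarrow> pb_step (u @ [i, j] @ v) (u @ [j, i] @ v)"
| near: "near i j \<Longrightarrow> pb_step (u @ [i, j, i] @ v) (u @ [j, i, j] @ v)"

lemma pb_step_sym: "pb_step u v \<Longrightarrow> pb_step v u"
  by (induction rule: pb_step.induct) (blast intro: pb_step.intros near_sym far_sym)+

lemma pb_step_append: "pb_step u v \<Longrightarrow> pb_step (p @ u @ q) (p @ v @ q)"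
proof (induction rule: pb_step.induct)
  case (far i j u v)
  then show ?case using pb_step.far[of i j "p @ u" "v @ q"] by simp
next
  case (near i j u v)
  then show ?case using pb_step.near[of i j "p @ u" "v @ q"] by simp
qed

lemma pb_step_rev: "pb_step u v \<Longrightarrow> pb_step (rev u) (rev v)"
proof (induction rule: pb_step.induct)
  case (far i j u v)
  then show ?case using pb_step.far[of j i "rev v" "rev u"] by (simp add: far_sym)
next
  case (near i j u v)
  then show ?case using pb_step.near[of i j "rev v" "rev u"] by simp
qed

abbreviation pb_eq :: "nat list \<Rightarrow> nat list \<Rightarrow> bool" where
  "pb_eq \<equiv> pb_step\<^sup>*\<^sup>*"

lemma pb_eq_append1: "pb_eq u v \<Longrightarrow> pb_eq (p @ u @ q) (p @ v @ q)"
  by (induction rule: rtranclp_induct) (auto intro: pb_step_append rtranclp.rtrancl_into_rtrancl)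

lemma pb_eq_append: "pb_eq u u' \<Longrightarrow> pb_eq v v' \<Longrightarrow> pb_eq (u @ v) (u' @ v')"
  using pb_eq_append1[of u u' "[]" v] pb_eq_append1[of v v' u' "[]"] by auto

lemma pb_eq_rev: "pb_eq u v \<Longrightarrow> pb_eq (rev u) (rev v)"
  by (induction rule: rtranclp_induct) (auto intro: pb_step_rev rtranclp.rtrancl_into_rtrancl)

lemma pb_step_length: "pb_step u v \<Longrightarrow> length u = length v"
  and pb_step_set: "pb_step u v \<Longrightarrow> set u = set v"
  by (induction rule: pb_step.induct) auto

lemma pb_eq_length: "pb_eq u v \<Longrightarrow> length u = length v"
  by (induction rule: rtranclp_induct) (simp_all add: pb_step_length)

lemma pb_eq_set: "pb_eq u v \<Longrightarrow> set u = set v"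
  by (induction rule: rtranclp_induct) (simp_all add: pb_step_set)

quotient_type pbraid = "nat list" / pb_eq
proof (rule equivpI)
  show "reflp pb_eq" by (simp add: reflp_def)
  show "symp pb_eq" by (rule symp_rtranclp, rule sympI, erule pb_step_sym)
  show "transp pb_eq" by (rule transpI, rule rtranclp_trans)
qed

instantiation pbraid :: monoid_mult
begin
lift_definition one_pbraid :: pbraid is "[]" .
lift_definition times_pbraid :: "pbraid \<Rightarrow> pbraid \<Rightarrow> pbraid" is "(@)" by (rule pb_eq_append)
instance by standard (transfer; simp)+
end

lift_definition gen :: "nat \<Rightarrow> pbraid" is "\<lambda>i. [i]" .
lift_definition plen :: "pbraid \<Rightarrow> nat" is length by (rule pb_eq_length)
lift_definition supp :: "pbraid \<Rightarrow> nat set" is set by (rule pb_eq_set)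
text \<open>Word reversal, an anti-automorphism because the relations are symmetric under it; it
  turns facts on left factors into facts on right factors.\<close>

lift_definition prev :: "pbraid \<Rightarrow> pbraid" is rev by (rule pb_eq_rev)
lift_definition pbraid_of :: "nat list \<Rightarrow> pbraid" is "\<lambda>u. u" .

lemma plen_simps [simp]: "plen 1 = 0" "plen (gen i) = 1" "plen (x * y) = plen x + plen y"
  by (transfer; simp)+

lemma supp_simps [simp]: "supp 1 = {}" "supp (gen i) = {i}" "supp (x * y) = supp x \<union> supp y"
  by (transfer; simp)+

lemma prev_simps [simp]:
  "prev 1 = 1" "prev (gen i) = gen i" "prev (x * y) = prev y * prev x" "prev (prev x) = x"
  by (transfer; simp)+

lemma pbraid_of_simps [simp]:
  "pbraid_of [] = 1" "pbraid_of (i # u) = gen i * pbraid_of u"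
  "pbraid_of (u @ v) = pbraid_of u * pbraid_of v"
  by (transfer; simp)+

lemma plen_pbraid_of [simp]: "plen (pbraid_of u) = length u"
  and supp_pbraid_of [simp]: "supp (pbraid_of u) = set u"
  by (transfer; simp)+

lemma pbraid_of_eq_iff: "pbraid_of u = pbraid_of v \<longleftrightarrow> pb_eq u v"
  by transfer simp

lemma pbraid_exhaust: obtains u where "x = pbraid_of u"
  by (transfer) blast

lemma pbraid_induct [case_names one gen]:
  assumes "P 1" "\<And>i x. P x \<Longrightarrow> P (gen i * x)"
  shows "P x"
proof -
  obtain u where "x = pbraid_of u" by (rule pbraid_exhaust)
  moreover have "P (pbraid_of u)" by (induction u) (auto intro: assms)
  ultimately show ?thesis by simp
qed

lemma far_commute: "far i j \<Longrightarrow> gen i * gen j = gen j * gen i"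
  by transfer (use pb_step.far[of _ _ "[]" "[]"] in auto)

lemma near_braid: "near i j \<Longrightarrow> gen i * (gen j * gen i) = gen j * (gen i * gen j)"
  by transfer (use pb_step.near[of _ _ "[]" "[]"] in auto)

lemma far_commute_left: "far i j \<Longrightarrow> gen i * (gen j * z) = gen j * (gen i * z)"
  by (metis far_commute mult.assoc)

lemma near_braid_left:
  "near i j \<Longrightarrow> gen i * (gen j * (gen i * z)) = gen j * (gen i * (gen j * z))"
  using near_braid[of i j] by (metis mult.assoc)

section \<open>Garside's lemma\<close>

text \<open>The equation \<open>gen i * x = gen j * y\<close> explained by the least common multiple
  of the two generators, which is \<open>gen i\<close>, \<open>gen i * gen j * gen i\<close> or
  \<open>gen i * gen j\<close>; in the last two cases \<open>z\<close> is the remaining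
  factor.\<close>

definition lcm_form :: "nat \<Rightarrow> pbraid \<Rightarrow> nat \<Rightarrow> pbraid \<Rightarrow> bool" where
  "lcm_form i x j y \<longleftrightarrow> i = j \<and> x = y
     \<or> near i j \<and> (\<exists>z. x = gen j * (gen i * z) \<and> y = gen i * (gen j * z))
     \<or> far i j \<and> (\<exists>z. x = gen j * z \<and> y = gen i * z)"

lemma lcm_form_sym: "lcm_form i x j y \<Longrightarrow> lcm_form j y i x"
  unfolding lcm_form_def using near_sym far_sym by blast

lemma lcm_form_self: "lcm_form i x i y \<Longrightarrow> x = y"
  by (simp add: lcm_form_def)

lemma lcm_form_near:
  assumes "lcm_form i x j y" "near i j"
  obtains z where "x = gen j * (gen i * z)" "y = gen i * (gen j * z)"
  using assms near_not_far not_near_self unfolding lcm_form_def by metis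

lemma lcm_form_far:
  assumes "lcm_form i x j y" "far i j"
  obtains z where "x = gen j * z" "y = gen i * z"
  using assms near_not_far not_far_self unfolding lcm_form_def by metis

lemma lcm_form_nearI:
  "near i j \<Longrightarrow> x = gen j * (gen i * z) \<Longrightarrow> y = gen i * (gen j * z) \<Longrightarrow> lcm_form i x j y"
  by (auto simp: lcm_form_def)

lemma lcm_form_farI:
  "far i j \<Longrightarrow> x = gen j * z \<Longrightarrow> y = gen i * z \<Longrightarrow> lcm_form i x j y"
  by (auto simp: lcm_form_def)

text \<open>Garside's induction: equivalences through a third first letter \<open>k\<close> are composed, using the
  claim for shorter words; the cases are the relative positions of \<open>i\<close>, \<open>k\<close> and \<open>j\<close>.\<close>

lemma lcm_form_trans_near_far:
  assumes IH: "\<And>a p b q. plen p < plen z \<Longrightarrow> gen a * p = gen b * q \<Longrightarrow> lcm_form a p b q"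
    and ik: "near i k" and kj: "far k j"
    and xz: "lcm_form i x k z" and zy: "lcm_form k z j y"
  shows "lcm_form i x j y"
proof -
  obtain p where x: "x = gen k * (gen i * p)" and z: "z = gen i * (gen k * p)"
    using lcm_form_near[OF xz ik] .
  obtain q where z': "z = gen j * q" and y: "y = gen k * q"
    using lcm_form_far[OF zy kj] .
  \<comment> \<open>Two factorisations of \<open>z\<close>, each starting with a generator: what
    follows is shorter than \<open>z\<close>, so the induction hypothesis applies.\<close>
  have eq: "lcm_form i (gen k * p) j q"
    using z z' by (intro IH) auto
  show ?thesis
  proof (cases rule: near_far_cases[of i j])
    case 1
    then show ?thesis using ik kj by (auto simp: near_def far_def)
  next
    case 2
    obtain r where kp: "gen k * p = gen j * (gen i * r)" and q: "q = gen i * (gen j * r)"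
      using lcm_form_near[OF eq 2] .
    obtain s where p: "p = gen j * s" and ir: "gen i * r = gen k * s"
      using lcm_form_far[OF IH[OF _ kp] kj] z by auto
    have "plen r < plen z"
      using z p arg_cong[OF ir, of plen] by simp
    then obtain u where r: "r = gen k * (gen i * u)" and s: "s = gen i * (gen k * u)"
      using lcm_form_near[OF IH[OF _ ir] ik] by auto
    \<comment> \<open>Here \<open>gen i * x\<close> equals the half twist on four strands times
      \<open>u\<close>; \<open>?t\<close> is what remains of \<open>x\<close> after
      \<open>gen j * gen i\<close>.\<close>
    let ?t = "gen k * (gen i * (gen j * u))"
    have "x = gen k * (gen i * (gen j * (gen i * (gen k * u))))"
      by (simp add: x p s)
    also have "\<dots> = gen k * (gen j * (gen i * (gen j * (gen k * u))))"
      by (simp add: near_braid_left[OF 2])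
    also have "\<dots> = gen j * (gen k * (gen i * (gen k * (gen j * u))))"
      by (simp add: far_commute_left[OF kj])
    also have "\<dots> = gen j * (gen i * ?t)"
      by (simp add: near_braid_left[OF ik])
    finally have x': "x = gen j * (gen i * ?t)" .
    have "y = gen k * (gen i * (gen j * (gen k * (gen i * u))))"
      by (simp add: y q r)
    also have "\<dots> = gen k * (gen i * (gen k * (gen j * (gen i * u))))"
      by (simp add: far_commute_left[OF kj])
    also have "\<dots> = gen i * (gen k * (gen i * (gen j * (gen i * u))))"
      by (simp add: near_braid_left[OF ik])
    also have "\<dots> = gen i * (gen k * (gen j * (gen i * (gen j * u))))"
      by (simp add: near_braid_left[OF 2])
    also have "\<dots> = gen i * (gen j * ?t)"
      by (simp add: far_commute_left[OF kj])
    finally show ?thesis using lcm_form_nearI[OF 2 x'] by blast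
  next
    case 3
    obtain r where kp: "gen k * p = gen j * r" and q: "q = gen i * r"
      using lcm_form_far[OF eq 3] .
    obtain s where p: "p = gen j * s" and r: "r = gen k * s"
      using lcm_form_far[OF IH[OF _ kp] kj] z by auto
    let ?t = "gen k * (gen i * s)"
    have "x = gen j * ?t"
      by (simp add: x p far_commute_left[OF 3] far_commute_left[OF kj])
    moreover have "y = gen i * ?t"
      by (simp add: y q r near_braid_left[OF ik])
    ultimately show ?thesis by (rule lcm_form_farI[OF 3])
  qed
qed

text \<open>A coincidence of indices is cancelled; near followed by far is the preceding lemma, and
  far followed by near is its mirror image. In the cases near/near and far/far the induction
  hypothesis is applied to the two factorisations of \<open>z\<close>.\<close>

lemma lcm_form_trans:
  assumes IH: "\<And>a p b q. plen p < plen z \<Longrightarrow> gen a * p = gen b * q \<Longrightarrow> lcm_form a p b q"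
    and xz: "lcm_form i x k z" and zy: "lcm_form k z j y"
  shows "lcm_form i x j y"
proof (cases rule: near_far_cases[of i k])
  case 1
  then show ?thesis using xz zy lcm_form_self by blast
next
  case ik: 2
  obtain p where x: "x = gen k * (gen i * p)" and z: "z = gen i * (gen k * p)"
    using lcm_form_near[OF xz ik] .
  show ?thesis
  proof (cases rule: near_far_cases[of k j])
    case 1
    then show ?thesis using xz zy lcm_form_self by blast
  next
    case kj: 2
    obtain q where z': "z = gen j * (gen k * q)" and y: "y = gen k * (gen j * q)"
      using lcm_form_near[OF zy kj] .
    have eq: "lcm_form i (gen k * p) j (gen k * q)"
      using z z' by (intro IH) auto
    show ?thesis
    proof (cases "i = j")
      case True
      have kpq: "gen k * p = gen k * q" using eq True lcm_form_self by blast
      moreover have "plen p = plen q" using arg_cong[OF kpq, of plen] by simp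
      ultimately have "lcm_form k p k q" by (intro IH) (simp_all add: z)
      then have "p = q" by (rule lcm_form_self)
      then show ?thesis using x y True by (simp add: lcm_form_def)
    next
      case False
      \<comment> \<open>Two different neighbours of \<open>k\<close> are at distance two and
        commute.\<close>
      have ij: "far i j" using near_near_far[OF ik kj False] .
      obtain r where kp: "gen k * p = gen j * r" and kq: "gen k * q = gen i * r"
        using lcm_form_far[OF eq ij] .
      obtain s where p: "p = gen j * (gen k * s)" and r: "r = gen k * (gen j * s)"
        using lcm_form_near[OF IH[OF _ kp] kj] z by auto
      have "plen q < plen z" using z' by simp
      then have "lcm_form k q i r" using kq by (intro IH)
      then obtain t where q: "q = gen i * (gen k * t)" and r': "r = gen k * (gen i * t)"
        using lcm_form_near near_sym[OF ik] by blast
      have "lcm_form k (gen j * s) k (gen i * t)" using r r' z p by (intro IH) auto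
      then have "gen j * s = gen i * t" by (rule lcm_form_self)
      then have "lcm_form j s i t" using z p by (intro IH) auto
      then obtain v where s: "s = gen i * v" and t: "t = gen j * v"
        using lcm_form_far far_sym[OF ij] by blast
      \<comment> \<open>Again \<open>gen i * x\<close> is the half twist on four strands times a
        remaining factor, now \<open>v\<close>.\<close>
      let ?w = "gen k * (gen j * (gen i * (gen k * v)))"
      have "x = gen k * (gen i * (gen j * (gen k * (gen i * v))))" by (simp add: x p s)
      also have "\<dots> = gen k * (gen j * (gen i * (gen k * (gen i * v))))"
        by (simp add: far_commute_left[OF ij])
      also have "\<dots> = gen k * (gen j * (gen k * (gen i * (gen k * v))))"
        by (simp add: near_braid_left[OF ik])
      also have "\<dots> = gen j * ?w" by (simp add: near_braid_left[OF kj])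
      finally have x': "x = gen j * ?w" .
      have "y = gen k * (gen j * (gen i * (gen k * (gen j * v))))" by (simp add: y q t)
      also have "\<dots> = gen k * (gen i * (gen j * (gen k * (gen j * v))))"
        by (simp add: far_commute_left[OF ij])
      also have "\<dots> = gen k * (gen i * (gen k * (gen j * (gen k * v))))"
        by (simp add: near_braid_left[OF kj])
      also have "\<dots> = gen i * (gen k * (gen i * (gen j * (gen k * v))))"
        by (simp add: near_braid_left[OF ik])
      also have "\<dots> = gen i * ?w" by (simp add: far_commute_left[OF ij])
      finally show ?thesis using lcm_form_farI[OF ij x'] by blast
    qed
  next
    case 3
    show ?thesis by (rule lcm_form_trans_near_far[OF IH ik 3 xz zy])
  qed
next
  case ik: 3
  obtain p where x: "x = gen k * p" and z: "z = gen i * p"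
    using lcm_form_far[OF xz ik] .
  show ?thesis
  proof (cases rule: near_far_cases[of k j])
    case 1
    then show ?thesis using xz zy lcm_form_self by blast
  next
    case 2
    have "lcm_form j y i x"
      by (rule lcm_form_trans_near_far[OF IH near_sym[OF 2] far_sym[OF ik]
            lcm_form_sym[OF zy] lcm_form_sym[OF xz]])
    then show ?thesis by (rule lcm_form_sym)
  next
    case kj: 3
    obtain q where z': "z = gen j * q" and y: "y = gen k * q"
      using lcm_form_far[OF zy kj] .
    have eq: "lcm_form i p j q" using z z' by (intro IH) auto
    show ?thesis
    proof (cases rule: near_far_cases[of i j])
      case 1
      then have "p = q" using eq lcm_form_self by blast
      then show ?thesis unfolding x y 1 by (simp add: lcm_form_def)
    next
      case 2
      obtain r where p: "p = gen j * (gen i * r)" and q: "q = gen i * (gen j * r)"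
        using lcm_form_near[OF eq 2] .
      have "x = gen j * (gen i * (gen k * r))"
        unfolding x p far_commute_left[OF kj] far_commute_left[OF ik] ..
      moreover have "y = gen i * (gen j * (gen k * r))"
        unfolding y q far_commute_left[OF far_sym[OF ik]] far_commute_left[OF kj] ..
      ultimately show ?thesis by (rule lcm_form_nearI[OF 2])
    next
      case 3
      obtain r where p: "p = gen j * r" and q: "q = gen i * r"
        using lcm_form_far[OF eq 3] .
      have "x = gen j * (gen k * r)"
        unfolding x p far_commute_left[OF kj] ..
      moreover have "y = gen i * (gen k * r)"
        unfolding y q far_commute_left[OF ik] ..
      ultimately show ?thesis by (rule lcm_form_farI[OF 3])
    qed
  qed
qed

text \<open>A relation applied at the front replaces one expression of a least common multiple by
  the other; applied further back it keeps the first letter and the braid after it.\<close>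

lemma pb_step_lcm_form:
  assumes "pb_step w w'"
  shows "lcm_form (hd w) (pbraid_of (tl w)) (hd w') (pbraid_of (tl w'))"
  using assms
proof cases
  case (far i j u v)
  show ?thesis
  proof (cases u)
    case Nil
    then show ?thesis
      using far by (auto intro!: lcm_form_farI[where z = "pbraid_of v"])
  next
    case (Cons k u')
    then show ?thesis
      using far by (auto simp: lcm_form_def far_commute_left[of i j])
  qed
next
  case (near i j u v)
  show ?thesis
  proof (cases u)
    case Nil
    then show ?thesis
      using near by (auto intro!: lcm_form_nearI[where z = "pbraid_of v"])
  next
    case (Cons k u')
    then show ?thesis
      using near by (auto simp: lcm_form_def near_braid_left[of i j])
  qed
qed

text \<open>Two words for the same braid are joined by a chain of relations. Along the chain, first
  letter and remaining braid are related to those at the start, and \<open>lcm_form_trans\<close>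
  composes the steps.\<close>

theorem garside:
  "gen i * x = gen j * y \<Longrightarrow> lcm_form i x j y"
proof (induction "plen x" arbitrary: i x j y rule: less_induct)
  case less
  obtain u where x: "x = pbraid_of u" by (rule pbraid_exhaust)
  obtain v where y: "y = pbraid_of v" by (rule pbraid_exhaust)
  have "pb_eq (i # u) (j # v)"
    using less.prems by (simp add: x y pbraid_of_eq_iff[symmetric])
  moreover have "lcm_form i x (hd w) (pbraid_of (tl w))" if "pb_eq (i # u) w" for w
    using that
  proof (induction rule: rtranclp_induct)
    case base
    then show ?case by (simp add: x lcm_form_def)
  next
    case (step w w')
    \<comment> \<open>Relations preserve length, so the outer induction hypothesis covers everything
      shorter than the intermediate tail.\<close>
    have "plen (pbraid_of (tl w)) = plen x"
      using pb_eq_length[OF step.hyps(1)] by (simp add: x)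
    then show ?case
      using lcm_form_trans[OF less.hyps step.IH pb_step_lcm_form[OF step.hyps(2)]] by simp
  qed
  ultimately show ?case by (force simp: y)
qed

corollary mult_left_cancel_gen: "gen i * x = gen i * y \<Longrightarrow> x = y"
  using garside lcm_form_self by blast

lemma pbraid_left_cancel: "z * x = z * y \<Longrightarrow> x = (y :: pbraid)"
  by (induction z rule: pbraid_induct) (auto simp: mult.assoc dest: mult_left_cancel_gen)

lemma mult_right_cancel_gen: "x * gen i = y * gen i \<Longrightarrow> x = y"
proof -
  assume "x * gen i = y * gen i"
  then have "gen i * prev x = gen i * prev y"
    by (metis prev_simps(2,3))
  then show "x = y"
    by (metis mult_left_cancel_gen prev_simps(4))
qed

lemma garside_near_right:
  assumes "x * gen i = y * gen j" "near i j"
  obtains z where "x = z * gen i * gen j" "y = z * gen j * gen i"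
proof -
  have "gen i * prev x = gen j * prev y"
    using arg_cong[OF assms(1), of prev] by simp
  from lcm_form_near[OF garside[OF this] assms(2)] obtain z
    where "prev x = gen j * (gen i * z)" "prev y = gen i * (gen j * z)" .
  then have "x = prev z * gen i * gen j" "y = prev z * gen j * gen i"
    by (metis prev_simps(2-4))+
  then show ?thesis using that by blast
qed

lemma garside_far_right:
  assumes "x * gen i = y * gen j" "far i j"
  obtains z where "x = z * gen j" "y = z * gen i"
proof -
  have "gen i * prev x = gen j * prev y"
    using arg_cong[OF assms(1), of prev] by simp
  from lcm_form_far[OF garside[OF this] assms(2)] obtain z
    where "prev x = gen j * z" "prev y = gen i * z" .
  then have "x = prev z * gen j" "y = prev z * gen i"
    by (metis prev_simps(2-4))+
  then show ?thesis using that by blast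
qed

section \<open>Left divisors and common multiples\<close>

definition ldvd :: "pbraid \<Rightarrow> pbraid \<Rightarrow> bool" where
  "ldvd x m \<longleftrightarrow> (\<exists>y. m = x * y)"

lemma ldvd_prefix: "ldvd (x * y) m \<Longrightarrow> ldvd x m"
  unfolding ldvd_def by (metis mult.assoc)

lemma ldvd_supp: "ldvd x m \<Longrightarrow> supp x \<subseteq> supp m"
  by (auto simp: ldvd_def)

lemma finite_ldvd: "finite {x. ldvd x m}"
proof (rule finite_subset)
  show "finite (pbraid_of ` {u. set u \<subseteq> supp m \<and> length u \<le> plen m})"
    by (intro finite_imageI finite_lists_length_le) (transfer, simp)
  show "{x. ldvd x m} \<subseteq> pbraid_of ` {u. set u \<subseteq> supp m \<and> length u \<le> plen m}"
  proof clarify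
    fix x assume x: "ldvd x m"
    obtain u where "x = pbraid_of u" by (rule pbraid_exhaust)
    moreover have "plen x \<le> plen m" using x by (auto simp: ldvd_def)
    ultimately show "x \<in> pbraid_of ` {u. set u \<subseteq> supp m \<and> length u \<le> plen m}"
      using ldvd_supp[OF x] by auto
  qed
qed

text \<open>After cancelling \<open>c\<close>, Garside's lemma puts the least common multiple of the
  two generators in front of the rest of \<open>m\<close>. This keeps reduced paths inside the graph
  of divisors.\<close>

lemma ldvd_lcm_near:
  assumes "ldvd (c * gen i) m" "ldvd (c * gen j) m" "near i j"
  shows "ldvd (c * gen i * gen j * gen i) m"
proof -
  obtain x where x: "m = c * gen i * x" using assms(1) by (auto simp: ldvd_def)
  obtain y where y: "m = c * gen j * y" using assms(2) by (auto simp: ldvd_def)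
  have "gen i * x = gen j * y"
    using x y by (metis pbraid_left_cancel mult.assoc)
  then obtain z where "x = gen j * (gen i * z)"
    using lcm_form_near[OF garside assms(3)] by metis
  then show ?thesis unfolding ldvd_def x by (metis mult.assoc)
qed

lemma ldvd_lcm_far:
  assumes "ldvd (c * gen i) m" "ldvd (c * gen j) m" "far i j"
  shows "ldvd (c * gen i * gen j) m"
proof -
  obtain x where x: "m = c * gen i * x" using assms(1) by (auto simp: ldvd_def)
  obtain y where y: "m = c * gen j * y" using assms(2) by (auto simp: ldvd_def)
  have "gen i * x = gen j * y"
    using x y by (metis pbraid_left_cancel mult.assoc)
  then obtain z where "x = gen j * z"
    using lcm_form_far[OF garside assms(3)] by metis
  then show ?thesis unfolding ldvd_def x by (metis mult.assoc)
qed

section \<open>The full twist\<close>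

text \<open>Not Garside's half twist but the product of all generators in increasing order; its
  power with exponent \<open>n - j + 1\<close>, the number of strands involved, is the full
  twist.\<close>

definition delta :: "nat \<Rightarrow> nat \<Rightarrow> pbraid" where
  "delta j n = pbraid_of [j..<n]"

definition twist :: "nat \<Rightarrow> nat \<Rightarrow> pbraid" where
  "twist j n = delta j n ^ (n - j + 1)"

lemma supp_power [simp]: "supp (x ^ k) = (if k = 0 then {} else supp x)"
  by (induction k) auto

lemma supp_twist: "supp (twist j n) \<subseteq> {j..<n}"
  by (simp add: twist_def delta_def)

lemma pbraid_of_far_commute:
  "(\<And>k. k \<in> set u \<Longrightarrow> far i k) \<Longrightarrow> gen i * pbraid_of u = pbraid_of u * gen i"
proof (induction u)
  case (Cons k u)
  have "gen i * pbraid_of (k # u) = gen k * (gen i * pbraid_of u)"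
    using Cons.prems by (simp add: far_commute_left[of i k])
  also have "\<dots> = pbraid_of (k # u) * gen i"
    using Cons by (simp add: mult.assoc)
  finally show ?case .
qed simp

text \<open>\<open>gen i\<close> passes the letters above \<open>Suc i\<close>, the braid relation
  turns it into \<open>gen (Suc i)\<close>, and this passes the letters below
  \<open>i\<close>.\<close>

lemma delta_gen:
  assumes "j \<le> i" "Suc i < n"
  shows "delta j n * gen i = gen (Suc i) * delta j n"
proof -
  have "[j..<n] = [j..<i] @ [i, Suc i] @ [Suc (Suc i)..<n]"
    using assms by (metis Suc_lessD append_Cons append_Nil le_eq_less_or_eq less_imp_le_nat
        upt_add_eq_append upt_conv_Cons le_add_diff_inverse)
  then have d: "delta j n = pbraid_of [j..<i] * (gen i * (gen (Suc i) * pbraid_of [Suc (Suc i)..<n]))"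
    by (simp add: delta_def)
  have n: "near i (Suc i)" by (simp add: near_def)
  have "delta j n * gen i
      = pbraid_of [j..<i] * (gen i * (gen (Suc i) * (gen i * pbraid_of [Suc (Suc i)..<n])))"
    unfolding d mult.assoc by (subst pbraid_of_far_commute[symmetric]) (auto simp: far_def)
  also have "\<dots> = (pbraid_of [j..<i] * gen (Suc i))
      * (gen i * (gen (Suc i) * pbraid_of [Suc (Suc i)..<n]))"
    by (simp add: near_braid_left[OF n] mult.assoc)
  also have "pbraid_of [j..<i] * gen (Suc i) = gen (Suc i) * pbraid_of [j..<i]"
    by (rule pbraid_of_far_commute[symmetric]) (auto simp: far_def)
  finally show ?thesis by (simp add: d mult.assoc)
qed

lemma delta_word:
  "set u \<subseteq> {j..<n - 1} \<Longrightarrow> delta j n * pbraid_of u = pbraid_of (map Suc u) * delta j n"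
proof (induction u)
  case (Cons k u)
  have "delta j n * gen k = gen (Suc k) * delta j n"
    using Cons.prems by (intro delta_gen) auto
  then have "delta j n * pbraid_of (k # u) = gen (Suc k) * (delta j n * pbraid_of u)"
    by (metis mult.assoc pbraid_of_simps(2))
  then show ?case using Cons by (simp add: mult.assoc)
qed simp

lemma delta_Cons: "j < n \<Longrightarrow> delta j n = gen j * delta (Suc j) n"
  by (simp add: delta_def upt_conv_Cons)

text \<open>The last generator cannot be shifted further up; two factors \<open>delta\<close> carry
  it round to the first one.\<close>

lemma delta_square_gen:
  assumes "j < n"
  shows "gen j * (delta j n * delta j n) = delta j n * delta j n * gen (n - 1)"
proof -
  have d: "delta j n = delta j (n - 1) * gen (n - 1)"
    using assms by (cases n) (auto simp: delta_def)
  have "delta j n * delta j (n - 1) = pbraid_of (map Suc [j..<n - 1]) * delta j n"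
    unfolding delta_def[of j "n - 1"] by (rule delta_word) auto
  also have "map Suc [j..<n - 1] = [Suc j..<n]"
    using assms by (simp add: map_Suc_upt)
  finally have *: "delta j n * delta j (n - 1) = delta (Suc j) n * delta j n"
    by (simp add: delta_def)
  have "delta j n * delta j n = delta (Suc j) n * delta j n * gen (n - 1)"
    using d * by (metis mult.assoc)
  then show ?thesis
    using delta_Cons[OF assms] by (metis mult.assoc)
qed

lemma delta_power_gen:
  "j \<le> i \<Longrightarrow> i + k < n \<Longrightarrow> delta j n ^ k * gen i = gen (i + k) * delta j n ^ k"
proof (induction k)
  case (Suc k)
  have "delta j n ^ Suc k * gen i = delta j n * gen (i + k) * delta j n ^ k"
    using Suc by (simp add: mult.assoc)
  then show ?case using Suc.prems by (simp add: delta_gen mult.assoc)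
qed simp

text \<open>The factors \<open>delta\<close> shift \<open>gen i\<close> up to
  \<open>gen (n - 1)\<close>, two of them wrap it round to \<open>gen j\<close>, and the others
  shift it back to \<open>gen i\<close>; the exponents add up to \<open>n - j + 1\<close>.\<close>

lemma twist_central_gen:
  assumes "i \<in> {j..<n}"
  shows "twist j n * gen i = gen i * twist j n"
proof -
  let ?d = "delta j n"
  have e: "n - j + 1 = (i - j) + 2 + (n - 1 - i)" using assms by auto
  have t: "twist j n = ?d ^ (i - j) * (?d * ?d) * ?d ^ (n - 1 - i)"
    unfolding twist_def e by (simp only: power_add power2_eq_square)
  have "twist j n * gen i = ?d ^ (i - j) * (?d * ?d * gen (n - 1)) * ?d ^ (n - 1 - i)"
    using delta_power_gen[of j i "n - 1 - i" n] assms by (simp add: t mult.assoc)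
  also have "\<dots> = ?d ^ (i - j) * gen j * (?d * ?d) * ?d ^ (n - 1 - i)"
    using delta_square_gen[of j n] assms by (simp add: mult.assoc)
  also have "\<dots> = gen i * twist j n"
    using delta_power_gen[of j j "i - j" n] assms by (simp add: t mult.assoc)
  finally show ?thesis .
qed

lemma twist_power_central:
  assumes "supp x \<subseteq> {j..<n}"
  shows "twist j n ^ k * x = x * twist j n ^ k"
proof -
  have 1: "twist j n * y = y * twist j n" if "supp y \<subseteq> {j..<n}" for y
    using that
  proof (induction y rule: pbraid_induct)
    case (gen i y)
    then show ?case
      using twist_central_gen[of i j n] by (simp add: mult.assoc[symmetric]) (simp add: mult.assoc)
  qed simp
  show ?thesis using assms 1 by (simp add: power_commuting_commutes)
qed

text \<open>\<open>delta\<close> starts with \<open>gen j\<close>, and moving this letter to the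
  front past \<open>i - j\<close> factors \<open>delta\<close> turns it into
  \<open>gen i\<close>.\<close>

lemma gen_ldvd_twist:
  assumes "i \<in> {j..<n}"
  obtains r where "twist j n = gen i * r"
proof -
  let ?d = "delta j n"
  have e: "n - j + 1 = (i - j) + Suc (n - i)" using assms by auto
  have t: "twist j n = ?d ^ (i - j) * (?d * ?d ^ (n - i))"
    unfolding twist_def e by (simp only: power_add power_Suc)
  also have "\<dots> = (?d ^ (i - j) * gen j) * (delta (Suc j) n * ?d ^ (n - i))"
    using delta_Cons[of j n] assms by (simp add: mult.assoc)
  also have "\<dots> = gen i * (?d ^ (i - j) * (delta (Suc j) n * ?d ^ (n - i)))"
    using delta_power_gen[of j j "i - j" n] assms by (simp add: mult.assoc)
  finally show ?thesis by (rule that)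
qed

text \<open>Each letter of \<open>x\<close> is split off from one full twist, the rest of which
  commutes past the remaining power. So powers of the twist serve as common multiples.\<close>

lemma ldvd_twist_power:
  "supp x \<subseteq> {j..<n} \<Longrightarrow> plen x \<le> k \<Longrightarrow> ldvd x (twist j n ^ k)"
proof (induction x arbitrary: k rule: pbraid_induct)
  case one
  show ?case by (simp add: ldvd_def)
next
  case (gen i x)
  obtain k' where k: "k = Suc k'" using gen.prems(2) by (cases k) auto
  then obtain y where y: "twist j n ^ k' = x * y"
    using gen by (fastforce simp: ldvd_def)
  obtain r where r: "twist j n = gen i * r" using gen_ldvd_twist[of i j n] gen.prems(1) by auto
  have "supp r \<subseteq> {j..<n}" using supp_twist[of j n] r by auto
  then have "twist j n ^ k = gen i * (twist j n ^ k' * r)"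
    using twist_power_central[of r j n k'] by (simp add: k r mult.assoc)
  then show ?case unfolding ldvd_def y by (metis mult.assoc)
qed

section \<open>Handle reduction in an interval of the positive monoid\<close>

text \<open>The left divisors of \<open>m\<close> span a finite subgraph of the Cayley graph. \<open>nconn m i\<close> joins
  vertices by paths in the generators of index \<open>> i\<close> and their inverses, \<open>pconn m i\<close> by paths
  that are \<open>\<sigma>\<^sub>i\<close>-positive words.\<close>

definition edge :: "pbraid \<Rightarrow> nat \<Rightarrow> pbraid \<Rightarrow> pbraid \<Rightarrow> bool" where
  "edge m i x y \<longleftrightarrow> y = x * gen i \<and> ldvd y m"

inductive nconn :: "pbraid \<Rightarrow> nat \<Rightarrow> pbraid \<Rightarrow> pbraid \<Rightarrow> bool" for m i where
  refl: "nconn m i x x"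
| up: "nconn m i x y \<Longrightarrow> edge m k y z \<Longrightarrow> k > i \<Longrightarrow> nconn m i x z"
| down: "nconn m i x y \<Longrightarrow> edge m k z y \<Longrightarrow> k > i \<Longrightarrow> nconn m i x z"

inductive pconn :: "pbraid \<Rightarrow> nat \<Rightarrow> pbraid \<Rightarrow> pbraid \<Rightarrow> bool" for m i where
  edge: "nconn m i x a \<Longrightarrow> edge m i a b \<Longrightarrow> nconn m i b y \<Longrightarrow> pconn m i x y"
| trans: "pconn m i x y \<Longrightarrow> pconn m i y z \<Longrightarrow> pconn m i x z"

definition lconn :: "pbraid \<Rightarrow> nat \<Rightarrow> pbraid \<Rightarrow> pbraid \<Rightarrow> bool" where
  "lconn m i x y \<longleftrightarrow> nconn m i x y \<or> pconn m i x y"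

lemma nconn_trans: "nconn m i y z \<Longrightarrow> nconn m i x y \<Longrightarrow> nconn m i x z"
  by (induction rule: nconn.induct) (auto intro: nconn.intros)

lemma nconn_sym: "nconn m i x y \<Longrightarrow> nconn m i y x"
proof (induction rule: nconn.induct)
  case (up x y k z)
  then show ?case using nconn_trans nconn.down[OF nconn.refl] by blast
next
  case (down x y k z)
  then show ?case using nconn_trans nconn.up[OF nconn.refl] by blast
qed (rule nconn.refl)

lemma nconn_mono: "nconn m j x y \<Longrightarrow> i \<le> j \<Longrightarrow> nconn m i x y"
  by (induction rule: nconn.induct) (auto intro: nconn.intros)

lemma nconn_pconn: "pconn m i y z \<Longrightarrow> nconn m i x y \<Longrightarrow> pconn m i x z"
  by (induction arbitrary: x rule: pconn.induct) (blast intro: pconn.intros nconn_trans)+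

lemma pconn_nconn: "pconn m i x y \<Longrightarrow> nconn m i y z \<Longrightarrow> pconn m i x z"
  by (induction arbitrary: z rule: pconn.induct) (blast intro: pconn.intros nconn_trans)+

lemma lconn_trans: "lconn m i x y \<Longrightarrow> lconn m i y z \<Longrightarrow> lconn m i x z"
  unfolding lconn_def by (blast intro: nconn_trans nconn_pconn pconn_nconn pconn.trans)

lemma lconn_edge: "edge m i x y \<Longrightarrow> lconn m i x y"
  unfolding lconn_def by (blast intro: pconn.edge nconn.refl)

lemma pconn_last:
  "pconn m i x y \<Longrightarrow> \<exists>a b. lconn m i x a \<and> edge m i a b \<and> nconn m i b y"
proof (induction rule: pconn.induct)
  case (trans x y z)
  then show ?case unfolding lconn_def by (meson lconn_def lconn_trans)
qed (auto simp: lconn_def)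

lemma pconn_first:
  "pconn m i x y \<Longrightarrow> \<exists>a b. nconn m i x a \<and> edge m i a b \<and> lconn m i b y"
proof (induction rule: pconn.induct)
  case (trans x y z)
  then show ?case unfolding lconn_def by (meson lconn_def lconn_trans)
qed (auto simp: lconn_def)

lemma nconn_ldvd: "nconn m i x y \<Longrightarrow> ldvd x m \<Longrightarrow> ldvd y m"
  by (induction rule: nconn.induct) (auto simp: edge_def intro: ldvd_prefix)

lemma pconn_ldvd: "pconn m i x y \<Longrightarrow> ldvd x m \<and> ldvd y m"
proof (induction rule: pconn.induct)
  case (edge x a b y)
  then show ?case using nconn_ldvd nconn_sym unfolding edge_def by (metis ldvd_prefix)
qed auto

section \<open>Pushing paths across edges of index \<open>i\<close>\<close>

lemma nconn_transport_down:
  "nconn m (Suc i) b c \<Longrightarrow> b = a * gen i \<Longrightarrow> \<exists>a'. c = a' * gen i \<and> nconn m (Suc i) a a'"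
proof (induction arbitrary: a rule: nconn.induct)
  case (refl x)
  then show ?case by (blast intro: nconn.refl)
next
  case (up x y k z)
  then obtain y' where y': "y = y' * gen i" and n: "nconn m (Suc i) a y'" by blast
  have f: "far k i" using up.hyps(3) by (simp add: far_def)
  have z: "z = y' * gen k * gen i" and zm: "ldvd z m"
    using up.hyps(2) y' far_commute[OF f] unfolding edge_def by (auto simp: mult.assoc)
  then have "edge m k y' (y' * gen k)" unfolding edge_def using ldvd_prefix by auto
  then show ?case using z nconn.up[OF n] up.hyps(3) by blast
next
  case (down x y k z)
  then obtain y' where y': "y = y' * gen i" and n: "nconn m (Suc i) a y'" by blast
  have f: "far k i" using down.hyps(3) by (simp add: far_def)
  have "z * gen k = y' * gen i" "ldvd y m" using down.hyps(2) y' by (auto simp: edge_def)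
  \<comment> \<open>By Garside's lemma an element divisible on the right by two commuting generators
    is divisible by their product, so the factor \<open>gen i\<close> survives a step down.\<close>
  then obtain e where z: "z = e * gen i" and e: "y' = e * gen k"
    using garside_far_right[OF _ f] by metis
  have "edge m k e y'" using \<open>ldvd y m\<close> ldvd_prefix unfolding edge_def y' e by auto
  then show ?case using z nconn.down[OF n] down.hyps(3) by blast
qed

text \<open>A positive edge \<open>Suc i\<close> becomes a path spelling sigma_{i+1}^-1 sigma_i
  sigma_{i+1}, which is the conjugate sigma_i sigma_{i+1} sigma_i^-1. Divisibility by
  \<open>gen i\<close> is given at the end \<open>c\<close> and is carried backwards along the
  path.\<close>

lemma pconn_transport_down:
  "pconn m (Suc i) b c \<Longrightarrow> c = d * gen i \<Longrightarrow> \<exists>a. b = a * gen i \<and> pconn m i a d"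
proof (induction arbitrary: d rule: pconn.induct)
  case (edge b x y c)
  obtain e where y: "y = e * gen i" and de: "nconn m (Suc i) d e"
    using nconn_transport_down[OF nconn_sym[OF edge.hyps(3)] edge.prems] by blast
  have nr: "near (Suc i) i" by (simp add: near_def)
  have "x * gen (Suc i) = e * gen i" and ym: "ldvd y m"
    using edge.hyps(2) y by (auto simp: edge_def)
  then obtain z where x: "x = z * gen (Suc i) * gen i" and e: "e = z * gen i * gen (Suc i)"
    using garside_near_right[OF _ nr] by metis
  obtain a where b: "b = a * gen i" and a: "nconn m (Suc i) (z * gen (Suc i)) a"
    using nconn_transport_down[OF nconn_sym[OF edge.hyps(1)] x] by blast
  have xm: "ldvd x m"
    using edge.hyps(2) ldvd_prefix unfolding edge_def by auto
  have em: "ldvd e m" using ym ldvd_prefix unfolding y by auto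
  have "edge m (Suc i) z (z * gen (Suc i))"
    using xm ldvd_prefix unfolding x edge_def by auto
  then have "nconn m i (z * gen (Suc i)) z"
    by (rule nconn.down[OF nconn.refl]) simp
  then have "nconn m i a z"
    using nconn_mono[OF nconn_sym[OF a]] nconn_trans by (meson le_SucI order_refl)
  moreover have "edge m i z (z * gen i)"
    using em ldvd_prefix unfolding e edge_def by auto
  moreover have "nconn m i (z * gen i) e"
    using em by (intro nconn.up[OF nconn.refl, of _ "Suc i"]) (auto simp: edge_def e)
  then have "nconn m i (z * gen i) d"
    using nconn_mono[OF nconn_sym[OF de]] nconn_trans by (meson le_SucI order_refl)
  ultimately show ?case using b pconn.edge by blast
next
  case (trans b y c)
  obtain e where y: "y = e * gen i" and e: "pconn m i e d"
    using trans.IH(2)[OF trans.prems] by blast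
  obtain a where "b = a * gen i" "pconn m i a e"
    using trans.IH(1)[OF y] by blast
  then show ?case using e pconn.trans by blast
qed

lemma nconn_transport_up:
  "nconn m (Suc i) b c \<Longrightarrow> ldvd (b * gen i) m \<Longrightarrow>
   ldvd (c * gen i) m \<and> nconn m (Suc i) (b * gen i) (c * gen i)"
proof (induction rule: nconn.induct)
  case (refl x)
  then show ?case by (blast intro: nconn.refl)
next
  case (up x y k z)
  have f: "far k i" using up.hyps(3) by (simp add: far_def)
  have z: "z = y * gen k" "ldvd z m" using up.hyps(2) by (auto simp: edge_def)
  have "ldvd (z * gen i) m" using up z ldvd_lcm_far[OF _ _ f] by blast
  moreover have "z * gen i = y * gen i * gen k"
    using far_commute[OF f] by (simp add: z mult.assoc)
  ultimately show ?case
    using up nconn.up[of m "Suc i" "x * gen i" "y * gen i" k] by (simp add: edge_def)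
next
  case (down x y k z)
  have f: "far k i" using down.hyps(3) by (simp add: far_def)
  have y: "y = z * gen k" using down.hyps(2) by (auto simp: edge_def)
  have yz: "y * gen i = z * gen i * gen k"
    using far_commute[OF f] by (simp add: y mult.assoc)
  then have "ldvd (z * gen i) m" using down ldvd_prefix by metis
  then show ?case
    using down yz nconn.down[of m "Suc i" "x * gen i" "y * gen i" k "z * gen i"]
    by (simp add: edge_def)
qed

text \<open>Mirror image of pushing down: an edge \<open>Suc i\<close> becomes a path spelling
  sigma_{i+1} sigma_i sigma_{i+1}^-1. The new vertices divide \<open>m\<close> because least common
  multiples do.\<close>

lemma pconn_transport_up:
  "pconn m (Suc i) b c \<Longrightarrow> ldvd (b * gen i) m \<Longrightarrow>
   ldvd (c * gen i) m \<and> pconn m i (b * gen i) (c * gen i)"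
proof (induction rule: pconn.induct)
  case (edge b x y c)
  have x: "ldvd (x * gen i) m" "nconn m (Suc i) (b * gen i) (x * gen i)"
    using nconn_transport_up[OF edge.hyps(1) edge.prems] by auto
  have y: "y = x * gen (Suc i)" "ldvd y m" using edge.hyps(2) by (auto simp: edge_def)
  have nr: "near i (Suc i)" by (simp add: near_def)
  have top: "ldvd (x * gen i * gen (Suc i) * gen i) m"
    using ldvd_lcm_near[OF x(1) _ nr] y by simp
  have eq: "x * gen i * gen (Suc i) * gen i = y * gen i * gen (Suc i)"
    using near_braid[OF nr] by (simp add: y mult.assoc)
  have ym: "ldvd (y * gen i) m" using top ldvd_prefix unfolding eq by auto
  have c: "ldvd (c * gen i) m" "nconn m (Suc i) (y * gen i) (c * gen i)"
    using nconn_transport_up[OF edge.hyps(3) ym] by auto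
  have "nconn m (Suc i) (b * gen i) (x * gen i)" using x by simp
  then have "nconn m i (b * gen i) (x * gen i * gen (Suc i))"
    using top ldvd_prefix
    by (intro nconn.up[OF nconn_mono, of m "Suc i" _ "x * gen i" i "Suc i"]) (auto simp: edge_def)
  moreover have "edge m i (x * gen i * gen (Suc i)) (x * gen i * gen (Suc i) * gen i)"
    using top by (simp add: edge_def)
  moreover have "nconn m i (x * gen i * gen (Suc i) * gen i) (y * gen i)"
    using top unfolding eq by (intro nconn.down[OF nconn.refl, of _ "Suc i"]) (auto simp: edge_def)
  then have "nconn m i (x * gen i * gen (Suc i) * gen i) (c * gen i)"
    using nconn_mono[OF c(2)] nconn_trans by (meson le_SucI order_refl)
  ultimately show ?case using c pconn.edge by blast
next
  case (trans x y z)
  then show ?case using pconn.trans by blast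
qed

section \<open>Handle reduction and comparison of vertices\<close>

definition comparison :: "pbraid \<Rightarrow> nat \<Rightarrow> bool" where
  "comparison m i \<longleftrightarrow>
     (\<forall>x y. nconn m i x y \<longrightarrow> lconn m (Suc i) x y \<or> lconn m (Suc i) y x)"

lemma lconn_SucE:
  assumes "lconn m (Suc i) x y"
  obtains "nconn m (Suc i) x y" | "pconn m (Suc i) x y"
  using assms lconn_def by blast

text \<open>The path from \<open>a\<close> to \<open>d\<close> spells a handle sigma_i w sigma_i^-1
  with \<open>w\<close> in generators of higher index. By \<open>cmp\<close>, \<open>w\<close> may
  be taken free of sigma_{i+1}, positive in it or negative in it, and is then pushed down below both
  edges.\<close>

lemma peak_reduction:
  assumes cmp: "comparison m i"
    and "edge m i a b" "nconn m i b c" "edge m i d c"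
  shows "lconn m i a d \<or> lconn m i d a"
proof -
  have b: "b = a * gen i" and c: "c = d * gen i"
    using assms(2,4) by (auto simp: edge_def)
  \<comment> \<open>Stated for arbitrary vertices, so that it serves both directions of the
    comparison of \<open>b\<close> and \<open>c\<close>.\<close>
  have step: "lconn m i a d" if bc: "lconn m (Suc i) b c" and b: "b = a * gen i" and c: "c = d * gen i" for a b c d
    using bc
  proof (cases rule: lconn_SucE)
    case 1
    obtain a' where a': "c = a' * gen i" "nconn m (Suc i) a a'"
      using nconn_transport_down[OF 1 b] by blast
    have "a' = d" using a'(1) c by (metis mult_right_cancel_gen)
    then show ?thesis using nconn_mono[OF a'(2), of i] by (simp add: lconn_def)
  next
    case 2
    obtain a' where a': "b = a' * gen i" "pconn m i a' d"
      using pconn_transport_down[OF 2 c] by blast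
    have "a' = a" using a'(1) b by (metis mult_right_cancel_gen)
    then show ?thesis using a'(2) by (simp add: lconn_def)
  qed
  show ?thesis
    using cmp assms(3) step[OF _ b c] step[OF _ c b] unfolding comparison_def by blast
qed

text \<open>Mirror image for handles sigma_i^-1 w sigma_i, where \<open>w\<close> is pushed
  up.\<close>

lemma valley_reduction:
  assumes cmp: "comparison m i"
    and "edge m i b a" "nconn m i b c" "edge m i c d"
  shows "lconn m i a d \<or> lconn m i d a"
proof -
  have a: "a = b * gen i" "ldvd a m" and d: "d = c * gen i" "ldvd d m"
    using assms(2,4) by (auto simp: edge_def)
  have step: "lconn m i (b * gen i) (c * gen i)"
    if bc: "lconn m (Suc i) b c" and "ldvd (b * gen i) m" for b c
    using bc
  proof (cases rule: lconn_SucE)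
    case 1
    then show ?thesis
      using nconn_transport_up[OF 1 that(2)] nconn_mono[of m "Suc i" _ _ i] unfolding lconn_def by auto
  next
    case 2
    then show ?thesis
      using pconn_transport_up[OF 2 that(2)] unfolding lconn_def by auto
  qed
  show ?thesis
    using cmp assms(3) step[of b c] step[of c b] a d unfolding comparison_def by blast
qed

text \<open>\<open>pconn\<close> is transitive and relates only the finitely many left divisors of
  \<open>m\<close>, so irreflexivity excludes infinite chains in either direction.\<close>

lemma wf_pconn:
  assumes "\<And>x. \<not> pconn m i x x"
  shows "wf {(x, y). pconn m i x y}" "wf ({(x, y). pconn m i x y}\<inverse>)"
proof -
  let ?r = "{(x, y). pconn m i x y}"
  have "finite ({x. ldvd x m} \<times> {x. ldvd x m})" using finite_ldvd by simp
  then have fin: "finite ?r"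
    by (rule rev_finite_subset) (auto dest: pconn_ldvd)
  have "trans ?r" using pconn.trans unfolding trans_def by blast
  then have ac: "acyclic ?r" using assms by (auto simp: acyclic_def trancl_id)
  show "wf ?r" by (rule finite_acyclic_wf[OF fin ac])
  show "wf (?r\<inverse>)" by (rule finite_acyclic_wf_converse[OF fin ac])
qed

text \<open>Both paths end with a \<open>\<sigma>\<^sub>i\<close>-edge into the class of \<open>p\<close>. Reducing this handle compares the
  sources of the two edges, and the larger of them replaces \<open>p\<close>.\<close>

lemma lconn_below:
  assumes irr: "\<And>x. \<not> pconn m i x x" and cmp: "comparison m i"
    and "lconn m i x p" "lconn m i y p"
  shows "lconn m i x y \<or> lconn m i y x"
  using assms(3,4)
proof (induction p arbitrary: x y rule: wf_induct_rule[OF wf_pconn(1)[OF irr]])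
  case (1 p)
  show ?case
  proof (cases "nconn m i x p \<or> nconn m i y p")
    case True
    \<comment> \<open>A neutral path can be reversed and then composed with the other path.\<close>
    then show ?thesis
      using 1(2,3) lconn_trans nconn_sym unfolding lconn_def by (metis lconn_def)
  next
    case False
    then have "pconn m i x p" "pconn m i y p" using 1(2,3) by (auto simp: lconn_def)
    then obtain a b d c where x: "lconn m i x a" "edge m i a b" "nconn m i b p"
      and y: "lconn m i y d" "edge m i d c" "nconn m i c p"
      using pconn_last by metis
    have ap: "pconn m i a p" and dp: "pconn m i d p"
      using x y pconn.edge nconn.refl by blast+
    have "nconn m i b c" using x(3) y(3) nconn_sym nconn_trans by blast
    then consider "lconn m i a d" | "lconn m i d a"
      using peak_reduction[OF cmp x(2) _ y(2)] by blast
    then show ?thesis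
    proof cases
      case 1
      then show ?thesis using "1.IH"[of d x y] dp lconn_trans[OF x(1)] y(1) by blast
    next
      case 2
      then show ?thesis using "1.IH"[of a x y] ap lconn_trans[OF y(1)] x(1) by blast
    qed
  qed
qed

text \<open>Mirror image at a lower turning point: the smaller of the two targets replaces
  \<open>p\<close>, which therefore moves up.\<close>

lemma lconn_above:
  assumes irr: "\<And>x. \<not> pconn m i x x" and cmp: "comparison m i"
    and "lconn m i p x" "lconn m i p y"
  shows "lconn m i x y \<or> lconn m i y x"
  using assms(3,4)
proof (induction p arbitrary: x y rule: wf_induct_rule[OF wf_pconn(2)[OF irr]])
  case (1 p)
  show ?case
  proof (cases "nconn m i p x \<or> nconn m i p y")
    case True
    then show ?thesis
      using 1(2,3) lconn_trans nconn_sym unfolding lconn_def by (metis lconn_def)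
  next
    case False
    then have "pconn m i p x" "pconn m i p y" using 1(2,3) by (auto simp: lconn_def)
    then obtain a b d c where x: "nconn m i p b" "edge m i b a" "lconn m i a x"
      and y: "nconn m i p c" "edge m i c d" "lconn m i d y"
      using pconn_first by metis
    have ap: "pconn m i p a" and dp: "pconn m i p d"
      using x y pconn.edge nconn.refl by blast+
    have "nconn m i b c" using x(1) y(1) nconn_sym nconn_trans by blast
    then consider "lconn m i a d" | "lconn m i d a"
      using valley_reduction[OF cmp x(2) _ y(2)] by blast
    then show ?thesis
    proof cases
      case 1
      then show ?thesis using "1.IH"[of a x y] ap lconn_trans[OF _ y(3)] x(3) by blast
    next
      case 2
      then show ?thesis using "1.IH"[of d x y] dp lconn_trans[OF _ x(3)] y(3) by blast
    qed
  qed
qed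

text \<open>Runs along the path, keeping its current end comparable with \<open>x\<close>. An edge
  \<open>Suc i\<close> against the direction found so far creates a turning point, which
  \<open>lconn_above\<close> or \<open>lconn_below\<close> resolves; the other edges are neutral at
  level \<open>Suc i\<close>.\<close>

lemma comparison_step:
  assumes irr: "\<And>x. \<not> pconn m (Suc i) x x" and cmp: "comparison m (Suc i)"
  shows "comparison m i"
  unfolding comparison_def
proof (intro allI impI)
  fix x y
  assume "nconn m i x y"
  then show "lconn m (Suc i) x y \<or> lconn m (Suc i) y x"
  proof (induction rule: nconn.induct)
    case (refl x)
    then show ?case by (auto simp: lconn_def intro: nconn.refl)
  next
    case (up x y k z)
    show ?case
    proof (cases "k = Suc i")
      case True
      then have yz: "lconn m (Suc i) y z" using up.hyps(2) lconn_edge by blast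
      then show ?thesis using up.IH lconn_trans lconn_above[OF irr cmp] by blast
    next
      case False
      then have "nconn m (Suc i) y z" using up.hyps nconn.up[OF nconn.refl] by force
      then show ?thesis using up.IH lconn_trans nconn_sym unfolding lconn_def by (metis lconn_def)
    qed
  next
    case (down x y k z)
    show ?case
    proof (cases "k = Suc i")
      case True
      then have zy: "lconn m (Suc i) z y" using down.hyps(2) lconn_edge by blast
      then show ?thesis using down.IH lconn_trans lconn_below[OF irr cmp] by blast
    next
      case False
      then have "nconn m (Suc i) y z" using down.hyps nconn.down[OF nconn.refl] by force
      then show ?thesis using down.IH lconn_trans nconn_sym unfolding lconn_def by (metis lconn_def)
    qed
  qed
qed

lemma nconn_trivial: "nconn m i x y \<Longrightarrow> supp m \<subseteq> {1..<n} \<Longrightarrow> n \<le> Suc i \<Longrightarrow> x = y"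
proof (induction rule: nconn.induct)
  case (up x y k z)
  then show ?case using ldvd_supp[of z m] by (fastforce simp: edge_def)
next
  case (down x y k z)
  then show ?case using ldvd_supp[of y m] by (fastforce simp: edge_def)
qed simp

text \<open>\<open>comparison\<close> is built downwards from level \<open>n\<close>, where no
  generators are left. Going up from level 0, the first level at which \<open>x\<close> and
  \<open>y\<close> are not joined neutrally supplies the sign.\<close>

theorem interval_comparison:
  assumes irr: "\<And>i x. \<not> pconn m i x x" and m: "supp m \<subseteq> {1..<n}" and xy: "nconn m 0 x y"
  shows "x = y \<or> (\<exists>i\<in>{1..<n}. pconn m i x y \<or> pconn m i y x)"
proof -
  have cmp: "comparison m i" for i
  proof (cases "i \<le> n")
    case True
    then show ?thesis
    proof (induction rule: inc_induct)
      case base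
      show ?case
        unfolding comparison_def using nconn_trivial[OF _ m] nconn.refl by (fastforce simp: lconn_def)
    next
      case (step i)
      then show ?case using comparison_step[OF irr] by blast
    qed
  next
    case False
    then show ?thesis
      unfolding comparison_def using nconn_trivial[OF _ m] nconn.refl by (fastforce simp: lconn_def)
  qed
  have "x = y \<or> (\<exists>j>i. pconn m j x y \<or> pconn m j y x)" if "nconn m i x y" "i \<le> n" for i
    using that(2,1)
  proof (induction rule: inc_induct)
    case base
    then show ?case using nconn_trivial[OF _ m] by fastforce
  next
    case (step i)
    from step.prems cmp[of i] consider "nconn m (Suc i) x y" | "pconn m (Suc i) x y \<or> pconn m (Suc i) y x"
      unfolding comparison_def lconn_def using nconn_sym by blast
    then show ?case
    proof cases
      case 1
      then show ?thesis using step.IH Suc_lessD by blast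
    qed blast
  qed
  \<comment> \<open>A positive path at level \<open>j\<close> contains an edge \<open>j\<close>, and
    the support of \<open>m\<close> bounds the indices of edges.\<close>
  moreover have "j < n" if p: "pconn m j u v" for j u v
  proof -
    obtain a b where "edge m j a b" using pconn_first[OF p] by blast
    then show ?thesis using ldvd_supp[of b m] m by (fastforce simp: edge_def)
  qed
  ultimately show ?thesis using xy by fastforce
qed

lemma (in group) commute_inv:
  assumes "x \<in> carrier G" "y \<in> carrier G" "x \<otimes> y = y \<otimes> x"
  shows "inv x \<otimes> y = y \<otimes> inv x"
proof -
  have "inv x \<otimes> y = inv x \<otimes> (y \<otimes> x) \<otimes> inv x"
    using assms(1,2) by (simp add: m_assoc)
  also have "\<dots> = inv x \<otimes> (x \<otimes> y) \<otimes> inv x" by (simp add: assms(3))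
  also have "\<dots> = y \<otimes> inv x"
    using assms(1,2) by (simp add: m_assoc[symmetric])
  finally show ?thesis .
qed

section \<open>Words in the braid group\<close>

locale braids = group G for G (structure) +
  fixes n :: nat
  assumes G_eq: "G = braid_group n"
begin

abbreviation cls :: "nat gword \<Rightarrow> nat gword set" where
  "cls \<equiv> braid_class n"

abbreviation \<sigma> :: "nat \<Rightarrow> nat gword set" where
  "\<sigma> i \<equiv> cls [(i, True)]"

text \<open>The subgroup generated by the generators of index above \<open>i\<close>.\<close>

definition neutral :: "nat \<Rightarrow> nat gword set set" where
  "neutral i = cls ` lists ({i + 1..<n} \<times> UNIV)"

definition positive :: "nat \<Rightarrow> nat gword set set" where
  "positive i = {g. sigma_i_positive n i g}"

lemma cls_closed [simp]: "w \<in> lists ({1..<n} \<times> UNIV) \<Longrightarrow> cls w \<in> carrier G"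
  unfolding G_eq by (rule braid_class_in_carrier)

lemma cls_append:
  "u \<in> lists ({1..<n} \<times> UNIV) \<Longrightarrow> v \<in> lists ({1..<n} \<times> UNIV) \<Longrightarrow> cls (u @ v) = cls u \<otimes> cls v"
  unfolding G_eq by (simp add: braid_class_append)

lemma cls_Nil: "cls [] = \<one>"
  by (simp add: G_eq braid_group_def presented_group_def braid_class_def)

lemma cls_eqI: "word_cong {1..<n} (braid_relations n) u v \<Longrightarrow> cls u = cls v"
  unfolding braid_class_def
  by (rule equiv_class_eq[OF equiv_word_cong_rel]) (simp add: word_cong_rel_def)

lemma carrier_eq: "carrier G = cls ` lists ({1..<n} \<times> UNIV)"
  by (auto simp: G_eq braid_group_def presented_group_def braid_class_def quotient_def)

lemma sigma_closed [simp]: "i \<in> {1..<n} \<Longrightarrow> \<sigma> i \<in> carrier G"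
  by (intro cls_closed) auto

lemma inv_sigma: "i \<in> {1..<n} \<Longrightarrow> inv (\<sigma> i) = cls [(i, False)]"
proof (rule inv_equality)
  assume i: "i \<in> {1..<n}"
  then show "\<sigma> i \<in> carrier G" "cls [(i, False)] \<in> carrier G" by (auto intro: cls_closed)
  have "cls [(i, False)] \<otimes> \<sigma> i = cls ([(i, False)] @ [(i, True)])"
    using i by (intro cls_append[symmetric]) auto
  also have "\<dots> = cls []"
    using word_cong.cancel[of i "{1..<n}" "braid_relations n" False] i by (intro cls_eqI) auto
  finally show "cls [(i, False)] \<otimes> \<sigma> i = \<one>" by (simp add: cls_Nil)
qed

lemma cls_Cons:
  assumes "i \<in> {1..<n}" "w \<in> lists ({1..<n} \<times> UNIV)"
  shows "cls ((i, b) # w) = (if b then \<sigma> i else inv (\<sigma> i)) \<otimes> cls w"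
proof -
  have "cls ([(i, b)] @ w) = cls [(i, b)] \<otimes> cls w"
    using assms by (intro cls_append) auto
  then show ?thesis using inv_sigma[OF assms(1)] by (cases b) auto
qed

lemma neutral_words: "lists ({i + 1..<n} \<times> (UNIV :: bool set)) \<subseteq> lists ({1..<n} \<times> UNIV)"
  by (rule lists_mono) auto

lemma neutral_closed: "g \<in> neutral i \<Longrightarrow> g \<in> carrier G"
  unfolding neutral_def using neutral_words cls_closed by blast

lemma neutral_0: "neutral 0 = carrier G"
  by (simp add: neutral_def carrier_eq)

lemma neutral_one: "\<one> \<in> neutral i"
  unfolding neutral_def using cls_Nil by (metis image_eqI lists.Nil)

lemma neutral_mult: "g \<in> neutral i \<Longrightarrow> h \<in> neutral i \<Longrightarrow> g \<otimes> h \<in> neutral i"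
proof -
  assume "g \<in> neutral i" "h \<in> neutral i"
  then obtain u v where u: "u \<in> lists ({i + 1..<n} \<times> UNIV)" "g = cls u"
    and v: "v \<in> lists ({i + 1..<n} \<times> UNIV)" "h = cls v" unfolding neutral_def by blast
  have "g \<otimes> h = cls (u @ v)"
    unfolding u(2) v(2) by (rule cls_append[symmetric]; rule subsetD[OF neutral_words]; fact)
  moreover have "u @ v \<in> lists ({i + 1..<n} \<times> UNIV)" using u v by auto
  ultimately show ?thesis unfolding neutral_def by blast
qed

lemma sigma_in_neutral: "k \<in> {i + 1..<n} \<Longrightarrow> \<sigma> k \<in> neutral i"
  unfolding neutral_def by (rule imageI) auto

lemma inv_sigma_in_neutral: "k \<in> {i + 1..<n} \<Longrightarrow> inv (\<sigma> k) \<in> neutral i"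
  unfolding neutral_def by (subst inv_sigma) (auto intro!: imageI)

lemma neutral_induct [consumes 1, case_names one gen inv_gen]:
  assumes "g \<in> neutral i" "Q \<one>"
    "\<And>k g. k \<in> {i + 1..<n} \<Longrightarrow> g \<in> neutral i \<Longrightarrow> Q g \<Longrightarrow> Q (\<sigma> k \<otimes> g)"
    "\<And>k g. k \<in> {i + 1..<n} \<Longrightarrow> g \<in> neutral i \<Longrightarrow> Q g \<Longrightarrow> Q (inv (\<sigma> k) \<otimes> g)"
  shows "Q g"
proof -
  obtain w where w: "w \<in> lists ({i + 1..<n} \<times> UNIV)" "g = cls w"
    using assms(1) unfolding neutral_def by blast
  have "Q (cls w)" using w(1)
  proof (induction w)
    case Nil
    then show ?case using assms(2) by (simp add: cls_Nil)
  next
    case (Cons l w)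
    obtain k b where l: "l = (k, b)" by (cases l)
    then have k: "k \<in> {i + 1..<n}" using Cons.hyps by auto
    have "cls w \<in> neutral i" using Cons.hyps unfolding neutral_def by blast
    moreover have "cls (l # w) = (if b then \<sigma> k else inv (\<sigma> k)) \<otimes> cls w"
      unfolding l using k Cons.hyps(2) neutral_words[of i] by (intro cls_Cons) auto
    ultimately show ?case using assms(3,4)[OF k] Cons.IH by auto
  qed
  then show ?thesis by (simp add: w)
qed

lemma neutral_inv: "g \<in> neutral i \<Longrightarrow> inv g \<in> neutral i"
proof (induction rule: neutral_induct)
  case (gen k g)
  then show ?case using neutral_closed[OF gen(2)]
    by (subst inv_mult_group) (auto intro!: neutral_mult inv_sigma_in_neutral)
next
  case (inv_gen k g)
  then show ?case using neutral_closed[OF inv_gen(2)]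
    by (subst inv_mult_group) (auto intro!: neutral_mult sigma_in_neutral)
qed (simp add: neutral_one)

lemma neutral_mono: "i \<le> j \<Longrightarrow> neutral j \<subseteq> neutral i"
  unfolding neutral_def by (intro image_mono lists_mono) auto

lemma positive_eq: "positive i = cls ` {w \<in> lists (sigma_alphabet n i). (i, True) \<in> set w}"
  unfolding positive_def by (auto simp: sigma_i_positive_iff)

lemma sigma_words:
  "i \<in> {1..<n} \<Longrightarrow> lists (sigma_alphabet n i) \<subseteq> lists ({1..<n} \<times> UNIV)"
  by (rule lists_mono) (auto simp: sigma_alphabet_def)

lemma positive_closed: "g \<in> positive i \<Longrightarrow> i \<in> {1..<n} \<Longrightarrow> g \<in> carrier G"
  unfolding positive_eq using sigma_words cls_closed by blast

lemma positive_subset_neutral: "i < j \<Longrightarrow> j < n \<Longrightarrow> positive j \<subseteq> neutral i"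
proof -
  assume "i < j" "j < n"
  then have "lists (sigma_alphabet n j) \<subseteq> lists ({i + 1..<n} \<times> UNIV)"
    by (intro lists_mono) (auto simp: sigma_alphabet_def)
  then show ?thesis unfolding positive_eq neutral_def by blast
qed

lemma sigma_word_class:
  assumes i: "i \<in> {1..<n}"
  shows "positive i \<union> neutral i = cls ` lists (sigma_alphabet n i)"
proof
  have "lists ({i + 1..<n} \<times> UNIV) \<subseteq> lists (sigma_alphabet n i)"
    by (rule lists_mono) (auto simp: sigma_alphabet_def)
  then show "positive i \<union> neutral i \<subseteq> cls ` lists (sigma_alphabet n i)"
    unfolding positive_eq neutral_def by blast
  have "w \<in> lists ({i + 1..<n} \<times> UNIV)"
    if "w \<in> lists (sigma_alphabet n i)" "(i, True) \<notin> set w" for w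
    using that by (auto simp: sigma_alphabet_def in_lists_conv_set)
  then show "cls ` lists (sigma_alphabet n i) \<subseteq> positive i \<union> neutral i"
    unfolding positive_eq neutral_def by blast
qed

lemma positive_mult_left:
  assumes i: "i \<in> {1..<n}" and "g \<in> positive i" "h \<in> positive i \<union> neutral i"
  shows "g \<otimes> h \<in> positive i" "h \<otimes> g \<in> positive i"
proof -
  obtain u where u: "u \<in> lists (sigma_alphabet n i)" "(i, True) \<in> set u" "g = cls u"
    using assms(2) unfolding positive_eq by blast
  obtain v where v: "v \<in> lists (sigma_alphabet n i)" "h = cls v"
    using assms(3) sigma_word_class[OF i] by blast
  have uv: "u \<in> lists ({1..<n} \<times> UNIV)" "v \<in> lists ({1..<n} \<times> UNIV)"
    using u v sigma_words[OF i] by blast+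
  have "g \<otimes> h = cls (u @ v)" "h \<otimes> g = cls (v @ u)"
    using uv by (simp_all add: u v cls_append)
  moreover have "u @ v \<in> lists (sigma_alphabet n i)" "v @ u \<in> lists (sigma_alphabet n i)"
    using u v by auto
  moreover have "(i, True) \<in> set (u @ v)" "(i, True) \<in> set (v @ u)" using u by auto
  ultimately show "g \<otimes> h \<in> positive i" "h \<otimes> g \<in> positive i" unfolding positive_eq by blast+
qed

lemmas positive_mult = positive_mult_left(1)[OF _ _ UnI1] and positive_neutral_mult = positive_mult_left(1)[OF _ _ UnI2]
  and neutral_positive_mult = positive_mult_left(2)[OF _ _ UnI2]

lemma sigma_in_positive: "i \<in> {1..<n} \<Longrightarrow> \<sigma> i \<in> positive i"
  unfolding positive_eq by (rule imageI) (auto simp: sigma_alphabet_def)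

text \<open>Cuts the word into factors with one \<open>\<sigma> i\<close> each; suited to properties
  that pass to products, such as those of conjugates.\<close>

lemma positive_induct [consumes 2, case_names base mult]:
  assumes "g \<in> positive i" and i: "i \<in> {1..<n}"
    and base: "\<And>k l. k \<in> neutral i \<Longrightarrow> l \<in> neutral i \<Longrightarrow> Q (k \<otimes> \<sigma> i \<otimes> l)"
    and mult: "\<And>g h. g \<in> positive i \<Longrightarrow> h \<in> positive i \<Longrightarrow> Q g \<Longrightarrow> Q h \<Longrightarrow> Q (g \<otimes> h)"
  shows "Q g"
proof -
  obtain w where w: "w \<in> lists (sigma_alphabet n i)" "(i, True) \<in> set w" "g = cls w"
    using assms(1) unfolding positive_eq by blast
  \<comment> \<open>\<open>k\<close> collects the neutral letters read before the next
    \<open>\<sigma> i\<close>.\<close>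
  have "\<forall>k\<in>neutral i. Q (k \<otimes> cls w)" using w(1,2)
  proof (induction w)
    case (Cons l w)
    have w: "w \<in> lists ({1..<n} \<times> UNIV)" using Cons.hyps(2) sigma_words[OF i] by blast
    show ?case
    proof
      fix k assume k: "k \<in> neutral i"
      then have kc: "k \<in> carrier G" by (rule neutral_closed)
      show "Q (k \<otimes> cls (l # w))"
      proof (cases "l = (i, True)")
        case True
        then have e: "cls (l # w) = \<sigma> i \<otimes> cls w" using cls_Cons[OF i w, of True] by simp
        show ?thesis
        proof (cases "(i, True) \<in> set w")
          case True
          then have "cls w \<in> positive i" using Cons.hyps(2) unfolding positive_eq by blast
          moreover have "k \<otimes> \<sigma> i \<otimes> \<one> \<in> positive i"
            using k i by (intro positive_neutral_mult neutral_positive_mult neutral_one sigma_in_positive)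
          moreover have "Q (\<one> \<otimes> cls w)" using Cons.IH True neutral_one by blast
          ultimately have "Q ((k \<otimes> \<sigma> i \<otimes> \<one>) \<otimes> cls w)"
            using mult base[OF k neutral_one] w by simp
          then show ?thesis using e kc i w by (simp add: m_assoc)
        next
          case False
          then have "w \<in> lists ({i + 1..<n} \<times> UNIV)"
            using Cons.hyps(2) by (auto simp: sigma_alphabet_def in_lists_conv_set)
          then have "cls w \<in> neutral i" unfolding neutral_def by blast
          then have "Q (k \<otimes> \<sigma> i \<otimes> cls w)" by (rule base[OF k])
          then show ?thesis using e kc i w by (simp add: m_assoc)
        qed
      next
        case False
        obtain j b where l: "l = (j, b)" by (cases l)
        have j: "j \<in> {i + 1..<n}" using Cons.hyps(1) False l by (auto simp: sigma_alphabet_def)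
        let ?a = "if b then \<sigma> j else inv (\<sigma> j)"
        have a: "?a \<in> neutral i" using sigma_in_neutral[OF j] inv_sigma_in_neutral[OF j] by simp
        have e: "cls (l # w) = ?a \<otimes> cls w"
          unfolding l using j i w by (intro cls_Cons) auto
        have "Q ((k \<otimes> ?a) \<otimes> cls w)"
          using Cons.IH Cons.prems False neutral_mult[OF k a] by auto
        then show ?thesis using e kc neutral_closed[OF a] w by (simp add: m_assoc)
      qed
    qed
  qed simp
  then have "Q (\<one> \<otimes> cls w)" using neutral_one by blast
  moreover have "cls w \<in> carrier G" using w sigma_words[OF i] cls_closed by blast
  ultimately show ?thesis by (simp add: w(3))
qed

lemma one_notin_positive: "\<one> \<notin> positive i"
  using not_sigma_i_positive_one[of n i] unfolding positive_def G_eq by simp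

section \<open>Positive braids in the braid group\<close>

definition pcls :: "nat list \<Rightarrow> nat gword set" where
  "pcls u = cls (map (\<lambda>i. (i, True)) u)"

text \<open>The value is independent of the chosen word when the support lies in
  \<open>{1..<n}\<close>, which has to be assumed because \<open>pbraid\<close> has generators of
  all indices.\<close>

definition emb :: "pbraid \<Rightarrow> nat gword set" where
  "emb x = pcls (SOME u. x = pbraid_of u)"

lemma pos_word: "set u \<subseteq> {1..<n} \<Longrightarrow> map (\<lambda>i. (i, True)) u \<in> lists ({1..<n} \<times> UNIV)"
  by auto

lemma pcls_append: "set u \<subseteq> {1..<n} \<Longrightarrow> set v \<subseteq> {1..<n} \<Longrightarrow> pcls (u @ v) = pcls u \<otimes> pcls v"
  unfolding pcls_def map_append by (intro cls_append pos_word)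

lemma pcls_step:
  assumes "pb_step u v" "set u \<subseteq> {1..<n}"
  shows "pcls u = pcls v"
  using assms
proof (induction rule: pb_step.induct)
  case (far i j u v)
  have "pcls [i, j] = pcls [j, i]" unfolding pcls_def
    using far by (intro cls_eqI word_cong.rel) (auto simp: far_def braid_relations_def)
  then show ?case using far by (simp add: pcls_append[of u] pcls_append[of "[_, _]" v, simplified])
next
  case (near i j u v)
  have "pcls [i, j, i] = pcls [j, i, j]"
  proof (cases "j = Suc i")
    case True
    then show ?thesis unfolding pcls_def
      using near by (intro cls_eqI word_cong.rel) (auto simp: braid_relations_def)
  next
    case False
    then have "i = Suc j" using near by (auto simp: near_def)
    then have "pcls [j, i, j] = pcls [i, j, i]" unfolding pcls_def
      using near by (intro cls_eqI word_cong.rel) (auto simp: braid_relations_def)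
    then show ?thesis by simp
  qed
  then show ?case using near
    by (simp add: pcls_append[of u] pcls_append[of "[_, _, _]" v, simplified])
qed

lemma pcls_eq: "pb_eq u v \<Longrightarrow> set u \<subseteq> {1..<n} \<Longrightarrow> pcls u = pcls v"
proof (induction rule: rtranclp_induct)
  case (step v w)
  then show ?case using pcls_step[OF step.hyps(2)] pb_eq_set[OF step.hyps(1)] by simp
qed simp

lemma emb_pbraid_of: "set u \<subseteq> {1..<n} \<Longrightarrow> emb (pbraid_of u) = pcls u"
proof -
  assume u: "set u \<subseteq> {1..<n}"
  let ?v = "SOME v. pbraid_of u = pbraid_of v"
  have "pbraid_of u = pbraid_of ?v" by (rule someI[of _ u]) (rule HOL.refl)
  then show ?thesis unfolding emb_def using pcls_eq[of u ?v] u pbraid_of_eq_iff by simp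
qed

lemma emb_one [simp]: "emb 1 = \<one>"
  using emb_pbraid_of[of "[]"] by (simp add: pcls_def cls_Nil)

lemma emb_gen: "i \<in> {1..<n} \<Longrightarrow> emb (gen i) = \<sigma> i"
  using emb_pbraid_of[of "[i]"] by (simp add: pcls_def)

lemma emb_mult:
  assumes "supp x \<subseteq> {1..<n}" "supp y \<subseteq> {1..<n}"
  shows "emb (x * y) = emb x \<otimes> emb y"
proof -
  obtain u where u: "x = pbraid_of u" by (rule pbraid_exhaust)
  obtain v where v: "y = pbraid_of v" by (rule pbraid_exhaust)
  show ?thesis
    using assms emb_pbraid_of[of "u @ v"] emb_pbraid_of[of u] emb_pbraid_of[of v]
    by (simp add: u v pcls_append)
qed

lemma emb_neutral: "supp x \<subseteq> {i + 1..<n} \<Longrightarrow> emb x \<in> neutral i"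
proof (induction x rule: pbraid_induct)
  case (gen k x)
  then have "emb (gen k * x) = \<sigma> k \<otimes> emb x"
    by (subst emb_mult) (auto simp: emb_gen)
  then show ?case using gen neutral_mult sigma_in_neutral by simp
qed (simp add: neutral_one)

lemma emb_closed [simp]: "supp x \<subseteq> {1..<n} \<Longrightarrow> emb x \<in> carrier G"
  using emb_neutral[of x 0] neutral_0 by simp

lemma emb_nonneg: "i \<in> {1..<n} \<Longrightarrow> supp x \<subseteq> {i..<n} \<Longrightarrow> emb x \<in> positive i \<union> neutral i"
proof (induction x rule: pbraid_induct)
  case one
  then show ?case by (simp add: neutral_one)
next
  case (gen k x)
  then have e: "emb (gen k * x) = \<sigma> k \<otimes> emb x"
    by (subst emb_mult) (auto simp: emb_gen)
  show ?case
  proof (cases "k = i")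
    case True
    then show ?thesis using gen e positive_mult_left(1) sigma_in_positive by auto
  next
    case False
    then have "\<sigma> k \<in> neutral i" using gen.prems by (intro sigma_in_neutral) auto
    then show ?thesis using gen e neutral_positive_mult neutral_mult by auto
  qed
qed

lemma emb_ldvd_closed: "supp m \<subseteq> {1..<n} \<Longrightarrow> ldvd x m \<Longrightarrow> emb x \<in> carrier G"
  using ldvd_supp by (intro emb_closed) blast

lemma emb_edge:
  assumes "supp m \<subseteq> {1..<n}" "edge m i x y"
  shows "i \<in> {1..<n}" "emb x \<in> carrier G" "emb y = emb x \<otimes> \<sigma> i"
proof -
  have y: "y = x * gen i" and "supp y \<subseteq> {1..<n}"
    using assms ldvd_supp unfolding edge_def by blast+
  then have *: "supp x \<subseteq> {1..<n}" "i \<in> {1..<n}" by auto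
  then show "i \<in> {1..<n}" "emb x \<in> carrier G" by auto
  show "emb y = emb x \<otimes> \<sigma> i" unfolding y using * by (simp add: emb_mult emb_gen)
qed

lemma inv_mult_assoc:
  "x \<in> carrier G \<Longrightarrow> y \<in> carrier G \<Longrightarrow> z \<in> carrier G \<Longrightarrow>
   inv x \<otimes> z = (inv x \<otimes> y) \<otimes> (inv y \<otimes> z)"
  using r_inv l_one m_assoc inv_closed m_closed by metis

section \<open>Paths of divisors as elements of the braid group\<close>

lemma nconn_neutral:
  "nconn m i x y \<Longrightarrow> supp m \<subseteq> {1..<n} \<Longrightarrow> ldvd x m \<Longrightarrow> inv (emb x) \<otimes> emb y \<in> neutral i"
proof (induction rule: nconn.induct)
  case (refl x)
  then show ?case using emb_ldvd_closed by (simp add: neutral_one)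
next
  case (up x y k z)
  note e = emb_edge[OF up.prems(1) up.hyps(2)]
  have "inv (emb x) \<otimes> emb z = (inv (emb x) \<otimes> emb y) \<otimes> \<sigma> k"
    using e emb_ldvd_closed[OF up.prems] by (simp add: m_assoc)
  then show ?case using up e sigma_in_neutral neutral_mult by simp
next
  case (down x y k z)
  note e = emb_edge[OF down.prems(1) down.hyps(2)]
  have "emb z = emb y \<otimes> inv (\<sigma> k)" using e by (simp add: m_assoc)
  then have "inv (emb x) \<otimes> emb z = (inv (emb x) \<otimes> emb y) \<otimes> inv (\<sigma> k)"
    using e emb_ldvd_closed[OF down.prems] by (simp add: m_assoc)
  then show ?case using down e inv_sigma_in_neutral neutral_mult by simp
qed

lemma pconn_positive:
  "pconn m i x y \<Longrightarrow> supp m \<subseteq> {1..<n} \<Longrightarrow> i \<in> {1..<n} \<and> inv (emb x) \<otimes> emb y \<in> positive i"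
proof (induction rule: pconn.induct)
  case (edge x a b y)
  note e = emb_edge[OF edge.prems edge.hyps(2)]
  have l: "ldvd b m" "ldvd a m" using edge.hyps(2) ldvd_prefix unfolding edge_def by auto
  have lx: "ldvd x m" using nconn_ldvd[OF nconn_sym[OF edge.hyps(1)] l(2)] .
  have ly: "ldvd y m" using nconn_ldvd[OF edge.hyps(3) l(1)] .
  note c = emb_ldvd_closed[OF edge.prems]
  have k: "inv (emb x) \<otimes> emb a \<in> neutral i" "inv (emb b) \<otimes> emb y \<in> neutral i"
    using nconn_neutral edge lx l by blast+
  have "inv (emb a) \<otimes> emb b = \<sigma> i" using e by (simp add: m_assoc[symmetric])
  then have "inv (emb x) \<otimes> emb y = (inv (emb x) \<otimes> emb a) \<otimes> \<sigma> i \<otimes> (inv (emb b) \<otimes> emb y)"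
    using inv_mult_assoc[of "emb x" "emb b" "emb y"] inv_mult_assoc[of "emb x" "emb a" "emb b"]
      c[OF lx] c[OF ly] c[OF l(1)] c[OF l(2)] by simp
  then show ?case using k e positive_neutral_mult neutral_positive_mult sigma_in_positive by simp
next
  case (trans x y z)
  have "ldvd x m" "ldvd y m" "ldvd z m" using trans.hyps pconn_ldvd by blast+
  then have "inv (emb x) \<otimes> emb z = (inv (emb x) \<otimes> emb y) \<otimes> (inv (emb y) \<otimes> emb z)"
    using emb_ldvd_closed[OF trans.prems] by (intro inv_mult_assoc)
  then show ?case using trans positive_mult by simp
qed

text \<open>A closed positive path would make the identity sigma_i-positive. This is where the
  Dynnikov coordinates enter the comparison argument.\<close>

lemma pconn_irrefl: "supp m \<subseteq> {1..<n} \<Longrightarrow> \<not> pconn m i x x"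
  using pconn_positive[of m i x x] pconn_ldvd[of m i x x] emb_ldvd_closed[of m x] one_notin_positive by auto

lemma nconn_ldvd_one: "ldvd x m \<Longrightarrow> supp m \<subseteq> {1..<n} \<Longrightarrow> nconn m 0 1 x"
proof -
  assume x: "ldvd x m" and m: "supp m \<subseteq> {1..<n}"
  obtain u where u: "x = pbraid_of u" by (rule pbraid_exhaust)
  have "ldvd (pbraid_of u) m \<Longrightarrow> nconn m 0 1 (pbraid_of u)"
  proof (induction u rule: rev_induct)
    case (snoc i u)
    then have "edge m i (pbraid_of u) (pbraid_of (u @ [i]))" by (simp add: edge_def)
    moreover have "i > 0" using ldvd_supp[OF snoc.prems] m by auto
    moreover have "ldvd (pbraid_of u) m" using snoc.prems ldvd_prefix by auto
    ultimately show ?case using snoc.IH nconn.up by blast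
  qed (simp add: nconn.refl)
  then show ?thesis using x u by simp
qed

section \<open>Full twists and fractions\<close>

definition full_twist :: "nat \<Rightarrow> nat gword set" where
  "full_twist j = emb (twist (Suc j) n)"

lemma supp_twist_Suc: "supp (twist (Suc j) n ^ k) \<subseteq> {1..<n}"
  using supp_twist[of "Suc j" n] by auto

lemma full_twist_closed [simp]: "full_twist j \<in> carrier G"
  unfolding full_twist_def using supp_twist_Suc[of j 1] by (intro emb_closed) auto

lemma emb_twist_power: "emb (twist (Suc j) n ^ k) = full_twist j [^] k"
proof (induction k)
  case (Suc k)
  have "emb (twist (Suc j) n * twist (Suc j) n ^ k) = full_twist j \<otimes> emb (twist (Suc j) n ^ k)"
    unfolding full_twist_def using supp_twist_Suc[of j k] supp_twist_Suc[of j 1] by (intro emb_mult) auto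
  then show ?case unfolding power_Suc nat_pow_Suc2[OF full_twist_closed] by (simp only: Suc)
qed simp

lemma full_twist_commute_sigma:
  assumes "k \<in> {Suc j..<n}"
  shows "full_twist j \<otimes> \<sigma> k = \<sigma> k \<otimes> full_twist j"
proof -
  have k: "k \<in> {1..<n}" and t: "supp (twist (Suc j) n) \<subseteq> {1..<n}"
    using assms supp_twist_Suc[of j 1] by auto
  have "emb (twist (Suc j) n * gen k) = emb (gen k * twist (Suc j) n)"
    using twist_central_gen[OF assms] by simp
  then show ?thesis unfolding full_twist_def using k t by (simp add: emb_mult emb_gen)
qed

lemma full_twist_commute: "g \<in> neutral j \<Longrightarrow> full_twist j \<otimes> g = g \<otimes> full_twist j"
proof (induction rule: neutral_induct)
  case (gen k g)
  have k: "k \<in> {1..<n}" and g: "g \<in> carrier G" using gen neutral_closed by auto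
  have "full_twist j \<otimes> \<sigma> k = \<sigma> k \<otimes> full_twist j" using full_twist_commute_sigma[of k j] gen by simp
  then have "full_twist j \<otimes> (\<sigma> k \<otimes> g) = \<sigma> k \<otimes> (full_twist j \<otimes> g)"
    using k g by (simp add: m_assoc[symmetric])
  then show ?case using gen k g by (simp add: m_assoc)
next
  case (inv_gen k g)
  have k: "k \<in> {1..<n}" using inv_gen by auto
  have "full_twist j \<otimes> inv (\<sigma> k) = inv (\<sigma> k) \<otimes> full_twist j"
    using full_twist_commute_sigma[of k j] inv_gen k
    by (metis full_twist_closed Suc_eq_plus1 inv_closed inv_solve_left inv_solve_right m_assoc m_closed sigma_closed)
  then have "full_twist j \<otimes> (inv (\<sigma> k) \<otimes> g) = inv (\<sigma> k) \<otimes> (full_twist j \<otimes> g)"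
    using neutral_closed[OF inv_gen(2)] k by (simp add: m_assoc[symmetric])
  then show ?case using inv_gen k neutral_closed by (simp add: m_assoc)
qed simp

lemma full_twist_pow_commute: "g \<in> neutral j \<Longrightarrow> full_twist j [^] (k::nat) \<otimes> g = g \<otimes> full_twist j [^] k"
proof (induction k)
  case (Suc k)
  have g: "g \<in> carrier G" using Suc.prems neutral_closed by blast
  have "full_twist j [^] Suc k \<otimes> g = full_twist j [^] k \<otimes> (g \<otimes> full_twist j)"
    using g full_twist_commute[OF Suc.prems] by (simp add: m_assoc)
  also have "\<dots> = g \<otimes> full_twist j [^] k \<otimes> full_twist j"
    using g Suc by (simp add: m_assoc[symmetric])
  finally show ?case using g by (simp add: m_assoc)
qed (simp add: neutral_closed)

text \<open>A positive letter commutes past the twists; an inverse letter is cleared by one further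
  full twist, of which every generator involved is a left divisor.\<close>

lemma twist_fraction:
  "g \<in> neutral j \<Longrightarrow> \<exists>k x. supp x \<subseteq> {Suc j..<n} \<and> full_twist j [^] (k::nat) \<otimes> g = emb x"
proof (induction rule: neutral_induct)
  case one
  show ?case by (rule exI[of _ 0], rule exI[of _ 1]) simp
next
  case (gen i g)
  then obtain k x where x: "supp x \<subseteq> {Suc j..<n}" "full_twist j [^] (k::nat) \<otimes> g = emb x" by auto
  have i: "i \<in> {1..<n}" and g: "g \<in> carrier G" and xs: "supp x \<subseteq> {1..<n}"
    using gen x neutral_closed by auto
  have "full_twist j [^] k \<otimes> (\<sigma> i \<otimes> g) = \<sigma> i \<otimes> (full_twist j [^] k \<otimes> g)"
    using full_twist_pow_commute[OF sigma_in_neutral[OF gen(1)], of k] i g by (simp add: m_assoc[symmetric])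
  also have "\<dots> = emb (gen i * x)"
    using x i xs by (simp add: emb_mult emb_gen)
  finally show ?case using x gen by (intro exI[of _ k] exI[of _ "gen i * x"]) auto
next
  case (inv_gen i g)
  then obtain k x where x: "supp x \<subseteq> {Suc j..<n}" "full_twist j [^] (k::nat) \<otimes> g = emb x" by auto
  have i: "i \<in> {1..<n}" and g: "g \<in> carrier G" and xs: "supp x \<subseteq> {1..<n}"
    using inv_gen x neutral_closed by auto
  obtain r where r: "twist (Suc j) n = gen i * r" using gen_ldvd_twist[of i "Suc j" n] inv_gen by auto
  have rs: "supp r \<subseteq> {Suc j..<n}" using supp_twist[of "Suc j" n] r by auto
  then have rs1: "supp r \<subseteq> {1..<n}" by auto
  have "full_twist j = \<sigma> i \<otimes> emb r" unfolding full_twist_def r using rs1 i by (simp add: emb_mult emb_gen)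
  then have cr: "inv (\<sigma> i) \<otimes> full_twist j = emb r" using i rs1 by (simp add: m_assoc[symmetric])
  have er: "emb r \<in> carrier G" using rs1 by simp
  have "full_twist j [^] Suc k \<otimes> (inv (\<sigma> i) \<otimes> g) = inv (\<sigma> i) \<otimes> full_twist j [^] Suc k \<otimes> g"
    using full_twist_pow_commute[OF inv_sigma_in_neutral[OF inv_gen(1)], of "Suc k"] i g by (simp add: m_assoc[symmetric])
  also have "\<dots> = emb r \<otimes> (full_twist j [^] k \<otimes> g)"
    unfolding nat_pow_Suc2[OF full_twist_closed] using i g cr er by (simp add: m_assoc[symmetric])
  also have "\<dots> = emb (r * x)" using x xs rs1 by (simp add: emb_mult)
  finally show ?case using x rs by (intro exI[of _ "Suc k"] exI[of _ "r * x"]) auto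
qed

text \<open>\<open>g\<close> is a fraction with a power of the full twist as denominator and the
  positive braid \<open>x\<close> as numerator. The exponent \<open>N\<close> is large enough for
  both to divide \<open>m\<close>, and the interval comparison then applies to them.\<close>

theorem trichotomy:
  assumes "g \<in> carrier G"
  shows "g = \<one> \<or> (\<exists>i\<in>{1..<n}. g \<in> positive i \<or> inv g \<in> positive i)"
proof -
  let ?t = "twist (Suc 0) n"
  obtain k x where x: "supp x \<subseteq> {1..<n}" and gx: "full_twist 0 [^] (k::nat) \<otimes> g = emb x"
    using twist_fraction[of g 0] assms neutral_0 by auto
  define N where "N = max k (plen x)"
  define m where "m = ?t ^ N"
  have m: "supp m \<subseteq> {1..<n}" unfolding m_def using supp_twist_Suc by simp
  have xm: "ldvd x m" unfolding m_def N_def using x by (intro ldvd_twist_power) auto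
  have "m = ?t ^ k * ?t ^ (N - k)" unfolding m_def N_def by (simp add: power_add[symmetric])
  then have km: "ldvd (?t ^ k) m" unfolding ldvd_def by blast
  have e: "emb (?t ^ k) = full_twist 0 [^] k" by (rule emb_twist_power)
  have g: "inv (emb (?t ^ k)) \<otimes> emb x = g"
    using assms by (simp add: e gx[symmetric] m_assoc[symmetric])
  then have g': "inv (emb x) \<otimes> emb (?t ^ k) = inv g"
    using x e by (simp add: g[symmetric] inv_mult_group)
  have "nconn m 0 (?t ^ k) x"
    using nconn_trans[OF nconn_ldvd_one[OF xm m] nconn_sym[OF nconn_ldvd_one[OF km m]]] .
  from interval_comparison[OF pconn_irrefl[OF m] m this]
  consider "?t ^ k = x" | i where "i \<in> {1..<n}" "pconn m i (?t ^ k) x \<or> pconn m i x (?t ^ k)"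
    by blast
  then show ?thesis
  proof cases
    case 1
    then show ?thesis using g x by simp
  next
    case 2
    then show ?thesis using pconn_positive[OF _ m] g g' by metis
  qed
qed

end

section \<open>Orderings and positive cones\<close>

context group
begin

definition is_cone :: "'a set \<Rightarrow> bool" where
  "is_cone Q \<longleftrightarrow> Q \<subseteq> carrier G \<and> \<one> \<notin> Q \<and> (\<forall>g\<in>Q. \<forall>h\<in>Q. g \<otimes> h \<in> Q) \<and>
     (\<forall>g\<in>carrier G. g = \<one> \<or> g \<in> Q \<or> inv g \<in> Q)"

lemma cone_inv: "is_cone Q \<Longrightarrow> g \<in> Q \<Longrightarrow> inv g \<notin> Q"
  unfolding is_cone_def by (metis r_inv subsetD)

lemma cone_left_ordering:
  assumes Q: "is_cone Q"
  shows "ordering_of_cone G Q \<in> left_orderings G"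
proof -
  let ?r = "ordering_of_cone G Q"
  have QG: "Q \<subseteq> carrier G" using Q by (simp add: is_cone_def)
  have "refl_on (carrier G) ?r" "?r \<subseteq> carrier G \<times> carrier G"
    by (auto simp: refl_on_def ordering_of_cone_def)
  moreover have "trans ?r"
  proof (rule transI)
    fix x y z assume xy: "(x, y) \<in> ?r" and yz: "(y, z) \<in> ?r"
    then have c: "x \<in> carrier G" "y \<in> carrier G" "z \<in> carrier G"
      by (auto simp: ordering_of_cone_def)
    have "inv x \<otimes> z = (inv x \<otimes> y) \<otimes> (inv y \<otimes> z)"
      using c r_inv l_one m_assoc inv_closed m_closed by metis
    then show "(x, z) \<in> ?r"
      using xy yz Q unfolding ordering_of_cone_def is_cone_def by auto
  qed
  moreover have "antisym ?r"
  proof (rule antisymI)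
    fix x y assume xy: "(x, y) \<in> ?r" and yx: "(y, x) \<in> ?r"
    then have c: "x \<in> carrier G" "y \<in> carrier G" by (auto simp: ordering_of_cone_def)
    then have "inv (inv x \<otimes> y) = inv y \<otimes> x" by (simp add: inv_mult_group)
    then show "x = y"
      using xy yx cone_inv[OF Q, of "inv x \<otimes> y"] unfolding ordering_of_cone_def by auto
  qed
  moreover have "total_on (carrier G) ?r"
  proof (rule total_onI)
    fix x y assume c: "x \<in> carrier G" "y \<in> carrier G" "x \<noteq> y"
    then have "inv (inv x \<otimes> y) = inv y \<otimes> x" "inv x \<otimes> y \<noteq> \<one>"
      using inv_solve_left[of \<one> x y] by (auto simp: inv_mult_group)
    then show "(x, y) \<in> ?r \<or> (y, x) \<in> ?r"
      using Q c unfolding is_cone_def ordering_of_cone_def by (metis (mono_tags, lifting) case_prodI inv_closed m_closed mem_Collect_eq)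
  qed
  moreover have "(f \<otimes> g, f \<otimes> h) \<in> ?r" if "f \<in> carrier G" "(g, h) \<in> ?r" for f g h
  proof -
    have c: "g \<in> carrier G" "h \<in> carrier G" using that by (auto simp: ordering_of_cone_def)
    have "inv f \<otimes> (f \<otimes> h) = h"
      using that(1) c by (simp add: m_assoc[symmetric])
    then have "inv (f \<otimes> g) \<otimes> (f \<otimes> h) = inv g \<otimes> h"
      using that(1) c by (simp add: inv_mult_group m_assoc)
    then show ?thesis using that c by (auto simp: ordering_of_cone_def)
  qed
  ultimately show ?thesis
    unfolding left_orderings_def order_on_defs by simp
qed

lemma positive_cone_of_cone: "is_cone Q \<Longrightarrow> positive_cone G (ordering_of_cone G Q) = Q"
  by (auto simp: positive_cone_def ordering_of_cone_def is_cone_def)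

definition conj_cone :: "'a set \<Rightarrow> 'a \<Rightarrow> 'a set" where
  "conj_cone Q f = {g \<in> carrier G. f \<otimes> g \<otimes> inv f \<in> Q}"

lemma conj_mult:
  assumes "f \<in> carrier G" "g \<in> carrier G" "h \<in> carrier G"
  shows "f \<otimes> (g \<otimes> h) \<otimes> inv f = (f \<otimes> g \<otimes> inv f) \<otimes> (f \<otimes> h \<otimes> inv f)"
proof -
  have "inv f \<otimes> (f \<otimes> (h \<otimes> inv f)) = h \<otimes> inv f"
    using assms by (simp add: m_assoc[symmetric])
  then show ?thesis using assms by (simp add: m_assoc)
qed

lemma conj_inv:
  assumes "f \<in> carrier G" "g \<in> carrier G"
  shows "f \<otimes> inv g \<otimes> inv f = inv (f \<otimes> g \<otimes> inv f)"
  using assms by (simp add: inv_mult_group m_assoc)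

lemma conj_eq_one:
  assumes "f \<in> carrier G" "g \<in> carrier G" "f \<otimes> g \<otimes> inv f = \<one>"
  shows "g = \<one>"
  using assms inv_solve_right'[of \<one> "f \<otimes> g" f] r_cancel_one by auto

lemma is_cone_conj:
  assumes Q: "is_cone Q" and f: "f \<in> carrier G"
  shows "is_cone (conj_cone Q f)"
proof -
  have "g = \<one> \<or> g \<in> conj_cone Q f \<or> inv g \<in> conj_cone Q f" if "g \<in> carrier G" for g
  proof -
    have "f \<otimes> g \<otimes> inv f = \<one> \<or> f \<otimes> g \<otimes> inv f \<in> Q \<or> inv (f \<otimes> g \<otimes> inv f) \<in> Q"
      using Q f that unfolding is_cone_def by (meson inv_closed m_closed)
    then show ?thesis
      using f that conj_inv[OF f that] conj_eq_one[OF f that] unfolding conj_cone_def by auto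
  qed
  moreover have "g \<otimes> h \<in> conj_cone Q f" if "g \<in> conj_cone Q f" "h \<in> conj_cone Q f" for g h
    using Q that conj_mult[OF f, of g h] unfolding is_cone_def conj_cone_def by auto
  ultimately show ?thesis
    using Q f unfolding is_cone_def by (auto simp: conj_cone_def)
qed

lemma conjugate_ordering_of_cone:
  assumes Q: "is_cone Q" and f: "f \<in> carrier G"
  shows "conjugate_ordering G (ordering_of_cone G Q) f = ordering_of_cone G (conj_cone Q f)"
proof -
  have "f \<otimes> g \<otimes> inv f = f \<otimes> h \<otimes> inv f \<longleftrightarrow> g = h"
    "inv (f \<otimes> g \<otimes> inv f) \<otimes> (f \<otimes> h \<otimes> inv f) = f \<otimes> (inv g \<otimes> h) \<otimes> inv f"
    if "g \<in> carrier G" "h \<in> carrier G" for g h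
    using that f conj_mult[OF f, of "inv g" h] conj_inv[OF f that(1)] by auto
  then show ?thesis
    using f by (auto simp: conjugate_ordering_def ordering_of_cone_def conj_cone_def)
qed

text \<open>An element of \<open>Q'\<close> outside \<open>Q\<close> would have its inverse in
  \<open>Q\<close>, hence in \<open>Q'\<close>, which a cone forbids.\<close>

lemma cone_subset_eq:
  assumes "is_cone Q" "is_cone Q'" "Q \<subseteq> Q'"
  shows "Q = Q'"
proof
  show "Q' \<subseteq> Q"
  proof
    fix x assume x: "x \<in> Q'"
    then have "x \<in> carrier G" "x \<noteq> \<one>" using assms(2) by (auto simp: is_cone_def)
    then show "x \<in> Q"
      using assms cone_inv[OF assms(2) x] unfolding is_cone_def by blast
  qed
qed fact

section \<open>Convergence in the space of orderings\<close>

lemma topspace_ordering_topology: "topspace (ordering_topology G) = left_orderings G"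
  unfolding ordering_topology_def topology_generated_by_topspace by auto

text \<open>A sub-basic set concerns a single pair, and eventual membership passes to finite
  intersections and to unions; so convergence may be checked pair by pair.\<close>

lemma limitin_orderings:
  assumes r: "r \<in> left_orderings G" and t: "\<And>k. t k \<in> left_orderings G"
    and ev: "\<And>f g. (f, g) \<in> r \<Longrightarrow> eventually (\<lambda>k. (f, g) \<in> t k) sequentially"
  shows "limitin (ordering_topology G) t r sequentially"
proof -
  let ?S = "insert (left_orderings G)
        {{r \<in> left_orderings G. (f, g) \<in> r} |f g. f \<in> carrier G \<and> g \<in> carrier G \<and> f \<noteq> g}"
  have "r \<in> U \<Longrightarrow> eventually (\<lambda>k. t k \<in> U) sequentially" if "generate_topology_on ?S U" for U
    using that
  proof (induction rule: generate_topology_on.induct)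
    case (Int U V)
    then show ?case by (auto intro: eventually_conj)
  next
    case (UN \<U>)
    then obtain U where "U \<in> \<U>" "r \<in> U" by blast
    then show ?case using UN.IH[of U] by (auto elim: eventually_mono)
  next
    case (Basis U)
    then consider "U = left_orderings G"
      | f g where "U = {r \<in> left_orderings G. (f, g) \<in> r}" by blast
    then show ?case using Basis.prems t ev by cases auto
  qed simp
  then show ?thesis
    unfolding limitin_def topspace_ordering_topology
    using r by (simp add: ordering_topology_def openin_topology_generated_by_iff)
qed

end

section \<open>The orderings of the braid group\<close>

context braids
begin

text \<open>\<open>\<epsilon>\<close> chooses a sign for every level: constantly \<open>True\<close>
  it gives Dehornoy's cone, and \<open>odd\<close> gives that of Dubrovina and Dubrovin.\<close>

definition signed_cone :: "(nat \<Rightarrow> bool) \<Rightarrow> nat gword set set" where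
  "signed_cone \<epsilon> = {g \<in> carrier G. \<exists>i\<in>{1..<n}. (if \<epsilon> i then g else inv g) \<in> positive i}"

lemma signed_mult:
  assumes g: "g \<in> carrier G" "(if b then g else inv g) \<in> positive i" and h: "h \<in> carrier G"
    and hPK: "(if b then h else inv h) \<in> positive i \<union> neutral i" and i: "i \<in> {1..<n}"
  shows "(if b then g \<otimes> h else inv (g \<otimes> h)) \<in> positive i" "(if b then h \<otimes> g else inv (h \<otimes> g)) \<in> positive i"
  using assms positive_mult_left[OF i g(2) hPK] by (auto simp: inv_mult_group)

text \<open>In a product the factor of smaller index decides: the other factor is neutral at that
  level, whatever its sign. Totality is \<open>trichotomy\<close>.\<close>

lemma is_cone_signed_cone: "is_cone (signed_cone \<epsilon>)"
proof -
  have "g \<otimes> h \<in> signed_cone \<epsilon>" if gs: "g \<in> signed_cone \<epsilon>" and hs: "h \<in> signed_cone \<epsilon>" for g h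
  proof -
    obtain i where g: "g \<in> carrier G" "i \<in> {1..<n}" "(if \<epsilon> i then g else inv g) \<in> positive i"
      using gs unfolding signed_cone_def by blast
    obtain j where h: "h \<in> carrier G" "j \<in> {1..<n}" "(if \<epsilon> j then h else inv h) \<in> positive j"
      using hs unfolding signed_cone_def by blast
    \<comment> \<open>The signs \<open>b\<close> and \<open>b'\<close> are independent because
      \<open>neutral k\<close> is closed under inverses.\<close>
    have neutral: "(if b then x else inv x) \<in> neutral k"
      if "k < l" "l < n" "x \<in> carrier G" "(if b' then x else inv x) \<in> positive l" for b b' k l x
    proof -
      have "(if b' then x else inv x) \<in> neutral k" using positive_subset_neutral[OF that(1,2)] that(4) by blast
      then show ?thesis using neutral_inv[of "inv x" k] neutral_inv[of x k] that(3) by (auto split: if_splits)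
    qed
    consider "i = j" | "i < j" | "j < i" by linarith
    then show ?thesis
    proof cases
      case 1
      then show ?thesis
        using signed_mult(1)[OF g(1,3) h(1) _ g(2)] g h unfolding signed_cone_def by blast
    next
      case 2
      then have "(if \<epsilon> i then h else inv h) \<in> neutral i" using neutral h by simp
      then show ?thesis
        using signed_mult(1)[OF g(1,3) h(1) _ g(2)] g h unfolding signed_cone_def by blast
    next
      case 3
      then have "(if \<epsilon> j then g else inv g) \<in> neutral j" using neutral g by simp
      then show ?thesis
        using signed_mult(2)[OF h(1,3) g(1) _ h(2)] g h unfolding signed_cone_def by blast
    qed
  qed
  moreover have "\<one> \<notin> signed_cone \<epsilon>" using one_notin_positive by (auto simp: signed_cone_def)
  moreover have "g = \<one> \<or> g \<in> signed_cone \<epsilon> \<or> inv g \<in> signed_cone \<epsilon>" if g: "g \<in> carrier G" for g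
    using trichotomy[OF g] g unfolding signed_cone_def by force
  ultimately show ?thesis unfolding is_cone_def by (auto simp: signed_cone_def)
qed

lemma dehornoy_eq: "dehornoy_ordering n = ordering_of_cone G (signed_cone (\<lambda>_. True))"
proof -
  have "{g. sigma_positive n g} = signed_cone (\<lambda>_. True)"
    unfolding sigma_positive_def signed_cone_def using positive_closed by (auto simp: positive_def)
  then show ?thesis unfolding dehornoy_ordering_def G_eq by simp
qed

lemma positive_neutral_disjoint: "i \<in> {1..<n} \<Longrightarrow> g \<in> positive i \<Longrightarrow> g \<notin> neutral i"
  using positive_neutral_mult[of i g "inv g"] neutral_inv[of g i] one_notin_positive positive_closed r_inv by metis

lemma shifted_subgroup_eq:
  assumes "n \<ge> 2"
  shows "shifted_subgroup n = neutral 1"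
proof
  have gen: "braid_gen n ` {2..<n} = \<sigma> ` {2..<n}" by (simp add: braid_gen_def)
  show "shifted_subgroup n \<subseteq> neutral 1"
  proof
    fix g assume "g \<in> shifted_subgroup n"
    then have "g \<in> generate G (\<sigma> ` {2..<n})" by (simp add: shifted_subgroup_def gen G_eq)
    then show "g \<in> neutral 1"
    proof induction
      case one show ?case by (rule neutral_one)
    next
      case (incl h) then show ?case by (auto intro: sigma_in_neutral)
    next
      case (inv h) then show ?case by (auto intro: inv_sigma_in_neutral)
    next
      case (eng g h) then show ?case by (blast intro: neutral_mult)
    qed
  qed
  show "neutral 1 \<subseteq> shifted_subgroup n"
  proof
    fix g assume "g \<in> neutral 1"
    then have "g \<in> generate G (\<sigma> ` {2..<n})"
    proof (induction rule: neutral_induct)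
      case one show ?case by (rule generate.one)
    next
      case (gen k g)
      then show ?case by (intro generate.eng[OF generate.incl]) auto
    next
      case (inv_gen k g)
      then show ?case by (intro generate.eng[OF generate.inv]) auto
    qed
    then show "g \<in> shifted_subgroup n" by (simp add: shifted_subgroup_def gen G_eq)
  qed
qed

end

section \<open>The shift from \<open>n - 1\<close> to \<open>n\<close> strands\<close>

lemma braids_braid_group: "braids (braid_group n) n"
  by (simp add: braids_def braids_axioms_def group_braid_group)

abbreviation (input) shift_word :: "nat gword \<Rightarrow> nat gword" where
  "shift_word \<equiv> map (\<lambda>(i, b). (i + 1, b))"

lemma shift_word_lists:
  "w \<in> lists ({1..<n - 1} \<times> UNIV) \<Longrightarrow> shift_word w \<in> lists ({1..<n} \<times> UNIV)"
  by (induction rule: lists.induct) auto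

lemma word_cong_shift:
  "word_cong {1..<n - 1} (braid_relations (n - 1)) u v \<Longrightarrow>
   word_cong {1..<n} (braid_relations n) (shift_word u) (shift_word v)"
proof (induction rule: word_cong.induct)
  case (refl w)
  then show ?case by (intro word_cong.refl shift_word_lists)
next
  case (sym u v)
  show ?case by (rule word_cong.sym[OF sym.IH])
next
  case (trans u v w)
  then show ?case by (metis word_cong.trans)
next
  case (append u u' v v')
  then show ?case by (simp add: word_cong.append)
next
  case (cancel x b)
  then show ?case using word_cong.cancel[of "x + 1" "{1..<n}"] by auto
next
  case (rel u v)
  have "(shift_word u, shift_word v) \<in> braid_relations n"
    using rel(1) unfolding braid_relations_def by fastforce
  then show ?case using rel by (intro word_cong.rel shift_word_lists)
qed

text \<open>Equivalent words have equivalent shifts, so the union in \<open>braid_shift\<close> is a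
  union of copies of one class.\<close>

lemma braid_shift_class:
  assumes "w \<in> lists ({1..<n - 1} \<times> UNIV)"
  shows "braid_shift n (braid_class (n - 1) w) = braid_class n (shift_word w)"
proof -
  interpret braids "braid_group n" n by (rule braids_braid_group)
  have "cls (shift_word v) = cls (shift_word w)" if "v \<in> braid_class (n - 1) w" for v
  proof -
    have "word_cong {1..<n - 1} (braid_relations (n - 1)) w v"
      using that by (simp add: braid_class_def word_cong_rel_def)
    from cls_eqI[OF word_cong_shift[OF this]] show ?thesis by simp
  qed
  moreover have "w \<in> braid_class (n - 1) w"
    using assms by (auto simp: braid_class_def word_cong_rel_def intro: word_cong.refl)
  ultimately show ?thesis unfolding braid_shift_def by blast
qed

lemma shift_sigma_words:
  "lists (sigma_alphabet n (Suc i)) = shift_word ` lists (sigma_alphabet (n - 1) i)"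
proof -
  have "sigma_alphabet n (Suc i) = (\<lambda>(k, b). (k + 1, b)) ` sigma_alphabet (n - 1) i"
  proof
    show "sigma_alphabet n (Suc i) \<subseteq> (\<lambda>(k, b). (k + 1, b)) ` sigma_alphabet (n - 1) i"
    proof
      fix l assume "l \<in> sigma_alphabet n (Suc i)"
      moreover obtain k b where "l = (k, b)" by (cases l)
      ultimately have "l = (\<lambda>(k, b). (k + 1, b)) (k - 1, b)" "(k - 1, b) \<in> sigma_alphabet (n - 1) i"
        by (auto simp: sigma_alphabet_def)
      then show "l \<in> (\<lambda>(k, b). (k + 1, b)) ` sigma_alphabet (n - 1) i" by blast
    qed
  qed (auto simp: sigma_alphabet_def)
  then show ?thesis by (simp add: lists_image)
qed

lemma shift_positive:
  assumes "i \<in> {1..<n - 1}"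
  shows "braid_shift n ` {g. sigma_i_positive (n - 1) i g} = {g. sigma_i_positive n (Suc i) g}"
proof -
  interpret G: braids "braid_group n" n by (rule braids_braid_group)
  interpret H: braids "braid_group (n - 1)" "n - 1" by (rule braids_braid_group)
  have mem: "(Suc i, True) \<in> set (shift_word w) \<longleftrightarrow> (i, True) \<in> set w" for w :: "nat gword"
    by force
  have "braid_shift n ` H.positive i
      = (\<lambda>w. G.cls (shift_word w)) ` {w \<in> lists (sigma_alphabet (n - 1) i). (i, True) \<in> set w}"
    unfolding H.positive_eq image_image
    using H.sigma_words[OF assms] by (intro image_cong HOL.refl braid_shift_class) auto
  also have "\<dots> = G.positive (Suc i)"
    unfolding G.positive_eq shift_sigma_words[of n i] using mem by (auto simp: image_iff)
  finally show ?thesis unfolding H.positive_def G.positive_def .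
qed

declare One_nat_def [simp del]

lemma braid_shift_mult:
  assumes "x \<in> carrier (braid_group (n - 1))" "y \<in> carrier (braid_group (n - 1))"
  shows "braid_shift n (x \<otimes>\<^bsub>braid_group (n - 1)\<^esub> y)
       = braid_shift n x \<otimes>\<^bsub>braid_group n\<^esub> braid_shift n y"
proof -
  interpret G: braids "braid_group n" n by (rule braids_braid_group)
  interpret H: braids "braid_group (n - 1)" "n - 1" by (rule braids_braid_group)
  obtain u where u: "u \<in> lists ({1..<n - 1} \<times> UNIV)" "x = H.cls u"
    using assms(1) unfolding H.carrier_eq by blast
  obtain v where v: "v \<in> lists ({1..<n - 1} \<times> UNIV)" "y = H.cls v"
    using assms(2) unfolding H.carrier_eq by blast
  have uv: "u @ v \<in> lists ({1..<n - 1} \<times> UNIV)" using u v by auto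
  show ?thesis
    unfolding u(2) v(2) H.cls_append[OF u(1) v(1), symmetric]
      braid_shift_class[OF u(1)] braid_shift_class[OF v(1)] braid_shift_class[OF uv]
      map_append
    by (rule G.cls_append[OF shift_word_lists[OF u(1)] shift_word_lists[OF v(1)]])
qed

lemma braid_shift_in_neutral:
  assumes "x \<in> carrier (braid_group (n - 1))"
  shows "braid_shift n x \<in> braids.neutral n 1"
proof -
  interpret G: braids "braid_group n" n by (rule braids_braid_group)
  interpret H: braids "braid_group (n - 1)" "n - 1" by (rule braids_braid_group)
  obtain u where u: "u \<in> lists ({1..<n - 1} \<times> UNIV)" "x = H.cls u"
    using assms(1) unfolding H.carrier_eq by blast
  have "shift_word u \<in> lists ({1 + 1..<n} \<times> UNIV)"
    using u(1) by (induction rule: lists.induct) auto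
  then show ?thesis unfolding u(2) braid_shift_class[OF u(1)] G.neutral_def by blast
qed

text \<open>Each recursion step reverses all signs and raises all indices by one, so the signs
  alternate, starting with plus at level 1.\<close>

lemma dubrovina_eq:
  "dubrovina_ordering n = ordering_of_cone (braid_group n) (braids.signed_cone (braid_group n) n odd)"
proof (induction n rule: less_induct)
  case (less n)
  interpret G: braids "braid_group n" n by (rule braids_braid_group)
  show ?case
  proof (cases "n \<le> 2")
    case True
    have "(if odd i then g else inv\<^bsub>braid_group n\<^esub> g) = (if True then g else inv\<^bsub>braid_group n\<^esub> g)"
      if "i \<in> {1..<n}" for i g
    proof -
      have "i = 1" using that True by auto
      then show ?thesis by simp
    qed
    then have "G.signed_cone odd = G.signed_cone (\<lambda>_. True)"
      unfolding G.signed_cone_def by (metis (mono_tags, lifting))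
    then show ?thesis
      using True by (subst dubrovina_ordering.simps) (simp add: G.dehornoy_eq)
  next
    case False
    then have n: "n \<ge> 3" by simp
    interpret H: braids "braid_group (n - 1)" "n - 1" by (rule braids_braid_group)
    let ?sh = "braid_shift n"
    let ?S = "map_prod ?sh ?sh ` ((dubrovina_ordering (n - 1))\<inverse>)"
    interpret sh: group_hom "braid_group (n - 1)" "braid_group n" ?sh
    proof (unfold group_hom_def group_hom_axioms_def, intro conjI)
      show "?sh \<in> hom (braid_group (n - 1)) (braid_group n)"
        by (rule homI) (use braid_shift_in_neutral G.neutral_closed braid_shift_mult in blast)+
    qed (rule group_braid_group)+
    have positive_shift: "?sh ` H.positive i = G.positive (Suc i)" if "i \<in> {1..<n - 1}" for i
      using shift_positive[OF that] unfolding G.positive_def H.positive_def .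
    have IH: "dubrovina_ordering (n - 1) = ordering_of_cone (braid_group (n - 1)) (H.signed_cone odd)"
      using less.IH[of "n - 1"] n by simp
    have K1: "shifted_subgroup n = G.neutral 1" using G.shifted_subgroup_eq n by simp
    have one: "(g \<in> G.signed_cone (\<lambda>_. True) \<and> g \<notin> G.neutral 1) \<longleftrightarrow> g \<in> G.positive 1" for g
    proof
      assume g: "g \<in> G.signed_cone (\<lambda>_. True) \<and> g \<notin> G.neutral 1"
      then obtain i where "i \<in> {1..<n}" "g \<in> G.positive i" unfolding G.signed_cone_def by auto
      then show "g \<in> G.positive 1" using g G.positive_subset_neutral[of 1 i] by (cases "i = 1") auto
    next
      assume "g \<in> G.positive 1"
      then show "g \<in> G.signed_cone (\<lambda>_. True) \<and> g \<notin> G.neutral 1"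
        using G.positive_neutral_disjoint[of 1 g] G.positive_closed[of g 1] n unfolding G.signed_cone_def by auto
    qed
    have two: "g \<in> positive_cone (braid_group n\<lparr>carrier := G.neutral 1\<rparr>) ?S \<longleftrightarrow>
      g \<in> carrier (braid_group n) \<and>
      (\<exists>i\<in>{2..<n}. (if odd i then g else inv\<^bsub>braid_group n\<^esub> g) \<in> G.positive i)" for g
    proof
      assume "g \<in> positive_cone (braid_group n\<lparr>carrier := G.neutral 1\<rparr>) ?S"
      then have g: "g \<in> G.neutral 1" "g \<noteq> \<one>\<^bsub>braid_group n\<^esub>"
        and S: "(\<one>\<^bsub>braid_group n\<^esub>, g) \<in> ?S"
        by (auto simp: positive_cone_def)
      from S obtain a b where ab: "(b, a) \<in> dubrovina_ordering (n - 1)"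
        and a: "?sh a = \<one>\<^bsub>braid_group n\<^esub>" and b: "?sh b = g" by auto
      have ne: "b \<noteq> a" using a b g by auto
      have gc: "g \<in> carrier (braid_group n)" using g G.neutral_closed by blast
      have abc: "a \<in> carrier (braid_group (n - 1))" "b \<in> carrier (braid_group (n - 1))"
        using ab unfolding IH ordering_of_cone_def by auto
      \<comment> \<open>The reversed pair is \<open>(b, a)\<close>, where \<open>a\<close> is only
        known to map to the identity. The quotient \<open>d\<close> therefore stands in for the
        inverse of \<open>b\<close>; it maps to the inverse of \<open>g\<close>.\<close>
      define d where "d = inv\<^bsub>braid_group (n - 1)\<^esub> b \<otimes>\<^bsub>braid_group (n - 1)\<^esub> a"
      have dc: "d \<in> carrier (braid_group (n - 1))" unfolding d_def using abc by simp
      have d: "d \<in> H.signed_cone odd" unfolding d_def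
        using ab ne unfolding IH ordering_of_cone_def by auto
      have shd: "?sh d = inv\<^bsub>braid_group n\<^esub> g" unfolding d_def using abc a b gc by simp
      obtain i where i: "i \<in> {1..<n - 1}" and di: "(if odd i then d else inv\<^bsub>braid_group (n - 1)\<^esub> d) \<in> H.positive i"
        using d unfolding H.signed_cone_def by blast
      have "?sh (if odd i then d else inv\<^bsub>braid_group (n - 1)\<^esub> d) \<in> G.positive (Suc i)"
        using di positive_shift[OF i] by blast
      then have "(if odd (Suc i) then g else inv\<^bsub>braid_group n\<^esub> g) \<in> G.positive (Suc i)"
        using shd dc gc by (auto split: if_splits)
      moreover have "Suc i \<in> {2..<n}" using i by auto
      ultimately show "g \<in> carrier (braid_group n) \<and>
          (\<exists>i\<in>{2..<n}. (if odd i then g else inv\<^bsub>braid_group n\<^esub> g) \<in> G.positive i)"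
        using gc by blast
    next
      assume "g \<in> carrier (braid_group n) \<and>
          (\<exists>i\<in>{2..<n}. (if odd i then g else inv\<^bsub>braid_group n\<^esub> g) \<in> G.positive i)"
      then obtain i where gc: "g \<in> carrier (braid_group n)" and i: "i \<in> {2..<n}"
        and gi: "(if odd i then g else inv\<^bsub>braid_group n\<^esub> g) \<in> G.positive i" by blast
      obtain j where j: "i = Suc j" "j \<in> {1..<n - 1}" using i by (cases i) auto
      obtain e where e: "e \<in> H.positive j" "(if odd i then g else inv\<^bsub>braid_group n\<^esub> g) = ?sh e"
        using gi positive_shift[OF j(2)] j(1) by blast
      have ec: "e \<in> carrier (braid_group (n - 1))" using H.positive_closed e j by blast
      \<comment> \<open>A preimage of \<open>g\<close> itself, whereas \<open>e\<close> is a
        preimage of \<open>g\<close> or of its inverse according to the sign at level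
        \<open>i\<close>.\<close>
      define b where "b = (if odd i then e else inv\<^bsub>braid_group (n - 1)\<^esub> e)"
      have bc: "b \<in> carrier (braid_group (n - 1))" using ec by (simp add: b_def)
      have shb: "?sh b = g"
      proof (cases "odd i")
        case False
        then have "inv\<^bsub>braid_group n\<^esub> (inv\<^bsub>braid_group n\<^esub> g) = inv\<^bsub>braid_group n\<^esub> (?sh e)"
          using e(2) by simp
        then show ?thesis using False ec gc by (simp add: b_def)
      qed (use e(2) in \<open>simp add: b_def\<close>)
      have "(if odd j then inv\<^bsub>braid_group (n - 1)\<^esub> b else inv\<^bsub>braid_group (n - 1)\<^esub> (inv\<^bsub>braid_group (n - 1)\<^esub> b)) = e"
        unfolding b_def j(1) using ec by auto
      then have "inv\<^bsub>braid_group (n - 1)\<^esub> b \<in> H.signed_cone odd"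
        unfolding H.signed_cone_def using e j bc by (auto intro!: bexI[of _ j])
      then have "(b, \<one>\<^bsub>braid_group (n - 1)\<^esub>) \<in> dubrovina_ordering (n - 1)"
        unfolding IH ordering_of_cone_def using bc by auto
      then have "(\<one>\<^bsub>braid_group n\<^esub>, g) \<in> ?S"
        using shb sh.hom_one by force
      moreover have "g \<in> G.neutral 1" using braid_shift_in_neutral[OF bc] shb by simp
      moreover have "g \<noteq> \<one>\<^bsub>braid_group n\<^esub>"
        using gi G.one_notin_positive[of i] by (auto split: if_splits)
      ultimately show "g \<in> positive_cone (braid_group n\<lparr>carrier := G.neutral 1\<rparr>) ?S"
        by (auto simp: positive_cone_def)
    qed
    have "(positive_cone (braid_group n) (dehornoy_ordering n) - G.neutral 1)
        \<union> positive_cone (braid_group n\<lparr>carrier := G.neutral 1\<rparr>) ?S = G.signed_cone odd" (is "?L = _")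
    proof (rule Set.set_eqI)
      fix g
      have "g \<in> ?L \<longleftrightarrow> g \<in> G.positive 1 \<or> g \<in> carrier (braid_group n) \<and>
          (\<exists>i\<in>{2..<n}. (if odd i then g else inv\<^bsub>braid_group n\<^esub> g) \<in> G.positive i)"
        using one[of g] two[of g]
        by (simp add: G.dehornoy_eq G.positive_cone_of_cone[OF G.is_cone_signed_cone])
      also have "\<dots> \<longleftrightarrow> g \<in> carrier (braid_group n) \<and>
          (\<exists>i\<in>insert 1 {2..<n}. (if odd i then g else inv\<^bsub>braid_group n\<^esub> g) \<in> G.positive i)"
        using G.positive_closed[of g 1] n by auto
      also have "insert 1 {2..<n} = {1..<n}" using n by auto
      finally show "g \<in> ?L \<longleftrightarrow> g \<in> G.signed_cone odd" by (simp add: G.signed_cone_def)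
    qed
    then show ?thesis
      using False by (subst dubrovina_ordering.simps) (simp add: extension_ordering_def K1)
  qed
qed

section \<open>Conjugating finite sets into the outermost cone\<close>

context braids
begin

text \<open>The generators of \<open>neutral (Suc j)\<close> have index at least
  \<open>j + 2\<close>.\<close>

lemma sigma_commute_neutral: "g \<in> neutral (Suc j) \<Longrightarrow> j \<in> {1..<n} \<Longrightarrow> \<sigma> j \<otimes> g = g \<otimes> \<sigma> j"
proof (induction rule: neutral_induct)
  case (gen k g)
  have k: "k \<in> {1..<n}" and g: "g \<in> carrier G" using gen neutral_closed by auto
  have "emb (gen j * gen k) = emb (gen k * gen j)"
    using gen.hyps(1) by (subst far_commute) (auto simp: far_def)
  then have "\<sigma> j \<otimes> \<sigma> k = \<sigma> k \<otimes> \<sigma> j" using gen k by (simp add: emb_mult emb_gen)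
  then have "\<sigma> j \<otimes> (\<sigma> k \<otimes> g) = \<sigma> k \<otimes> (\<sigma> j \<otimes> g)"
    using k g gen.prems by (simp add: m_assoc[symmetric])
  then show ?case using gen k g by (simp add: m_assoc)
next
  case (inv_gen k g)
  have k: "k \<in> {1..<n}" and g: "g \<in> carrier G" using inv_gen neutral_closed by auto
  have "emb (gen j * gen k) = emb (gen k * gen j)"
    using inv_gen.hyps(1) by (subst far_commute) (auto simp: far_def)
  then have "\<sigma> j \<otimes> \<sigma> k = \<sigma> k \<otimes> \<sigma> j" using inv_gen k by (simp add: emb_mult emb_gen)
  then have "\<sigma> j \<otimes> inv (\<sigma> k) = inv (\<sigma> k) \<otimes> \<sigma> j"
    using commute_inv[of "\<sigma> k" "\<sigma> j"] inv_gen k by simp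
  then have "\<sigma> j \<otimes> (inv (\<sigma> k) \<otimes> g) = inv (\<sigma> k) \<otimes> (\<sigma> j \<otimes> g)"
    using k g inv_gen.prems by (simp add: m_assoc[symmetric])
  then show ?case using inv_gen k g by (simp add: m_assoc)
qed simp

lemma inv_sigma_commute_neutral: "g \<in> neutral (Suc j) \<Longrightarrow> j \<in> {1..<n} \<Longrightarrow> inv (\<sigma> j) \<otimes> g = g \<otimes> inv (\<sigma> j)"
  by (rule commute_inv[OF sigma_closed neutral_closed sigma_commute_neutral])

text \<open>The braid relation in the form that shows a single, positive \<open>\<sigma> j\<close>
  in the conjugate of \<open>\<sigma> (Suc j)\<close>.\<close>

lemma sigma_conj_sigma:
  assumes "j \<in> {1..<n}" "Suc j < n"
  shows "inv (\<sigma> j) \<otimes> (\<sigma> (Suc j) \<otimes> \<sigma> j) = \<sigma> (Suc j) \<otimes> (\<sigma> j \<otimes> inv (\<sigma> (Suc j)))"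
proof -
  have j: "Suc j \<in> {1..<n}" using assms by auto
  have "emb (gen j * (gen (Suc j) * gen j)) = emb (gen (Suc j) * (gen j * gen (Suc j)))"
    by (subst near_braid) (auto simp: near_def)
  then have "\<sigma> j \<otimes> (\<sigma> (Suc j) \<otimes> \<sigma> j) = \<sigma> (Suc j) \<otimes> (\<sigma> j \<otimes> \<sigma> (Suc j))"
    using assms(1) j by (simp add: emb_mult emb_gen)
  note eq = this
  have c: "\<sigma> j \<in> carrier G" "\<sigma> (Suc j) \<in> carrier G" using assms(1) j by auto
  have "\<sigma> (Suc j) \<otimes> \<sigma> j = \<sigma> (Suc j) \<otimes> (\<sigma> j \<otimes> \<sigma> (Suc j)) \<otimes> inv (\<sigma> (Suc j))"
    using c by (simp add: m_assoc)
  also have "\<dots> = \<sigma> j \<otimes> (\<sigma> (Suc j) \<otimes> (\<sigma> j \<otimes> inv (\<sigma> (Suc j))))"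
    unfolding eq[symmetric] using c by (simp add: m_assoc)
  finally show ?thesis using c by (simp add: m_assoc[symmetric])
qed

text \<open>Conjugation is multiplicative, so one factor
  \<open>k \<otimes> \<sigma> (Suc j) \<otimes> l\<close> suffices; \<open>k\<close> and
  \<open>l\<close> commute with \<open>\<sigma> j\<close>, and \<open>sigma_conj_sigma\<close>
  treats the middle.\<close>

lemma conj_sigma_positive:
  assumes "g \<in> positive (Suc j)" and j: "j \<in> {1..<n}" "Suc j < n"
  shows "inv (\<sigma> j) \<otimes> g \<otimes> \<sigma> j \<in> positive j"
proof -
  have Sj: "Suc j \<in> {1..<n}" using j by auto
  show ?thesis using assms(1) Sj
  proof (induction rule: positive_induct)
    case (base k l)
    have c: "k \<in> carrier G" "l \<in> carrier G" "\<sigma> j \<in> carrier G" "\<sigma> (Suc j) \<in> carrier G"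
      using base neutral_closed j Sj by auto
    have "inv (\<sigma> j) \<otimes> (k \<otimes> \<sigma> (Suc j) \<otimes> l) \<otimes> \<sigma> j
        = (inv (\<sigma> j) \<otimes> k) \<otimes> \<sigma> (Suc j) \<otimes> (l \<otimes> \<sigma> j)"
      using c by (simp add: m_assoc)
    also have "\<dots> = (k \<otimes> inv (\<sigma> j)) \<otimes> \<sigma> (Suc j) \<otimes> (\<sigma> j \<otimes> l)"
      using sigma_commute_neutral[OF base(2) j(1)] inv_sigma_commute_neutral[OF base(1) j(1)] by simp
    also have "\<dots> = k \<otimes> (inv (\<sigma> j) \<otimes> (\<sigma> (Suc j) \<otimes> \<sigma> j)) \<otimes> l"
      using c by (simp add: m_assoc)
    also have "\<dots> = (k \<otimes> \<sigma> (Suc j)) \<otimes> \<sigma> j \<otimes> (inv (\<sigma> (Suc j)) \<otimes> l)"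
      unfolding sigma_conj_sigma[OF j] using c by (simp add: m_assoc)
    also have "\<dots> \<in> positive j"
    proof -
      have kl: "k \<in> neutral j" "l \<in> neutral j" using base neutral_mono[of j "Suc j"] by auto
      have "k \<otimes> \<sigma> (Suc j) \<in> neutral j" using kl j by (intro neutral_mult sigma_in_neutral) auto
      moreover have "inv (\<sigma> (Suc j)) \<otimes> l \<in> neutral j" using kl j by (intro neutral_mult inv_sigma_in_neutral) auto
      ultimately show ?thesis
        using positive_neutral_mult[OF j(1) neutral_positive_mult[OF j(1) sigma_in_positive[OF j(1)]]] by blast
    qed
    finally show ?case .
  next
    case (mult g h)
    have "g \<in> carrier G" "h \<in> carrier G" using mult positive_closed Sj by blast+
    then have "inv (\<sigma> j) \<otimes> (g \<otimes> h) \<otimes> \<sigma> j = (inv (\<sigma> j) \<otimes> g \<otimes> \<sigma> j) \<otimes> (inv (\<sigma> j) \<otimes> h \<otimes> \<sigma> j)"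
      using conj_mult[of "inv (\<sigma> j)" g h] j by simp
    then show ?case using mult positive_mult j by simp
  qed
qed

text \<open>Isolates the first \<open>\<sigma> i\<close>, so that the neutral prefix
  \<open>w\<close> can later be absorbed by twists.\<close>

lemma positive_decomposition:
  assumes "g \<in> positive i" and i: "i \<in> {1..<n}"
  shows "\<exists>w\<in>neutral i. \<exists>v\<in>positive i \<union> neutral i. g = w \<otimes> \<sigma> i \<otimes> v"
  using assms
proof (induction rule: positive_induct)
  case (mult g h)
  then obtain w v where w: "w \<in> neutral i" and v: "v \<in> positive i \<union> neutral i" and g: "g = w \<otimes> \<sigma> i \<otimes> v" by blast
  have "v \<otimes> h \<in> positive i" using positive_mult_left(2)[OF i mult(2) v] .
  moreover have "g \<otimes> h = w \<otimes> \<sigma> i \<otimes> (v \<otimes> h)"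
    unfolding g using w v i neutral_closed positive_closed[OF _ i] mult(2) by (auto simp: m_assoc)
  ultimately show ?case using w by blast
qed blast

lemma full_twist_in_positive: "Suc j < n \<Longrightarrow> full_twist j \<in> positive (Suc j)"
proof -
  assume j: "Suc j < n"
  obtain r where r: "twist (Suc j) n = gen (Suc j) * r" using gen_ldvd_twist[of "Suc j" "Suc j" n] j by auto
  have rs: "supp r \<subseteq> {Suc j..<n}" using supp_twist[of "Suc j" n] r by auto
  then have "full_twist j = \<sigma> (Suc j) \<otimes> emb r"
    unfolding full_twist_def r using j by (subst emb_mult) (auto simp: emb_gen)
  then show ?thesis
    using positive_mult_left(1)[OF _ sigma_in_positive emb_nonneg[OF _ rs]] j by simp
qed

text \<open>Some power of the twist turns \<open>w\<close> into a positive braid, one more twist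
  makes it strictly positive at level \<open>Suc j\<close>, and further twists keep it so.\<close>

lemma full_twist_power_mult_in_positive:
  assumes "w \<in> neutral j" "Suc j < n"
  shows "\<exists>k0. \<forall>k\<ge>k0. full_twist j [^] (k::nat) \<otimes> w \<in> positive (Suc j)"
proof -
  have i: "Suc j \<in> {1..<n}" using assms by auto
  obtain k x where x: "supp x \<subseteq> {Suc j..<n}" "full_twist j [^] (k::nat) \<otimes> w = emb x"
    using twist_fraction[OF assms(1)] by blast
  have w: "w \<in> carrier G" using assms neutral_closed by blast
  have "full_twist j [^] (Suc k + l) \<otimes> w \<in> positive (Suc j)" for l
  proof (induction l)
    case 0
    have "full_twist j [^] Suc k \<otimes> w = full_twist j \<otimes> emb x"
      unfolding nat_pow_Suc2[OF full_twist_closed] using w by (simp add: m_assoc x(2)[symmetric])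
    then show ?case
      using positive_mult_left(1)[OF i full_twist_in_positive[OF assms(2)] emb_nonneg[OF i x(1)]] by simp
  next
    case (Suc l)
    have "full_twist j [^] (Suc k + Suc l) \<otimes> w = full_twist j \<otimes> (full_twist j [^] (Suc k + l) \<otimes> w)"
      unfolding add_Suc_right nat_pow_Suc2[OF full_twist_closed] using w by (simp add: m_assoc)
    then show ?case using positive_mult[OF i full_twist_in_positive[OF assms(2)] Suc] by simp
  qed
  then show ?thesis by (intro exI[of _ "Suc k"]) (metis le_add_diff_inverse)
qed

lemma conj_step_positive:
  assumes "g \<in> positive i" "1 \<le> i" "i \<le> Suc j" and j: "1 \<le> j" "Suc j < n"
  shows "\<exists>k0. \<forall>k\<ge>k0. \<exists>i'\<in>{1..j}.
    inv (inv (full_twist j [^] (k::nat)) \<otimes> \<sigma> j) \<otimes> g \<otimes> (inv (full_twist j [^] k) \<otimes> \<sigma> j) \<in> positive i'"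
proof -
  have i: "i \<in> {1..<n}" and jn: "j \<in> {1..<n}" using assms by auto
  have g: "g \<in> carrier G" using assms positive_closed[OF _ i] by blast
  have ck: "full_twist j [^] (k::nat) \<in> neutral j" for k
  proof -
    have "supp (twist (Suc j) n ^ k) \<subseteq> {j + 1..<n}" using supp_twist[of "Suc j" n] by auto
    then show ?thesis using emb_neutral[of "twist (Suc j) n ^ k" j] emb_twist_power[of j k] by simp
  qed
  let ?h = "\<lambda>k::nat. inv (full_twist j [^] k) \<otimes> \<sigma> j"
  have hc: "?h k \<in> carrier G" for k using jn by simp
  have invh: "inv (?h k) = inv (\<sigma> j) \<otimes> full_twist j [^] k" for k
    using jn by (simp add: inv_mult_group)
  consider "i < j" | "i = j" | "i = Suc j" using assms by linarith
  then show ?thesis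
  proof cases
    case 1
    have "\<sigma> j \<in> neutral i" "full_twist j [^] (k::nat) \<in> neutral i" for k
      using ck neutral_mono[of i j] 1 j sigma_in_neutral[of j i] by auto
    then have h: "?h k \<in> neutral i" for k by (intro neutral_mult neutral_inv)
    have "inv (?h k) \<otimes> g \<otimes> ?h k \<in> positive i" for k
      by (rule positive_neutral_mult[OF i neutral_positive_mult[OF i assms(1) neutral_inv[OF h]] h])
    then show ?thesis using 1 assms by (auto intro!: bexI[of _ i])
  next
    case 2
    obtain w v where w: "w \<in> neutral j" and v: "v \<in> positive j \<union> neutral j" and gd: "g = w \<otimes> \<sigma> j \<otimes> v"
      using positive_decomposition[OF assms(1) i] 2 by blast
    obtain k0 where k0: "\<forall>k\<ge>k0. full_twist j [^] (k::nat) \<otimes> w \<in> positive (Suc j)"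
      using full_twist_power_mult_in_positive[OF w j(2)] by blast
    have wv: "w \<in> carrier G" "v \<in> carrier G" using w v neutral_closed positive_closed[OF _ jn] by auto
    \<comment> \<open>The twists make the prefix \<open>w\<close> positive at level
      \<open>Suc j\<close>, so its conjugate by \<open>\<sigma> j\<close> is positive at level
      \<open>j\<close>; the remaining factors \<open>v\<close> and \<open>?h k\<close> are at least
      nonnegative there.\<close>
    have "inv (?h k) \<otimes> g \<otimes> ?h k \<in> positive j" if "k \<ge> k0" for k
    proof -
      have "inv (\<sigma> j) \<otimes> (full_twist j [^] k \<otimes> w) \<otimes> \<sigma> j \<in> positive j"
        using conj_sigma_positive[OF _ jn j(2)] k0 that by blast
      moreover have "?h k \<in> positive j" using jn ck by (intro neutral_positive_mult neutral_inv sigma_in_positive)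
      then have "v \<otimes> ?h k \<in> positive j" by (rule positive_mult_left(2)[OF jn _ v])
      ultimately have "(inv (\<sigma> j) \<otimes> (full_twist j [^] k \<otimes> w) \<otimes> \<sigma> j) \<otimes> (v \<otimes> ?h k) \<in> positive j"
        by (rule positive_mult[OF jn])
      then show ?thesis unfolding invh gd using wv jn by (simp add: m_assoc)
    qed
    then show ?thesis using j by (auto intro!: exI[of _ k0] bexI[of _ j])
  next
    case 3
    have gK: "g \<in> neutral j" using positive_subset_neutral[of j "Suc j"] assms 3 by auto
    \<comment> \<open>At the top level the twists commute with \<open>g\<close> and cancel, and
      conjugation by \<open>\<sigma> j\<close> alone lowers the level.\<close>
    have "inv (?h k) \<otimes> g \<otimes> ?h k = inv (\<sigma> j) \<otimes> g \<otimes> \<sigma> j" for k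
    proof -
      have "inv (?h k) \<otimes> g \<otimes> ?h k = inv (\<sigma> j) \<otimes> ((full_twist j [^] k \<otimes> g) \<otimes> inv (full_twist j [^] k)) \<otimes> \<sigma> j"
        unfolding invh using g jn by (simp add: m_assoc)
      also have "(full_twist j [^] k \<otimes> g) \<otimes> inv (full_twist j [^] k) = g"
        unfolding full_twist_pow_commute[OF gK] using g by (simp add: m_assoc)
      finally show ?thesis .
    qed
    then show ?thesis
      using conj_sigma_positive[OF _ jn j(2)] assms(1) 3 j by (auto intro!: bexI[of _ j])
  qed
qed

text \<open>Each conjugation lowers the highest level that occurs by one, until only level 1 is
  left.\<close>

lemma conj_into_P1_aux:
  assumes "1 \<le> j" "j < n" "finite F" "F \<subseteq> (\<Union>i\<in>{1..j}. positive i)"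
  shows "\<exists>h\<in>carrier G. \<forall>g\<in>F. inv h \<otimes> g \<otimes> h \<in> positive 1"
  using assms
proof (induction j arbitrary: F rule: nat_induct_at_least)
  case base
  have "inv \<one> \<otimes> g \<otimes> \<one> \<in> positive 1" if "g \<in> F" for g
    using that base positive_closed[of g 1] by auto
  then show ?case by blast
next
  case (Suc j)
  have FP: "\<exists>i\<in>{1..Suc j}. g \<in> positive i" if "g \<in> F" for g using Suc.prems that by blast
  let ?h = "\<lambda>k::nat. inv (full_twist j [^] k) \<otimes> \<sigma> j"
  have "\<exists>k0. \<forall>k\<ge>k0. \<exists>i'\<in>{1..j}. inv (?h k) \<otimes> g \<otimes> ?h k \<in> positive i'" if "g \<in> F" for g
    using FP[OF that] conj_step_positive[of g _ j] Suc.hyps Suc.prems by auto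
  then have "\<forall>g\<in>F. eventually (\<lambda>k. \<exists>i'\<in>{1..j}. inv (?h k) \<otimes> g \<otimes> ?h k \<in> positive i') sequentially"
    unfolding eventually_sequentially by blast
  \<comment> \<open>Finiteness of \<open>F\<close> yields one exponent \<open>k\<close> for all its
    elements.\<close>
  then have "eventually (\<lambda>k. \<forall>g\<in>F. \<exists>i'\<in>{1..j}. inv (?h k) \<otimes> g \<otimes> ?h k \<in> positive i') sequentially"
    using Suc.prems(2) by (simp add: eventually_ball_finite)
  then obtain k where k: "\<forall>g\<in>F. \<exists>i'\<in>{1..j}. inv (?h k) \<otimes> g \<otimes> ?h k \<in> positive i'"
    unfolding eventually_sequentially by blast
  let ?F = "(\<lambda>g. inv (?h k) \<otimes> g \<otimes> ?h k) ` F"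
  have "?F \<subseteq> (\<Union>i\<in>{1..j}. positive i)" using k by blast
  then obtain h where h: "h \<in> carrier G" "\<forall>g\<in>?F. inv h \<otimes> g \<otimes> h \<in> positive 1"
    using Suc.IH[of ?F] Suc.prems by auto
  have hk: "?h k \<in> carrier G" using Suc by simp
  have "inv (?h k \<otimes> h) \<otimes> g \<otimes> (?h k \<otimes> h) \<in> positive 1" if "g \<in> F" for g
  proof -
    obtain i where "i \<in> {1..<n}" "g \<in> positive i" using FP[OF \<open>g \<in> F\<close>] Suc.prems by force
    then have "g \<in> carrier G" using positive_closed by blast
    then have "inv (?h k \<otimes> h) \<otimes> g \<otimes> (?h k \<otimes> h) = inv h \<otimes> (inv (?h k) \<otimes> g \<otimes> ?h k) \<otimes> h"
      using hk h(1) by (simp add: inv_mult_group[OF hk h(1)] m_assoc)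
    then show ?thesis using h(2) that by auto
  qed
  then show ?case using hk h(1) by blast
qed

lemma conj_into_P1:
  assumes "n \<ge> 2" "finite F" "F \<subseteq> signed_cone (\<lambda>_. True)"
  shows "\<exists>f\<in>carrier G. \<forall>g\<in>F. f \<otimes> g \<otimes> inv f \<in> positive 1"
proof -
  have "F \<subseteq> (\<Union>i\<in>{1..n - 1}. positive i)"
    using assms(3) unfolding signed_cone_def by fastforce
  moreover have "1 \<le> n - 1" "n - 1 < n" using assms(1) by auto
  ultimately obtain h where "h \<in> carrier G" "\<forall>g\<in>F. inv h \<otimes> g \<otimes> h \<in> positive 1"
    using conj_into_P1_aux[of "n - 1" F] assms(2) by blast
  then show ?thesis by (intro bexI[of _ "inv h"]) auto
qed

text \<open>A conjugation preserving the cone would fix its least element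
  \<open>\<sigma> (n - 1)\<close>, but the image of this element is positive at level 1, where
  \<open>\<sigma> (n - 1)\<close> is neutral.\<close>

lemma conj_cone_neq:
  assumes n: "n \<ge> 3" and f: "f \<in> carrier G" and p: "f \<otimes> \<sigma> (n - 1) \<otimes> inv f \<in> positive 1"
  shows "conj_cone (signed_cone (\<lambda>_. True)) f \<noteq> signed_cone (\<lambda>_. True)"
proof
  let ?D = "signed_cone (\<lambda>_. True)" and ?t = "\<sigma> (n - 1)"
  assume eq: "conj_cone ?D f = ?D"
  have t: "?t \<in> carrier G" and n1: "n - 1 \<in> {1..<n}" and one: "1 \<in> {1..<n}" using n by auto
  \<comment> \<open>At level \<open>n - 1\<close> the neutral subgroup is trivial, so
    \<open>x\<close> starts with \<open>?t\<close>; at lower levels \<open>inv ?t\<close> is neutral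
    and is absorbed.\<close>
  have least: "x = ?t \<or> inv ?t \<otimes> x \<in> ?D" if x: "x \<in> ?D" for x
  proof -
    obtain i where i: "i \<in> {1..<n}" "x \<in> positive i" using x unfolding signed_cone_def by auto
    show ?thesis
    proof (cases "i = n - 1")
      case True
      have "lists ({n - 1 + 1..<n} \<times> (UNIV :: bool set)) = {[]}" using n by simp
      then have "neutral (n - 1) = {\<one>}" by (simp add: neutral_def cls_Nil)
      then have K1: "neutral i = {\<one>}" using True by simp
      obtain w v where w: "w \<in> neutral i" and v: "v \<in> positive i \<union> neutral i" "x = w \<otimes> \<sigma> i \<otimes> v"
        using positive_decomposition[OF i(2,1)] by blast
      then have v: "v \<in> positive i \<union> {\<one>}" "x = ?t \<otimes> v"
        using K1 True t by auto
      then have vc: "v \<in> carrier G" using positive_closed[OF _ i(1)] by auto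
      then have "inv ?t \<otimes> x = v" using t v by (simp add: m_assoc[symmetric])
      then show ?thesis using v t vc i unfolding signed_cone_def by auto
    next
      case False
      then have "inv ?t \<in> neutral i" using i by (intro inv_sigma_in_neutral) auto
      then have "inv ?t \<otimes> x \<in> positive i" using i by (intro neutral_positive_mult)
      then show ?thesis using i positive_closed unfolding signed_cone_def by auto
    qed
  qed
  let ?p = "f \<otimes> ?t \<otimes> inv f" and ?x = "inv f \<otimes> ?t \<otimes> f"
  have fx: "f \<otimes> ?x \<otimes> inv f = ?t"
  proof -
    have "f \<otimes> ?x \<otimes> inv f = (f \<otimes> inv f) \<otimes> ?t \<otimes> (f \<otimes> inv f)"
      using f t by (simp only: m_assoc m_closed inv_closed)
    then show ?thesis using f t by simp
  qed
  have "?t \<in> ?D" using sigma_in_positive[OF n1] t n1 unfolding signed_cone_def by auto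
  then have "?x \<in> conj_cone ?D f" using f t fx unfolding conj_cone_def by simp
  then have "?x \<in> ?D" using eq by simp
  then have "?x = ?t \<or> inv ?t \<otimes> ?x \<in> conj_cone ?D f" using least eq by simp
  moreover have "f \<otimes> (inv ?t \<otimes> ?x) \<otimes> inv f = inv ?p \<otimes> ?t"
    using conj_mult[OF f, of "inv ?t" ?x] conj_inv[OF f t] f t fx by simp
  ultimately have d: "?x = ?t \<or> inv ?p \<otimes> ?t \<in> ?D" by (auto simp: conj_cone_def)
  \<comment> \<open>Here \<open>n \<ge> 3\<close> enters: the index \<open>n - 1\<close> exceeds
    1.\<close>
  have "?t \<in> neutral 1" using n by (intro sigma_in_neutral) auto
  then have q: "inv ?t \<otimes> ?p \<in> positive 1" by (rule neutral_positive_mult[OF one p neutral_inv])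
  have qc: "inv ?t \<otimes> ?p \<in> carrier G" using f t by simp
  have "inv ?t \<otimes> ?p \<in> ?D" using q qc one unfolding signed_cone_def by auto
  moreover have "inv (inv ?t \<otimes> ?p) = inv ?p \<otimes> ?t" using f t by (simp add: inv_mult_group)
  ultimately have "inv ?p \<otimes> ?t \<notin> ?D"
    using cone_inv[OF is_cone_signed_cone] by metis
  then have "?x = ?t" using d by simp
  then have "?p = ?t" using fx by simp
  then have "\<one> \<in> positive 1" using q t by simp
  then show False using one_notin_positive by simp
qed

section \<open>Infinite generation and limits of conjugates\<close>

lemma not_finitely_generated:
  assumes n: "n \<ge> 3"
  shows "\<not> finitely_generated_semigroup G (signed_cone (\<lambda>_. True))"
proof
  let ?D = "signed_cone (\<lambda>_. True)"
  assume "finitely_generated_semigroup G ?D"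
  then obtain A where A: "finite A" "semigroup_generated G A = ?D"
    unfolding finitely_generated_semigroup_def by blast
  have n1: "n - 1 \<in> {1..<n}" using n by auto
  have t: "\<sigma> (n - 1) \<in> ?D"
    using n1 sigma_in_positive[OF n1] sigma_closed[OF n1] unfolding signed_cone_def by (auto intro: bexI[of _ "n - 1"])
  have AD: "A \<subseteq> ?D"
    unfolding A(2)[symmetric] by (rule subsetI) (rule semigroup_generated.incl)
  \<comment> \<open>\<open>\<sigma> (n - 1)\<close> is added to the generators so that
    \<open>conj_cone_neq\<close> applies to \<open>f\<close>.\<close>
  obtain f where f: "f \<in> carrier G" "\<forall>g\<in>insert (\<sigma> (n - 1)) A. f \<otimes> g \<otimes> inv f \<in> positive 1"
    using conj_into_P1[of "insert (\<sigma> (n - 1)) A"] n A(1) AD t by auto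
  have P1: "positive 1 \<subseteq> ?D" using n positive_closed[of _ 1] unfolding signed_cone_def by force
  have cone: "is_cone (conj_cone ?D f)" using is_cone_conj[OF is_cone_signed_cone f(1)] .
  have "x \<in> conj_cone ?D f" if "x \<in> semigroup_generated G A" for x
    using that
  proof induction
    case (incl a)
    then show ?case using f P1 AD unfolding conj_cone_def by (auto simp: signed_cone_def)
  next
    case (mult a b)
    then show ?case using cone unfolding is_cone_def by blast
  qed
  \<comment> \<open>The conjugate cone contains the generators, hence all of \<open>?D\<close>, and
    inclusion between cones is equality.\<close>
  then have "?D = conj_cone ?D f"
    using cone_subset_eq[OF is_cone_signed_cone cone] A(2) by blast
  then show False using conj_cone_neq[OF n f(1)] f(2) by auto
qed

text \<open>The conjugators push more and more of Dehornoy's cone into \<open>positive 1\<close>,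
  which lies in every signed cone with plus at level 1. So one sequence serves all such
  \<open>\<epsilon>\<close>.\<close>

lemma conjugates_converge:
  assumes n: "n \<ge> 3"
  shows "\<exists>f :: nat \<Rightarrow> nat gword set. (\<forall>k. f k \<in> carrier G \<and> f k \<otimes> \<sigma> (n - 1) \<otimes> inv (f k) \<in> positive 1) \<and>
    (\<forall>\<epsilon>. \<epsilon> 1 \<longrightarrow> limitin (ordering_topology G)
       (\<lambda>k. conjugate_ordering G (ordering_of_cone G (signed_cone \<epsilon>)) (f k))
       (ordering_of_cone G (signed_cone (\<lambda>_. True))) sequentially)"
proof -
  let ?D = "signed_cone (\<lambda>_. True)"
  have n1: "n - 1 \<in> {1..<n}" using n by auto
  have t: "\<sigma> (n - 1) \<in> ?D"
    using n1 sigma_in_positive[OF n1] sigma_closed[OF n1] unfolding signed_cone_def by auto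
  have "countable (lists ({1..<n} \<times> (UNIV :: bool set)))" by simp
  then have "countable ?D" unfolding signed_cone_def carrier_eq
    by (rule countable_subset[rotated, OF countable_image]) blast
  then obtain e :: "nat \<Rightarrow> nat gword set" where e: "range e = ?D"
    using t uncountable_def by (metis empty_iff)
  \<comment> \<open>\<open>f k\<close> treats the first \<open>k + 1\<close> members of an
    enumeration of the cone, and \<open>\<sigma> (n - 1)\<close> to keep the conjugate of Dehornoy's
    ordering different from it.\<close>
  have "\<exists>f\<in>carrier G. \<forall>g\<in>insert (\<sigma> (n - 1)) (e ` {..k}). f \<otimes> g \<otimes> inv f \<in> positive 1" for k
    using conj_into_P1[of "insert (\<sigma> (n - 1)) (e ` {..k})"] n e t by auto
  then obtain f where f: "\<And>k. f k \<in> carrier G"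
    "\<And>k g. g \<in> insert (\<sigma> (n - 1)) (e ` {..k}) \<Longrightarrow> f k \<otimes> g \<otimes> inv (f k) \<in> positive 1"
    by metis
  have "limitin (ordering_topology G)
       (\<lambda>k. conjugate_ordering G (ordering_of_cone G (signed_cone \<epsilon>)) (f k))
       (ordering_of_cone G ?D) sequentially" if \<epsilon>: "\<epsilon> 1" for \<epsilon>
  proof (rule limitin_orderings)
    show "ordering_of_cone G ?D \<in> left_orderings G"
      by (rule cone_left_ordering[OF is_cone_signed_cone])
    show "conjugate_ordering G (ordering_of_cone G (signed_cone \<epsilon>)) (f k) \<in> left_orderings G" for k
      unfolding conjugate_ordering_of_cone[OF is_cone_signed_cone f(1)]
      by (rule cone_left_ordering[OF is_cone_conj[OF is_cone_signed_cone f(1)]])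
    fix x y assume xy: "(x, y) \<in> ordering_of_cone G ?D"
    then have c: "x \<in> carrier G" "y \<in> carrier G" by (auto simp: ordering_of_cone_def)
    show "eventually (\<lambda>k. (x, y) \<in> conjugate_ordering G (ordering_of_cone G (signed_cone \<epsilon>)) (f k)) sequentially"
    proof (cases "x = y")
      case True
      then show ?thesis
        unfolding conjugate_ordering_of_cone[OF is_cone_signed_cone f(1)]
        using c by (simp add: ordering_of_cone_def)
    next
      case False
      then have "inv x \<otimes> y \<in> range e" using xy e unfolding ordering_of_cone_def by simp
      then obtain m where m: "e m = inv x \<otimes> y" by (metis rangeE)
      have "(x, y) \<in> conjugate_ordering G (ordering_of_cone G (signed_cone \<epsilon>)) (f k)" if "m \<le> k" for k
      proof -
        have "f k \<otimes> (inv x \<otimes> y) \<otimes> inv (f k) \<in> positive 1" using f(2)[of "e m" k] that m by auto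
        then have "inv x \<otimes> y \<in> conj_cone (signed_cone \<epsilon>) (f k)"
          using c f(1)[of k] \<epsilon> n unfolding conj_cone_def signed_cone_def by (auto intro!: bexI[of _ 1])
        then show ?thesis
          unfolding conjugate_ordering_of_cone[OF is_cone_signed_cone f(1)]
          using c by (simp add: ordering_of_cone_def)
      qed
      then show ?thesis unfolding eventually_sequentially by blast
    qed
  qed
  then show ?thesis using f by blast
qed

end

theorem theoremD:
  fixes n :: nat
  assumes "n \<ge> 3"
  shows "dehornoy_ordering n \<in>
           ordering_topology (braid_group n) derived_set_of
             (conjugacy_orbit (braid_group n) (dehornoy_ordering n))
       \<and> \<not> finitely_generated_semigroup (braid_group n)
           (positive_cone (braid_group n) (dehornoy_ordering n))
       \<and> (\<exists>f :: nat \<Rightarrow> nat gword set.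
             (\<forall>k. f k \<in> carrier (braid_group n)) \<and>
             limitin (ordering_topology (braid_group n))
               (\<lambda>k. conjugate_ordering (braid_group n) (dubrovina_ordering n) (f k))
               (dehornoy_ordering n) sequentially)"
proof -
  interpret braids "braid_group n" n by (rule braids_braid_group)
  let ?G = "braid_group n" and ?D = "signed_cone (\<lambda>_. True)"
  obtain f :: "nat \<Rightarrow> nat gword set"
    where f: "\<And>k. f k \<in> carrier ?G" "\<And>k. f k \<otimes>\<^bsub>?G\<^esub> \<sigma> (n - 1) \<otimes>\<^bsub>?G\<^esub> inv\<^bsub>?G\<^esub> (f k) \<in> positive 1"
    and lim: "\<And>\<epsilon>. \<epsilon> 1 \<Longrightarrow> limitin (ordering_topology ?G)
       (\<lambda>k. conjugate_ordering ?G (ordering_of_cone ?G (signed_cone \<epsilon>)) (f k))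
       (dehornoy_ordering n) sequentially"
    using conjugates_converge[OF assms] unfolding dehornoy_eq by blast
  \<comment> \<open>An accumulation point needs approximating orderings other than itself; an
    ordering given by a cone determines the cone, so \<open>conj_cone_neq\<close> provides
    this.\<close>
  have neq: "conjugate_ordering ?G (dehornoy_ordering n) (f k) \<noteq> dehornoy_ordering n" for k
  proof
    assume "conjugate_ordering ?G (dehornoy_ordering n) (f k) = dehornoy_ordering n"
    then have "ordering_of_cone ?G (conj_cone ?D (f k)) = ordering_of_cone ?G ?D"
      unfolding dehornoy_eq conjugate_ordering_of_cone[OF is_cone_signed_cone f(1)] .
    then have "conj_cone ?D (f k) = ?D"
      using positive_cone_of_cone[OF is_cone_signed_cone]
        positive_cone_of_cone[OF is_cone_conj[OF is_cone_signed_cone f(1)]] by metis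
    then show False using conj_cone_neq[OF assms f] by blast
  qed
  have "dehornoy_ordering n \<in> ordering_topology ?G derived_set_of conjugacy_orbit ?G (dehornoy_ordering n)"
    unfolding in_derived_set_of
  proof (intro conjI allI impI)
    note l = lim[of "\<lambda>_. True", folded dehornoy_eq]
    then show "dehornoy_ordering n \<in> topspace (ordering_topology ?G)" by (simp add: limitin_def)
    fix T assume "dehornoy_ordering n \<in> T \<and> openin (ordering_topology ?G) T"
    then have "eventually (\<lambda>k. conjugate_ordering ?G (dehornoy_ordering n) (f k) \<in> T) sequentially"
      using l by (simp add: limitin_def)
    then obtain k where "conjugate_ordering ?G (dehornoy_ordering n) (f k) \<in> T"
      unfolding eventually_sequentially by blast
    then show "\<exists>y. y \<noteq> dehornoy_ordering n \<and> y \<in> conjugacy_orbit ?G (dehornoy_ordering n) \<and> y \<in> T"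
      using neq f(1) unfolding conjugacy_orbit_def by blast
  qed
  moreover have "\<not> finitely_generated_semigroup ?G (positive_cone ?G (dehornoy_ordering n))"
    unfolding dehornoy_eq positive_cone_of_cone[OF is_cone_signed_cone]
    by (rule not_finitely_generated[OF assms])
  \<comment> \<open>The instance \<open>odd\<close> of the sign function, which is true at 1; the
    same conjugators are used.\<close>
  moreover have "limitin (ordering_topology ?G)
      (\<lambda>k. conjugate_ordering ?G (dubrovina_ordering n) (f k)) (dehornoy_ordering n) sequentially"
    unfolding dubrovina_eq[of n] by (rule lim) simp
  ultimately show ?thesis using f(1) by blast
qed

end
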